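(* Let $X$ and $Y$ be proper geodesic Morse center spaces with the small cross-ratio property. Suppose $h:\partial X\to\partial Y$ is a homeomorphism that is $2$-stable and quasi-möbius with $2$-stable and quasi-möbius inverse. Then for all $K$ sufficiently large, $h$ is induced by the map $f_K:X\to Y$ described in the context; that is, $f_K$ is a quasi-isometry and $(f_K)_*=h$.
   Context: **Quasi-geodesics, Morse.** $f:X\to Y$ is a $(\lambda,\varepsilon)$-quasi-isometric embedding ($\lambda\ge1,\varepsilon\ge0$) if $\frac1\lambda d_X(x,y)-\varepsilon\le d_Y(f(x),f(y))\le\lambda d_X(x,y)+\varepsilon$ for all $x,y$; it is a quasi-isometry if moreover there are $\hat f:Y\to X$ and $D\ge0$ with $d_X(\hat f f(x),x)\le D$, $d_Y(f\hat f(y),y)\le D$ for all $x,y$. A $(\lambda,\varepsilon)$-quasi-geodesic is a $(\lambda,\varepsilon)$-quasi-isometric embedding of a closed interval $I\subseteq\mathbb R$. A Morse gauge is a function $N:[1,\infty)\times[0,\infty)\to[0,\infty)$; a quasi-geodesic $\gamma$ is $N$-Morse if every $(\lambda,\varepsilon)$-quasi-geodesic with endpoints on $\gamma$ lies in the $N(\lambda,\varepsilon)$-neighborhood of $\gamma$. Convention: when a geodesic is said to be $N$-Morse, $N$ is assumed large enough that all its subgeodesics are also $N$-Morse. **Morse boundary.** Let $X$ be a proper geodesic metric space, $p\in X$. Rays are asymptotic if their images have finite Hausdorff distance. $\partial_vX_p$ is the set of asymptotism classes of geodesic rays based at $p$; $B\subseteq\partial_vX_p$ is closed iff: whenever $(b_n)$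 is a sequence in $B$, $\beta_n$ are rays based at $p$ with $[\beta_n]=b_n$, $b\in\partial_vX_p$, and every subsequence of $(\beta_n)$ has a further subsequence converging uniformly on compact sets to a ray in $b$, then $b\in B$. For a Morse gauge $N$, $\partial^NX_p\subseteq\partial_vX_p$ is the set of classes containing an $N$-Morse geodesic ray based at $p$, with the subspace topology. Gauges are partially ordered pointwise, and the Morse boundary is $\partial X=\partial_MX_p=\varinjlim_N\partial^NX_p=\bigcup_N\partial^NX_p$ with the direct limit topology. Changing the basepoint gives canonically homeomorphic boundaries (asymptotic rays correspond). A quasi-isometry $f:X\to Y$ induces a homeomorphism $f_*:\partial X\to\partial Y$ sending $[\gamma]$ to the class of geodesic rays at finite Hausdorff distance from $f(\gamma)$; $h$ is induced by $f$ if $h=f_*$. A bi-infinite (quasi-)geodesic $\gamma$ is from $a$ to $b$ ($a,b\in\partial X$) if $\gamma|_{(-\infty,0]}$ is asymptotic to a representative of $a$ and $\gamma|_{[0,\infty)}$ to a representative of $b$. **Centers, cross-ratio.** $\partial X^{(n,N)}$ is the set of $n$-tuples of pairwise distinct points of $\partial X$ such that every geodesic between any two of them is $N$-Morse. For $K>0$ and $(a,b,c)\in\partial X^{(3,N)}$, $m_X^{N,K}(a,b,c)$ is the set of $x\in X$ within $K$ of all three sides of some geodesic triangle with vertices $a,b,c$; its elements are called $K$-centers of $(a,b,c)$. For each gauge $N$, $K_N$ denotes a fixed constant such that every geodesic triangle (with vertices in the space or its Morse boundary) in either of the spaces all of whose sides are $N$-Morse has points $q_1,q_2,q_3$, one on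 each side, pairwise at distance at most $K_N$ (such constants exist); so $m_X^{N,K}$ takes non-empty values for $K\ge K_N$. The $N$-cross-ratio of $(a,b,c,d)\in\partial X^{(4,N)}$ is $[a,b,c,d]_N=\operatorname{diam}\big(m_X^{N,K_N}(a,b,c)\cup m_X^{N,K_N}(a,d,c)\big)$. **2-stable, quasi-möbius.** $h:\partial X\to\partial Y$ is $2$-stable if for every $N$ there is $N'$ with $h(\partial X^{(2,N)})\subseteq\partial Y^{(2,N')}$. A $2$-stable $h$ is quasi-möbius if for every pair of gauges $N,N'$ with $h(\partial X^{(2,N)})\subseteq\partial Y^{(2,N')}$ there is a continuous increasing $\psi:[0,\infty)\to[0,\infty)$ with $[h(a),h(b),h(c),h(d)]_{N'}\le\psi([a,b,c,d]_N)$ for all $(a,b,c,d)\in\partial X^{(4,N)}$. **Small cross-ratio property.** For each gauge $N$ there is $C>0$ such that for every $(a,b,c,d)\in\partial X^{(4,N)}$ at least one of $[a,b,c,d]_N$, $[a,c,b,d]_N$, $[b,a,c,d]_N$ is less than $C$. **Morse center space.** $X$ is an $N$-Morse center space if there is $K$ with $X=\bigcup_{(a,b,c)\in\partial X^{(3,N)}}m_X^{N,K}(a,b,c)$, and a Morse center space if this holds for some gauge $N$. **The map $f_K$.** Fix basepoints $p\in X$, $r\in Y$ and view $h$ as a map $\partial_MX_p\to\partial_MY_r$. Fix a gauge $N$ and a constant $K_0$ such that for all $K\ge K_0$, $X=\bigcup_{V\in\partial X^{(3,N)}}m_X^{N,K}(V)$ and $Y=\bigcup_{V\in\partial Y^{(3,N)}}m_Y^{N,K}(V)$,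 and a gauge $N_h\ge N$ with $h(\partial X^{(3,N)})\subseteq\partial Y^{(3,N_h)}$ (these exist since $X,Y$ are Morse center spaces and $h$ is $2$-stable). For $K\ge\max\{K_0,K_{N_h}\}$ set $f_K(p)=r$, and for each $x\in X\setminus\{p\}$ choose an ideal geodesic triangle $T_x$ with vertex tuple $(a,b,c)\in\partial X^{(3,N)}$ such that $x$ is within $K$ of each side of $T_x$, and let $f_K(x)$ be any chosen point of $m_Y^{N_h,K}(h(a),h(b),h(c))$. *)

theory Defs
  imports "HOL-Analysis.Analysis"
begin

section \<open>Quasi-isometries, geodesics and Morse gauges\<close>

definition quasi_isometric_embedding ::
    "real \<Rightarrow> real \<Rightarrow> 'a::metric_space set \<Rightarrow> ('a \<Rightarrow> 'b::metric_space) \<Rightarrow> bool" where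
  "quasi_isometric_embedding l e S f \<longleftrightarrow> l \<ge> 1 \<and> e \<ge> 0 \<and>
     (\<forall>x\<in>S. \<forall>y\<in>S. 1 / l * dist x y - e \<le> dist (f x) (f y) \<and> dist (f x) (f y) \<le> l * dist x y + e)"

definition quasi_isometry :: "('a::metric_space \<Rightarrow> 'b::metric_space) \<Rightarrow> bool" where
  "quasi_isometry f \<longleftrightarrow>
     (\<exists>l e. quasi_isometric_embedding l e UNIV f) \<and>
     (\<exists>g D. D \<ge> 0 \<and> (\<forall>x. dist (g (f x)) x \<le> D) \<and> (\<forall>y. dist (f (g y)) y \<le> D))"

definition closed_interval :: "real set \<Rightarrow> bool" where
  "closed_interval I \<longleftrightarrow> closed I \<and> is_interval I \<and> I \<noteq> {}"

definition geodesic_on :: "real set \<Rightarrow> (real \<Rightarrow> 'a::metric_space) \<Rightarrow> bool" where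
  "geodesic_on I \<gamma> \<longleftrightarrow> closed_interval I \<and> (\<forall>s\<in>I. \<forall>t\<in>I. dist (\<gamma> s) (\<gamma> t) = \<bar>s - t\<bar>)"

definition proper_geodesic_space :: "'a::metric_space itself \<Rightarrow> bool" where
  "proper_geodesic_space _ \<longleftrightarrow>
     (\<forall>(x::'a) \<rho>. compact (cball x \<rho>)) \<and>
     (\<forall>x y::'a. \<exists>\<gamma> s t. s \<le> t \<and> geodesic_on {s..t} \<gamma> \<and> \<gamma> s = x \<and> \<gamma> t = y)"

text \<open>
  Gauges are extensional functions, so that two gauges agreeing on the domain are equal and
  the pointwise order of gauges is the order \<open>\<le>\<close> on functions.
\<close>

type_synonym gauge = "real \<times> real \<Rightarrow> real"

definition morse_gauge :: "gauge \<Rightarrow> bool" where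
  "morse_gauge N \<longleftrightarrow> N \<in> ({1..} \<times> {0..}) \<rightarrow>\<^sub>E {0..}"

definition within_distance :: "real \<Rightarrow> 'a::metric_space \<Rightarrow> 'a set \<Rightarrow> bool" where
  "within_distance K x A \<longleftrightarrow> (\<exists>y\<in>A. dist x y \<le> K)"

definition morse_on :: "gauge \<Rightarrow> real set \<Rightarrow> (real \<Rightarrow> 'a::metric_space) \<Rightarrow> bool" where
  "morse_on N I \<gamma> \<longleftrightarrow>
     (\<forall>l e (s::real) t \<sigma>. s \<le> t \<and> quasi_isometric_embedding l e {s..t} \<sigma> \<and>
        \<sigma> s \<in> \<gamma> ` I \<and> \<sigma> t \<in> \<gamma> ` I \<longrightarrow>
        (\<forall>u\<in>{s..t}. within_distance (N (l, e)) (\<sigma> u) (\<gamma> ` I)))"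

text \<open>
  By convention an \<open>N\<close>-Morse geodesic is one all of whose subgeodesics (itself included)
  satisfy the \<open>N\<close>-Morse condition.
\<close>

definition morse_geodesic :: "gauge \<Rightarrow> real set \<Rightarrow> (real \<Rightarrow> 'a::metric_space) \<Rightarrow> bool" where
  "morse_geodesic N I \<gamma> \<longleftrightarrow> geodesic_on I \<gamma> \<and>
     (\<forall>J. closed_interval J \<and> J \<subseteq> I \<longrightarrow> morse_on N J \<gamma>)"

section \<open>The Morse boundary\<close>

definition finite_hausdorff :: "'a::metric_space set \<Rightarrow> 'a set \<Rightarrow> bool" where
  "finite_hausdorff A B \<longleftrightarrow>
     (\<exists>C. (\<forall>x\<in>A. within_distance C x B) \<and> (\<forall>y\<in>B. within_distance C y A))"

text \<open>
  Rays are functions on all of \<open>\<real>\<close> whose values at negative arguments are irrelevant;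
  these values do not affect the asymptotism relation either.
\<close>

definition geodesic_ray :: "'a::metric_space \<Rightarrow> (real \<Rightarrow> 'a) \<Rightarrow> bool" where
  "geodesic_ray p \<gamma> \<longleftrightarrow> geodesic_on {0..} \<gamma> \<and> \<gamma> 0 = p"

definition asymptotic_rel :: "'a::metric_space \<Rightarrow> ((real \<Rightarrow> 'a) \<times> (real \<Rightarrow> 'a)) set" where
  "asymptotic_rel p = {(\<alpha>, \<beta>). geodesic_ray p \<alpha> \<and> geodesic_ray p \<beta> \<and>
     finite_hausdorff (\<alpha> ` {0..}) (\<beta> ` {0..})}"

lemma within_distance_trans:
  assumes "\<And>x. x \<in> A \<Longrightarrow> within_distance C x B" and "\<And>y. y \<in> B \<Longrightarrow> within_distance D y E"
  shows "\<forall>x\<in>A. within_distance (C + D) x E"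
proof
  fix x assume "x \<in> A"
  then obtain y z where "y \<in> B" "dist x y \<le> C" "z \<in> E" "dist y z \<le> D"
    using assms unfolding within_distance_def by metis
  moreover have "dist x z \<le> dist x y + dist y z" by (rule dist_triangle)
  ultimately show "within_distance (C + D) x E"
    unfolding within_distance_def by (intro bexI[of _ z]) auto
qed

lemma finite_hausdorff_trans:
  assumes "finite_hausdorff A B" and "finite_hausdorff B E"
  shows "finite_hausdorff A E"
proof -
  from assms obtain C D where
    "\<And>x. x \<in> A \<Longrightarrow> within_distance C x B" "\<And>y. y \<in> B \<Longrightarrow> within_distance C y A"
    "\<And>x. x \<in> B \<Longrightarrow> within_distance D x E" "\<And>y. y \<in> E \<Longrightarrow> within_distance D y B"
    unfolding finite_hausdorff_def by blast
  then have "\<forall>x\<in>A. within_distance (C + D) x E" "\<forall>y\<in>E. within_distance (D + C) y A"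
    using within_distance_trans[of A C B D E] within_distance_trans[of E D B C A] by blast+
  then show ?thesis unfolding finite_hausdorff_def by (auto simp: add.commute)
qed

lemma equiv_asymptotic_rel: "equiv {\<gamma>. geodesic_ray p \<gamma>} (asymptotic_rel p)"
proof (rule equivI)
  have "finite_hausdorff A A" for A :: "'a set"
    unfolding finite_hausdorff_def within_distance_def by (intro exI[of _ 0]) auto
  then show "refl_on {\<gamma>. geodesic_ray p \<gamma>} (asymptotic_rel p)"
    by (auto simp: refl_on_def asymptotic_rel_def)
  show "sym (asymptotic_rel p)"
    by (auto simp: sym_def asymptotic_rel_def finite_hausdorff_def)
  show "trans (asymptotic_rel p)"
  proof (rule transI)
    fix \<alpha> \<beta> \<gamma> assume "(\<alpha>, \<beta>) \<in> asymptotic_rel p" and "(\<beta>, \<gamma>) \<in> asymptotic_rel p"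
    then show "(\<alpha>, \<gamma>) \<in> asymptotic_rel p"
      using finite_hausdorff_trans[of "\<alpha> ` {0..}" "\<beta> ` {0..}" "\<gamma> ` {0..}"]
      by (simp add: asymptotic_rel_def)
  qed
  show "asymptotic_rel p \<subseteq> {\<gamma>. geodesic_ray p \<gamma>} \<times> {\<gamma>. geodesic_ray p \<gamma>}"
    unfolding asymptotic_rel_def by blast
qed

type_synonym 'a bpoint = "(real \<Rightarrow> 'a) set"

definition visual_boundary :: "'a::metric_space \<Rightarrow> 'a bpoint set" where
  "visual_boundary p = {\<gamma>. geodesic_ray p \<gamma>} // asymptotic_rel p"

definition subconverges :: "(nat \<Rightarrow> real \<Rightarrow> 'a::metric_space) \<Rightarrow> 'a bpoint \<Rightarrow> bool" where
  "subconverges \<beta> b \<longleftrightarrow>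
     (\<forall>s. strict_mono (s :: nat \<Rightarrow> nat) \<longrightarrow>
       (\<exists>s'. strict_mono (s' :: nat \<Rightarrow> nat) \<and>
         (\<exists>\<gamma>\<in>b. \<forall>C. compact C \<and> C \<subseteq> {0..} \<longrightarrow>
            uniform_limit C (\<lambda>n. \<beta> (s (s' n))) \<gamma> sequentially)))"

definition visual_closed :: "'a::metric_space \<Rightarrow> 'a bpoint set \<Rightarrow> bool" where
  "visual_closed p B \<longleftrightarrow> B \<subseteq> visual_boundary p \<and>
     (\<forall>\<beta> b. (\<forall>n. \<exists>c\<in>B. \<beta> n \<in> c) \<and> b \<in> visual_boundary p \<and> subconverges \<beta> b \<longrightarrow> b \<in> B)"

definition visual_topology :: "'a::metric_space \<Rightarrow> 'a bpoint topology" where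
  "visual_topology p =
     topology (\<lambda>U. U \<subseteq> visual_boundary p \<and> visual_closed p (visual_boundary p - U))"

definition morse_stratum :: "'a::metric_space \<Rightarrow> gauge \<Rightarrow> 'a bpoint set" where
  "morse_stratum p N = {b \<in> visual_boundary p. \<exists>\<gamma>\<in>b. morse_geodesic N {0..} \<gamma>}"

definition morse_boundary :: "'a::metric_space \<Rightarrow> 'a bpoint set" where
  "morse_boundary p = (\<Union>N\<in>Collect morse_gauge. morse_stratum p N)"

definition morse_topology :: "'a::metric_space \<Rightarrow> 'a bpoint topology" where
  "morse_topology p =
     topology (\<lambda>U. U \<subseteq> morse_boundary p \<and>
       (\<forall>N. morse_gauge N \<longrightarrow>
          openin (subtopology (visual_topology p) (morse_stratum p N)) (U \<inter> morse_stratum p N)))"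

text \<open>The two families of open sets above are indeed topologies.\<close>

lemma subconverges_subseq:
  assumes "subconverges \<beta> b" and "strict_mono (r :: nat \<Rightarrow> nat)"
  shows "subconverges (\<lambda>n. \<beta> (r n)) b"
  unfolding subconverges_def
proof (intro allI impI)
  fix s :: "nat \<Rightarrow> nat" assume "strict_mono s"
  then have "strict_mono (\<lambda>n. r (s n))"
    using assms(2) by (simp add: strict_mono_def)
  then show "\<exists>s'. strict_mono (s' :: nat \<Rightarrow> nat) \<and>
         (\<exists>\<gamma>\<in>b. \<forall>C. compact C \<and> C \<subseteq> {0..} \<longrightarrow>
            uniform_limit C (\<lambda>n. \<beta> (r (s (s' n)))) \<gamma> sequentially)"
    using assms(1)[unfolded subconverges_def, rule_format, of "\<lambda>n. r (s n)"] by simp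
qed

lemma visual_closedD:
  assumes "visual_closed p B" and "\<And>n. \<exists>c\<in>B. \<beta> n \<in> c" and "b \<in> visual_boundary p"
    and "subconverges \<beta> b"
  shows "b \<in> B"
proof -
  have "\<forall>n. \<exists>c\<in>B. \<beta> n \<in> c" using assms(2) by (rule allI)
  with assms(1,3,4) show ?thesis unfolding visual_closed_def by blast
qed

lemma visual_closed_Un:
  assumes B: "visual_closed p B" and C: "visual_closed p C"
  shows "visual_closed p (B \<union> C)"
  unfolding visual_closed_def
proof (intro conjI allI impI)
  show "B \<union> C \<subseteq> visual_boundary p"
    using B C by (auto simp: visual_closed_def)
next
  fix \<beta> b
  assume H: "(\<forall>n. \<exists>c\<in>B \<union> C. \<beta> n \<in> c) \<and> b \<in> visual_boundary p \<and> subconverges \<beta> b"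
  have sub: "b \<in> A" if A: "visual_closed p A" and inf: "infinite {n. \<exists>c\<in>A. \<beta> n \<in> c}" for A
  proof -
    obtain r :: "nat \<Rightarrow> nat" where r: "strict_mono r" "\<And>n. r n \<in> {n. \<exists>c\<in>A. \<beta> n \<in> c}"
      using infinite_enumerate[OF inf] by blast
    show ?thesis
    proof (rule visual_closedD[OF A])
      show "\<exists>c\<in>A. \<beta> (r n) \<in> c" for n using r(2) by blast
      show "subconverges (\<lambda>n. \<beta> (r n)) b" using H r(1) by (simp add: subconverges_subseq)
    qed (use H in simp)
  qed
  have "{n. \<exists>c\<in>B. \<beta> n \<in> c} \<union> {n. \<exists>c\<in>C. \<beta> n \<in> c} = UNIV"
    using H by blast
  then have "\<not> (finite {n. \<exists>c\<in>B. \<beta> n \<in> c} \<and> finite {n. \<exists>c\<in>C. \<beta> n \<in> c})"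
    unfolding finite_Un[symmetric] by (simp only: infinite_UNIV_nat not_False_eq_True)
  then show "b \<in> B \<union> C"
    using sub[OF B] sub[OF C] by blast
qed

lemma visual_closed_Inter:
  assumes "\<F> \<noteq> {}" and "\<And>B. B \<in> \<F> \<Longrightarrow> visual_closed p B"
  shows "visual_closed p (\<Inter>\<F>)"
  unfolding visual_closed_def
proof (intro conjI allI impI)
  show "\<Inter>\<F> \<subseteq> visual_boundary p"
    using assms by (auto simp: visual_closed_def)
next
  fix \<beta> b
  assume H: "(\<forall>n. \<exists>c\<in>\<Inter>\<F>. \<beta> n \<in> c) \<and> b \<in> visual_boundary p \<and> subconverges \<beta> b"
  show "b \<in> \<Inter>\<F>"
  proof
    fix B assume "B \<in> \<F>"
    moreover from this have "\<exists>c\<in>B. \<beta> n \<in> c" for n using H by blast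
    ultimately show "b \<in> B" using H assms(2) visual_closedD[of p B \<beta> b] by simp
  qed
qed

lemma visual_closed_empty: "visual_closed p {}"
  by (simp add: visual_closed_def)

lemma visual_closed_boundary: "visual_closed p (visual_boundary p)"
  by (simp add: visual_closed_def)

lemma openin_visual_topology:
  "openin (visual_topology p) U \<longleftrightarrow>
     U \<subseteq> visual_boundary p \<and> visual_closed p (visual_boundary p - U)"
proof -
  have "istopology (\<lambda>U. U \<subseteq> visual_boundary p \<and> visual_closed p (visual_boundary p - U))"
    unfolding istopology_def
  proof (intro conjI allI impI)
    fix S T
    assume "S \<subseteq> visual_boundary p \<and> visual_closed p (visual_boundary p - S)"
      and "T \<subseteq> visual_boundary p \<and> visual_closed p (visual_boundary p - T)"
    then show "S \<inter> T \<subseteq> visual_boundary p" "visual_closed p (visual_boundary p - S \<inter> T)"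
      by (auto simp: Diff_Int visual_closed_Un)
  next
    fix \<K>
    assume K: "\<forall>S\<in>\<K>. S \<subseteq> visual_boundary p \<and> visual_closed p (visual_boundary p - S)"
    then show "\<Union>\<K> \<subseteq> visual_boundary p" by blast
    let ?\<F> = "insert (visual_boundary p) ((\<lambda>S. visual_boundary p - S) ` \<K>)"
    have "visual_closed p (\<Inter>?\<F>)"
    proof (rule visual_closed_Inter)
      show "visual_closed p B" if "B \<in> ?\<F>" for B
        using that K visual_closed_boundary[of p] by blast
    qed simp
    moreover have "visual_boundary p - \<Union>\<K> = \<Inter>?\<F>" by auto
    ultimately show "visual_closed p (visual_boundary p - \<Union>\<K>)" by simp
  qed
  from topology_inverse'[OF this] show ?thesis by (simp only: visual_topology_def)
qed

lemma topspace_visual_topology [simp]: "topspace (visual_topology p) = visual_boundary p"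
proof -
  have "openin (visual_topology p) (visual_boundary p)"
    unfolding openin_visual_topology Diff_cancel using visual_closed_empty by blast
  then have "visual_boundary p \<subseteq> topspace (visual_topology p)" by (rule openin_subset)
  moreover have "topspace (visual_topology p) \<subseteq> visual_boundary p"
    using openin_topspace[of "visual_topology p"] unfolding openin_visual_topology by (rule conjunct1)
  ultimately show ?thesis by (rule subset_antisym[rotated])
qed

lemma openin_morse_topology:
  "openin (morse_topology p) U \<longleftrightarrow> U \<subseteq> morse_boundary p \<and>
     (\<forall>N. morse_gauge N \<longrightarrow>
        openin (subtopology (visual_topology p) (morse_stratum p N)) (U \<inter> morse_stratum p N))"
proof -
  let ?\<tau> = "\<lambda>N. subtopology (visual_topology p) (morse_stratum p N)"
  let ?L = "\<lambda>U. U \<subseteq> morse_boundary p \<and>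
       (\<forall>N. morse_gauge N \<longrightarrow> openin (?\<tau> N) (U \<inter> morse_stratum p N))"
  have Int: "?L (S \<inter> T)" if S: "?L S" and T: "?L T" for S T
  proof (intro conjI allI impI)
    show "S \<inter> T \<subseteq> morse_boundary p" using S by blast
  next
    fix N assume N: "morse_gauge N"
    have "openin (?\<tau> N) ((S \<inter> morse_stratum p N) \<inter> (T \<inter> morse_stratum p N))"
      by (rule openin_Int[OF S[THEN conjunct2, rule_format, OF N] T[THEN conjunct2, rule_format, OF N]])
    moreover have "(S \<inter> morse_stratum p N) \<inter> (T \<inter> morse_stratum p N) = S \<inter> T \<inter> morse_stratum p N"
      by blast
    ultimately show "openin (?\<tau> N) (S \<inter> T \<inter> morse_stratum p N)" by (simp only:)
  qed
  have Union: "?L (\<Union>\<K>)" if K: "\<forall>S\<in>\<K>. ?L S" for \<K>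
  proof (intro conjI allI impI)
    show "\<Union>\<K> \<subseteq> morse_boundary p" using K by blast
  next
    fix N assume N: "morse_gauge N"
    have "openin (?\<tau> N) (\<Union>((\<lambda>S. S \<inter> morse_stratum p N) ` \<K>))"
    proof (rule openin_Union)
      fix A assume "A \<in> (\<lambda>S. S \<inter> morse_stratum p N) ` \<K>"
      then obtain S where "S \<in> \<K>" and A: "A = S \<inter> morse_stratum p N" by (rule imageE)
      show "openin (?\<tau> N) A"
        unfolding A by (rule K[rule_format, OF \<open>S \<in> \<K>\<close>, THEN conjunct2, rule_format, OF N])
    qed
    moreover have "\<Union>((\<lambda>S. S \<inter> morse_stratum p N) ` \<K>) = \<Union>\<K> \<inter> morse_stratum p N"
      by blast
    ultimately show "openin (?\<tau> N) (\<Union>\<K> \<inter> morse_stratum p N)" by (simp only:)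
  qed
  have "istopology ?L"
    unfolding istopology_def
  proof (rule conjI; (rule allI)+; (rule impI)+)
    show "?L (S \<inter> T)" if "?L S" "?L T" for S T using that by (rule Int)
    show "?L (\<Union>\<K>)" if "\<forall>S\<in>\<K>. ?L S" for \<K> using that by (rule Union)
  qed
  from topology_inverse'[OF this] show ?thesis by (simp only: morse_topology_def)
qed

lemma topspace_morse_topology [simp]: "topspace (morse_topology p) = morse_boundary p"
proof -
  have "morse_boundary p \<inter> morse_stratum p N = morse_stratum p N" if "morse_gauge N" for N
    using that by (auto simp: morse_boundary_def)
  moreover have "openin (subtopology (visual_topology p) (morse_stratum p N)) (morse_stratum p N)" for N
  proof -
    have "topspace (subtopology (visual_topology p) (morse_stratum p N)) = morse_stratum p N"
      by (auto simp: morse_stratum_def)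
    then show ?thesis by (metis openin_topspace)
  qed
  ultimately have "openin (morse_topology p) (morse_boundary p)"
    unfolding openin_morse_topology by (metis subset_refl)
  then have "morse_boundary p \<subseteq> topspace (morse_topology p)" by (rule openin_subset)
  moreover have "topspace (morse_topology p) \<subseteq> morse_boundary p"
    using openin_topspace[of "morse_topology p"] unfolding openin_morse_topology by (rule conjunct1)
  ultimately show ?thesis by (rule subset_antisym[rotated])
qed

section \<open>Lines, triangles, centers and cross-ratios\<close>

definition asymptotic_to :: "'a::metric_space set \<Rightarrow> 'a bpoint \<Rightarrow> bool" where
  "asymptotic_to A b \<longleftrightarrow> (\<exists>\<beta>\<in>b. finite_hausdorff A (\<beta> ` {0..}))"

definition line_between :: "'a::metric_space bpoint \<Rightarrow> 'a bpoint \<Rightarrow> (real \<Rightarrow> 'a) \<Rightarrow> bool" where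
  "line_between a b \<gamma> \<longleftrightarrow> geodesic_on UNIV \<gamma> \<and>
     asymptotic_to (\<gamma> ` {..0}) a \<and> asymptotic_to (\<gamma> ` {0..}) b"

text \<open>
  Geodesics \<open>\<gamma>\<close>, defined on \<open>I\<close>, joining two vertices, each of which is a point of the
  space (\<open>Inl\<close>) or of its boundary (\<open>Inr\<close>).
\<close>

fun geodesic_side ::
    "'a::metric_space + 'a bpoint \<Rightarrow> 'a + 'a bpoint \<Rightarrow> real set \<Rightarrow> (real \<Rightarrow> 'a) \<Rightarrow> bool" where
  "geodesic_side (Inl x) (Inl y) I \<gamma> \<longleftrightarrow>
     (\<exists>s t. s \<le> t \<and> I = {s..t} \<and> geodesic_on I \<gamma> \<and> \<gamma> s = x \<and> \<gamma> t = y)"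
| "geodesic_side (Inl x) (Inr b) I \<gamma> \<longleftrightarrow>
     I = {0..} \<and> geodesic_ray x \<gamma> \<and> asymptotic_to (\<gamma> ` {0..}) b"
| "geodesic_side (Inr a) (Inl y) I \<gamma> \<longleftrightarrow>
     I = {0..} \<and> geodesic_ray y \<gamma> \<and> asymptotic_to (\<gamma> ` {0..}) a"
| "geodesic_side (Inr a) (Inr b) I \<gamma> \<longleftrightarrow> I = UNIV \<and> line_between a b \<gamma>"

definition triangle_constant :: "'a::metric_space \<Rightarrow> gauge \<Rightarrow> real \<Rightarrow> bool" where
  "triangle_constant p N K \<longleftrightarrow>
     (\<forall>u v w I\<^sub>1 I\<^sub>2 I\<^sub>3 \<gamma>\<^sub>1 \<gamma>\<^sub>2 \<gamma>\<^sub>3.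
        {u, v, w} \<subseteq> range Inl \<union> Inr ` morse_boundary p \<and>
        geodesic_side u v I\<^sub>1 \<gamma>\<^sub>1 \<and> geodesic_side v w I\<^sub>2 \<gamma>\<^sub>2 \<and> geodesic_side w u I\<^sub>3 \<gamma>\<^sub>3 \<and>
        morse_geodesic N I\<^sub>1 \<gamma>\<^sub>1 \<and> morse_geodesic N I\<^sub>2 \<gamma>\<^sub>2 \<and> morse_geodesic N I\<^sub>3 \<gamma>\<^sub>3 \<longrightarrow>
        (\<exists>q\<^sub>1\<in>\<gamma>\<^sub>1 ` I\<^sub>1. \<exists>q\<^sub>2\<in>\<gamma>\<^sub>2 ` I\<^sub>2. \<exists>q\<^sub>3\<in>\<gamma>\<^sub>3 ` I\<^sub>3.
           dist q\<^sub>1 q\<^sub>2 \<le> K \<and> dist q\<^sub>2 q\<^sub>3 \<le> K \<and> dist q\<^sub>3 q\<^sub>1 \<le> K))"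

text \<open>\<open>morse_tuples p n N\<close> is the set \<open>\<partial>X\<close> with superscript \<open>(n, N)\<close>; tuples are lists.\<close>

definition morse_tuples :: "'a::metric_space \<Rightarrow> nat \<Rightarrow> gauge \<Rightarrow> 'a bpoint list set" where
  "morse_tuples p n N = {bs. length bs = n \<and> distinct bs \<and> set bs \<subseteq> morse_boundary p \<and>
     (\<forall>a\<in>set bs. \<forall>b\<in>set bs. a \<noteq> b \<longrightarrow> (\<forall>\<gamma>. line_between a b \<gamma> \<longrightarrow> morse_geodesic N UNIV \<gamma>))}"

definition ideal_triangle :: "'a::metric_space bpoint \<Rightarrow> 'a bpoint \<Rightarrow> 'a bpoint \<Rightarrow>
    (real \<Rightarrow> 'a) \<times> (real \<Rightarrow> 'a) \<times> (real \<Rightarrow> 'a) \<Rightarrow> bool" where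
  "ideal_triangle a b c = (\<lambda>(\<alpha>, \<beta>, \<gamma>). line_between a b \<alpha> \<and> line_between b c \<beta> \<and> line_between c a \<gamma>)"

definition close_to_sides :: "real \<Rightarrow> 'a::metric_space \<Rightarrow>
    (real \<Rightarrow> 'a) \<times> (real \<Rightarrow> 'a) \<times> (real \<Rightarrow> 'a) \<Rightarrow> bool" where
  "close_to_sides K x = (\<lambda>(\<alpha>, \<beta>, \<gamma>). within_distance K x (range \<alpha>) \<and>
     within_distance K x (range \<beta>) \<and> within_distance K x (range \<gamma>))"

text \<open>
  The set of \<open>K\<close>-centers. The gauge decorating \<open>m\<close> only records the domain
  (tuples in \<open>morse_tuples p 3 N\<close>); it does not enter the value.
\<close>

definition centers :: "real \<Rightarrow> 'a::metric_space bpoint \<Rightarrow> 'a bpoint \<Rightarrow> 'a bpoint \<Rightarrow> 'a set" where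
  "centers K a b c = {x. \<exists>T. ideal_triangle a b c T \<and> close_to_sides K x T}"

definition covered_by_centers :: "'a::metric_space \<Rightarrow> gauge \<Rightarrow> real \<Rightarrow> bool" where
  "covered_by_centers p N K \<longleftrightarrow>
     (UNIV :: 'a set) = (\<Union>(a, b, c)\<in>{(a, b, c). [a, b, c] \<in> morse_tuples p 3 N}. centers K a b c)"

definition morse_center_space :: "'a::metric_space \<Rightarrow> bool" where
  "morse_center_space p \<longleftrightarrow> (\<exists>N K. morse_gauge N \<and> K > 0 \<and> covered_by_centers p N K)"

text \<open>
  From here on \<open>\<kappa>\<close> is the family of constants \<open>K\<^sub>N\<close> entering the cross-ratio. The sets
  of centers occurring in it are bounded, so \<open>diameter\<close> takes no default value.
\<close>

definition cross_ratio :: "(gauge \<Rightarrow> real) \<Rightarrow> gauge \<Rightarrow>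
    'a::metric_space bpoint \<Rightarrow> 'a bpoint \<Rightarrow> 'a bpoint \<Rightarrow> 'a bpoint \<Rightarrow> real" where
  "cross_ratio \<kappa> N a b c d = diameter (centers (\<kappa> N) a b c \<union> centers (\<kappa> N) a d c)"

definition small_cross_ratio :: "(gauge \<Rightarrow> real) \<Rightarrow> 'a::metric_space \<Rightarrow> bool" where
  "small_cross_ratio \<kappa> p \<longleftrightarrow>
     (\<forall>N. morse_gauge N \<longrightarrow>
       (\<exists>C>0. \<forall>a b c d. [a, b, c, d] \<in> morse_tuples p 4 N \<longrightarrow>
          cross_ratio \<kappa> N a b c d < C \<or> cross_ratio \<kappa> N a c b d < C \<or> cross_ratio \<kappa> N b a c d < C))"

section \<open>Maps between boundaries\<close>

definition two_stable :: "'a::metric_space \<Rightarrow> 'b::metric_space \<Rightarrow> ('a bpoint \<Rightarrow> 'b bpoint) \<Rightarrow> bool" where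
  "two_stable p r h \<longleftrightarrow>
     (\<forall>N. morse_gauge N \<longrightarrow>
       (\<exists>N'. morse_gauge N' \<and> map h ` morse_tuples p 2 N \<subseteq> morse_tuples r 2 N'))"

definition quasi_moebius :: "(gauge \<Rightarrow> real) \<Rightarrow> 'a::metric_space \<Rightarrow> 'b::metric_space \<Rightarrow>
    ('a bpoint \<Rightarrow> 'b bpoint) \<Rightarrow> bool" where
  "quasi_moebius \<kappa> p r h \<longleftrightarrow>
     (\<forall>N N'. morse_gauge N \<and> morse_gauge N' \<and> map h ` morse_tuples p 2 N \<subseteq> morse_tuples r 2 N' \<longrightarrow>
       (\<exists>\<psi>. continuous_on {0..} \<psi> \<and> mono_on {0..} \<psi> \<and> \<psi> ` {0..} \<subseteq> {0..} \<and>
         (\<forall>a b c d. [a, b, c, d] \<in> morse_tuples p 4 N \<longrightarrow>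
            cross_ratio \<kappa> N' (h a) (h b) (h c) (h d) \<le> \<psi> (cross_ratio \<kappa> N a b c d))))"

text \<open>The boundary map \<open>f\<^sub>*\<close> of a quasi-isometry, with values in rays based at \<open>r\<close>.\<close>

definition induced_map :: "'b::metric_space \<Rightarrow> ('a::metric_space \<Rightarrow> 'b) \<Rightarrow> 'a bpoint \<Rightarrow> 'b bpoint" where
  "induced_map r f b =
     {\<beta>. geodesic_ray r \<beta> \<and> (\<exists>\<gamma>\<in>b. finite_hausdorff (f ` \<gamma> ` {0..}) (\<beta> ` {0..}))}"

text \<open>
  \<open>f\<close> is one of the maps \<open>f\<^sub>K\<close>; the choices made in the construction are expressed by
  existential quantification.
\<close>

definition center_map :: "'a::metric_space \<Rightarrow> 'b::metric_space \<Rightarrow> ('a bpoint \<Rightarrow> 'b bpoint) \<Rightarrow>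
    gauge \<Rightarrow> real \<Rightarrow> ('a \<Rightarrow> 'b) \<Rightarrow> bool" where
  "center_map p r h N K f \<longleftrightarrow> f p = r \<and>
     (\<forall>x. x \<noteq> p \<longrightarrow>
       (\<exists>a b c T. [a, b, c] \<in> morse_tuples p 3 N \<and> ideal_triangle a b c T \<and> close_to_sides K x T \<and>
          f x \<in> centers K (h a) (h b) (h c)))"

end

(* The Morse property is studied for arbitrary subsets of a geodesic space: it passes to sets at finite
   Hausdorff distance and to unions of two sets with a common point, and a geodesic running between
   points of a Morse set and close to it stays uniformly close to it. For boundary points reached by
   uniformly Morse rays from near x, this makes all connecting lines uniformly Morse and all ideal
   triangles uniformly slim, so around x the boundary behaves as in a hyperbolic space. If x and x' are
   nearby centers of two triples, the first triple can therefore be turned into the second by changing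
   one point at a time with x remaining a coarse center; every change is controlled by a cross-ratio, so
   by the quasi-moebius property the centers of the image triples are close. Applied to h and to its
   inverse this gives coarse Lipschitz maps that are coarse inverses of each other.

   For f_* = h, take b and two further points c, d. Every point of a line from c to b is a coarse center
   of (c, b, i) for some i, so f maps that line close to a line from h c to h b. Hence the image of a
   ray to b is asymptotic to h c or h b, and likewise to h d or h b, so it is asymptotic to h b. *)

theory Submission
  imports Defs
begin

section \<open>Quasi-geodesics and nearest points\<close>

text \<open>Gauges vary with the pair of boundary points, and asymptoticity supplies only some
  finite distance \<open>H\<close> without any bound. The recurring device against both is to
  prolong a path from its (almost) nearest point to a target \<open>z\<close> by a geodesic ending
  at \<open>z\<close>. One such hook turns constants \<open>(l, e)\<close> into
  \<open>(3 * l, e + 2)\<close>, and two turn a geodesic into a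
  \<open>(9, 4)\<close>-quasi-geodesic, whatever the length of the hooks. The Morse property then
  applies although the given path does not end in the Morse set, and an unknown \<open>H\<close>
  only influences how far out the hooks are attached; hence the ubiquitous \<open>N (9, 4)\<close>.
  A second obstacle is that points of two different triples need not form Morse pairs for a common
  gauge; but all points reached from near \<open>x\<close> do, for a gauge independent of
  \<open>x\<close>. Finally, the cross-ratio of \<open>u, w, v, w'\<close> is the diameter of the
  union of the centers of \<open>(u, w, v)\<close> and \<open>(u, w', v)\<close>, so it measures
  exactly the exchange of one point of a triple.\<close>

abbreviation qie :: "real \<Rightarrow> real \<Rightarrow> 'a::metric_space set \<Rightarrow> ('a \<Rightarrow> 'b::metric_space) \<Rightarrow> bool" where
  "qie \<equiv> quasi_isometric_embedding"

definition morse_set :: "gauge \<Rightarrow> 'a::metric_space set \<Rightarrow> bool" where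
  "morse_set N A \<longleftrightarrow>
     (\<forall>l e (s::real) t \<sigma>. s \<le> t \<and> qie l e {s..t} \<sigma> \<and> \<sigma> s \<in> A \<and> \<sigma> t \<in> A \<longrightarrow>
        (\<forall>u\<in>{s..t}. within_distance (N (l, e)) (\<sigma> u) A))"

lemma morse_on_iff: "morse_on N I \<gamma> \<longleftrightarrow> morse_set N (\<gamma> ` I)"
  unfolding morse_on_def morse_set_def ..

lemma morse_setD:
  fixes s t u :: real
  assumes "morse_set N A" "s \<le> t" "qie l e {s..t} \<sigma>" "\<sigma> s \<in> A" "\<sigma> t \<in> A" "u \<in> {s..t}"
  shows "within_distance (N (l, e)) (\<sigma> u) A"
  using assms(1)[unfolded morse_set_def, rule_format, of s t l e \<sigma> u] assms(2-) by blast

lemma within_distance_mono: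
  assumes "within_distance C x A" "C \<le> D" "A \<subseteq> B"
  shows "within_distance D x B"
proof -
  obtain y where "y \<in> A" "dist x y \<le> C" using assms(1) unfolding within_distance_def by blast
  with assms(2,3) show ?thesis unfolding within_distance_def by (intro bexI[of _ y]) auto
qed

lemma within_distance_triangle:
  assumes "within_distance C y A" "dist x y \<le> D"
  shows "within_distance (C + D) x A"
proof -
  obtain z where "z \<in> A" "dist y z \<le> C" using assms(1) unfolding within_distance_def by blast
  moreover have "dist x z \<le> dist x y + dist y z" by (rule dist_triangle)
  ultimately show ?thesis unfolding within_distance_def using assms(2) by (intro bexI[of _ z]) auto
qed

lemma within_distance_nonneg: "within_distance C x A \<Longrightarrow> 0 \<le> C"
  unfolding within_distance_def by (elim bexE order_trans[OF zero_le_dist])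

lemma within_distance_self: "x \<in> A \<Longrightarrow> 0 \<le> C \<Longrightarrow> within_distance C x A"
  unfolding within_distance_def by (intro bexI[of _ x]) auto

lemma qieD:
  assumes "qie l e S \<sigma>"
  shows "1 \<le> l" "0 \<le> e"
    "x \<in> S \<Longrightarrow> y \<in> S \<Longrightarrow> dist x y / l - e \<le> dist (\<sigma> x) (\<sigma> y)"
    "x \<in> S \<Longrightarrow> y \<in> S \<Longrightarrow> dist (\<sigma> x) (\<sigma> y) \<le> l * dist x y + e"
  using assms unfolding quasi_isometric_embedding_def by auto

lemma qie_inverse_bound:
  assumes "qie l e S \<sigma>" "x \<in> S" "y \<in> S" "dist (\<sigma> x) (\<sigma> y) \<le> C"
  shows "dist x y \<le> l * (C + e)"
proof -
  have "dist x y / l \<le> C + e" using qieD(3)[OF assms(1-3)] assms(4) by linarith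
  then show ?thesis using qieD(1)[OF assms(1)] by (simp add: pos_divide_le_eq mult.commute)
qed

lemma qieI_ordered:
  fixes S :: "real set"
  assumes "1 \<le> l" "0 \<le> e"
    and "\<And>u v. u \<in> S \<Longrightarrow> v \<in> S \<Longrightarrow> u \<le> v \<Longrightarrow> (v - u) / l - e \<le> dist (\<sigma> u) (\<sigma> v)"
    and "\<And>u v. u \<in> S \<Longrightarrow> v \<in> S \<Longrightarrow> u \<le> v \<Longrightarrow> dist (\<sigma> u) (\<sigma> v) \<le> l * (v - u) + e"
  shows "qie l e S \<sigma>"
  unfolding quasi_isometric_embedding_def
proof (intro conjI ballI)
  fix x y assume "x \<in> S" "y \<in> S"
  show "1 / l * dist x y - e \<le> dist (\<sigma> x) (\<sigma> y)"
  proof (cases "x \<le> y")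
    case True then show ?thesis using assms(3)[of x y] \<open>x \<in> S\<close> \<open>y \<in> S\<close> by (simp add: dist_real_def)
  next
    case False then show ?thesis using assms(3)[of y x] \<open>x \<in> S\<close> \<open>y \<in> S\<close>
      by (simp add: dist_real_def dist_commute)
  qed
  show "dist (\<sigma> x) (\<sigma> y) \<le> l * dist x y + e"
  proof (cases "x \<le> y")
    case True then show ?thesis using assms(4)[of x y] \<open>x \<in> S\<close> \<open>y \<in> S\<close> by (simp add: dist_real_def)
  next
    case False then show ?thesis using assms(4)[of y x] \<open>x \<in> S\<close> \<open>y \<in> S\<close>
      by (simp add: dist_real_def dist_commute)
  qed
qed (use assms in auto)

lemma qie_subset: "qie l e S \<sigma> \<Longrightarrow> T \<subseteq> S \<Longrightarrow> qie l e T \<sigma>"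
  unfolding quasi_isometric_embedding_def by blast

lemma qie_perturb:
  assumes "qie l e S \<sigma>" "0 \<le> D" "\<And>u. u \<in> S \<Longrightarrow> dist (\<sigma>' u) (\<sigma> u) \<le> D"
  shows "qie l (e + 2 * D) S \<sigma>'"
  unfolding quasi_isometric_embedding_def
proof (intro conjI ballI)
  show "1 \<le> l" "0 \<le> e + 2 * D" using qieD[OF assms(1)] assms(2) by auto
  fix x y assume xy: "x \<in> S" "y \<in> S"
  have "\<bar>dist (\<sigma>' x) (\<sigma>' y) - dist (\<sigma> x) (\<sigma> y)\<bar> \<le> 2 * D"
    using assms(3)[OF xy(1)] assms(3)[OF xy(2)]
      dist_triangle[of "\<sigma>' x" "\<sigma>' y" "\<sigma> x"] dist_triangle[of "\<sigma> x" "\<sigma>' y" "\<sigma> y"]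
      dist_triangle[of "\<sigma> x" "\<sigma> y" "\<sigma>' x"] dist_triangle[of "\<sigma>' x" "\<sigma> y" "\<sigma>' y"]
    by (auto simp: dist_commute)
  then show "1 / l * dist x y - (e + 2 * D) \<le> dist (\<sigma>' x) (\<sigma>' y)"
    "dist (\<sigma>' x) (\<sigma>' y) \<le> l * dist x y + (e + 2 * D)"
    using qieD(3,4)[OF assms(1) xy] by auto
qed

lemma qie_isometry_compose:
  assumes "qie l e S \<sigma>" "\<And>u. u \<in> T \<Longrightarrow> \<phi> u \<in> S" "\<And>u v. u \<in> T \<Longrightarrow> v \<in> T \<Longrightarrow> dist (\<phi> u) (\<phi> v) = dist u v"
  shows "qie l e T (\<lambda>u. \<sigma> (\<phi> u))"
  using assms unfolding quasi_isometric_embedding_def by metis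

lemma geodesic_onD:
  "geodesic_on I \<gamma> \<Longrightarrow> s \<in> I \<Longrightarrow> t \<in> I \<Longrightarrow> dist (\<gamma> s) (\<gamma> t) = \<bar>s - t\<bar>"
  unfolding geodesic_on_def by blast

lemma geodesic_qie:
  assumes "geodesic_on I \<gamma>" "S \<subseteq> I"
  shows "qie 1 0 S \<gamma>"
  using geodesic_onD[OF assms(1)] assms(2)
  unfolding quasi_isometric_embedding_def dist_real_def by (simp add: subset_iff)

lemma geodesic_on_subset:
  "geodesic_on I \<gamma> \<Longrightarrow> closed_interval J \<Longrightarrow> J \<subseteq> I \<Longrightarrow> geodesic_on J \<gamma>"
  unfolding geodesic_on_def by blast

lemma closed_interval_simps [simp]:
  "closed_interval (UNIV :: real set)" "closed_interval {a..}" "closed_interval {..a}"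
  "closed_interval {a..b} \<longleftrightarrow> a \<le> b"
  unfolding closed_interval_def by (auto simp: is_interval_def)

lemma geodesic_on_shift:
  assumes "geodesic_on UNIV \<gamma>"
  shows "geodesic_on UNIV (\<lambda>t. \<gamma> (s + t))" "geodesic_on UNIV (\<lambda>t. \<gamma> (s - t))"
  using assms unfolding geodesic_on_def by auto

lemma ex_geodesic:
  assumes "proper_geodesic_space TYPE('a::metric_space)"
  shows "\<exists>\<eta>. (\<forall>u\<in>{0..dist x y}. \<forall>v\<in>{0..dist x y}. dist (\<eta> u) (\<eta> v) = \<bar>u - v\<bar>) \<and>
    \<eta> 0 = x \<and> \<eta> (dist x y) = (y::'a)"
proof -
  obtain \<gamma> s t where g: "s \<le> t" "geodesic_on {s..t} \<gamma>" "\<gamma> s = x" "\<gamma> t = y"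
    using assms unfolding proper_geodesic_space_def by blast
  then have "dist x y = t - s" using geodesic_onD[OF g(2), of s t] by auto
  then show ?thesis using g geodesic_onD[OF g(2)]
    by (intro exI[of _ "\<lambda>u. \<gamma> (s + u)"]) auto
qed

section \<open>Hooks to a nearest point\<close>

text \<open>If \<open>\<sigma> t\<close> is nearest to \<open>z\<close>, the distance from
  \<open>\<sigma> u\<close> to the point at depth \<open>k\<close> of the hook is at least
  \<open>k\<close>, and at least the quasi-geodesic bound minus \<open>k\<close>; averaging the two
  gives the factor 3. The slack 1 allows for discontinuous paths, which need not have a nearest
  point.\<close>

lemma hook_right:
  fixes \<sigma> :: "real \<Rightarrow> 'a::metric_space"
  assumes X: "proper_geodesic_space TYPE('a)" and q: "qie l e {s..t} \<sigma>" and st: "s \<le> t"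
    and near: "\<And>u. u \<in> {s..t} \<Longrightarrow> dist z (\<sigma> t) \<le> dist z (\<sigma> u) + 1"
  shows "\<exists>\<tau>. qie (3 * l) (e + 2) {s..t + dist z (\<sigma> t)} \<tau> \<and> (\<forall>u\<in>{s..t}. \<tau> u = \<sigma> u) \<and>
    \<tau> (t + dist z (\<sigma> t)) = z \<and> (\<forall>u\<in>{t..t + dist z (\<sigma> t)}. dist (\<tau> u) (\<sigma> t) = u - t)"
proof -
  have l: "1 \<le> l" "0 \<le> e" using qieD[OF q] by auto
  define m where "m = dist z (\<sigma> t)"
  obtain \<eta> where \<eta>: "\<And>u v. u \<in> {0..m} \<Longrightarrow> v \<in> {0..m} \<Longrightarrow> dist (\<eta> u) (\<eta> v) = \<bar>u - v\<bar>"
    "\<eta> 0 = \<sigma> t" "\<eta> m = z"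
    using ex_geodesic[OF X, of "\<sigma> t" z] unfolding m_def dist_commute[of z] by blast
  have m0: "0 \<le> m" unfolding m_def by simp
  define \<tau> where "\<tau> u = (if u \<le> t then \<sigma> u else \<eta> (u - t))" for u
  have \<tau>r: "\<tau> u = \<eta> (u - t)" if "t \<le> u" for u using that \<eta>(2) by (cases "u = t") (auto simp: \<tau>_def)
  have l3: "x / (3 * l) \<le> x / l" "x \<le> l * x" "l * x \<le> 3 * l * x" "x / l \<le> x" if "0 \<le> x" for x
    using that l mult_right_mono[of 1 l x] by (auto simp: field_simps)
  have "qie (3 * l) (e + 2) {s..t + m} \<tau>"
  proof (rule qieI_ordered)
    fix u v assume uv: "u \<in> {s..t + m}" "v \<in> {s..t + m}" "u \<le> v"
    consider "v \<le> t" | "t \<le> u" | "u \<le> t" "t \<le> v" by linarith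
    then have "(v - u) / (3 * l) - (e + 2) \<le> dist (\<tau> u) (\<tau> v) \<and> dist (\<tau> u) (\<tau> v) \<le> 3 * l * (v - u) + (e + 2)"
    proof cases
      case 1
      then have "\<tau> u = \<sigma> u" "\<tau> v = \<sigma> v" using uv by (auto simp: \<tau>_def)
      moreover have "dist u v / l - e \<le> dist (\<sigma> u) (\<sigma> v)" "dist (\<sigma> u) (\<sigma> v) \<le> l * dist u v + e"
        using qieD(3,4)[OF q, of u v] uv 1 by auto
      ultimately show ?thesis using uv l3[of "v - u"] by (auto simp: dist_real_def)
    next
      case 2
      then have "dist (\<tau> u) (\<tau> v) = v - u" using uv \<eta>(1)[of "u - t" "v - t"] by (simp add: \<tau>r)
      moreover have "(v - u) / l \<le> v - u" using l3(4)[of "v - u"] uv by simp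
      ultimately show ?thesis using uv l l3[of "v - u"] by auto
    next
      case 3
      define k where "k = v - t"
      have k: "0 \<le> k" "k \<le> m" using uv 3 by (auto simp: k_def)
      have \<tau>u: "\<tau> u = \<sigma> u" and \<tau>v: "\<tau> v = \<eta> k" using 3 \<tau>r[of v] by (auto simp: \<tau>_def k_def)
      have d1: "dist (\<eta> k) (\<sigma> t) = k" using \<eta>(1)[of k 0] \<eta>(2) k m0 by simp
      have d2: "dist (\<eta> k) z = m - k" using \<eta>(1)[of k m] \<eta>(3) k m0 by simp
      have "m \<le> dist z (\<sigma> u) + 1" using near[of u] uv 3 unfolding m_def by auto
      then have b1: "k - 1 \<le> dist (\<sigma> u) (\<eta> k)"
        using d2 dist_triangle[of z "\<sigma> u" "\<eta> k"] by (simp add: dist_commute)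
      have q1: "(t - u) / l - e \<le> dist (\<sigma> u) (\<sigma> t)" "dist (\<sigma> u) (\<sigma> t) \<le> l * (t - u) + e"
        using qieD(3,4)[OF q, of u t] uv 3 by (auto simp: dist_real_def)
      have b2: "(t - u) / l - e - k \<le> dist (\<sigma> u) (\<eta> k)"
        using q1(1) d1 dist_triangle[of "\<sigma> u" "\<sigma> t" "\<eta> k"] by simp
      have "k / l \<le> k" using l3(4) k by simp
      moreover have "(v - u) / l = k / l + (t - u) / l" by (simp add: k_def add_divide_distrib[symmetric])
      \<comment> \<open>Twice \<open>b1\<close> plus \<open>b2\<close>: the coefficient of
        \<open>k\<close> that remains is 1, which dominates \<open>k / l\<close>.\<close>
      ultimately have "(v - u) / l - e - 2 \<le> 3 * dist (\<sigma> u) (\<eta> k)" using b1 b2 by linarith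
      moreover have "(v - u) / (3 * l) = (v - u) / l / 3" by simp
      ultimately have lo: "(v - u) / (3 * l) - (e + 2) \<le> dist (\<sigma> u) (\<eta> k)" using l(2) by linarith
      have "dist (\<sigma> u) (\<eta> k) \<le> l * (t - u) + e + k"
        using q1(2) d1 dist_triangle[of "\<sigma> u" "\<eta> k" "\<sigma> t"] by (simp add: dist_commute)
      also have "\<dots> \<le> l * (t - u) + e + l * k" using l3(2)[of k] k by simp
      also have "\<dots> = l * (v - u) + e" by (simp add: k_def algebra_simps)
      finally show ?thesis using lo l3(3)[of "v - u"] uv \<tau>u \<tau>v by auto
    qed
    then show "(v - u) / (3 * l) - (e + 2) \<le> dist (\<tau> u) (\<tau> v)"
      "dist (\<tau> u) (\<tau> v) \<le> 3 * l * (v - u) + (e + 2)" by auto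
  qed (use l in auto)
  moreover have "\<forall>u\<in>{s..t}. \<tau> u = \<sigma> u" by (simp add: \<tau>_def)
  moreover have "\<tau> (t + m) = z" using \<tau>r[of "t + m"] \<eta>(3) m0 by simp
  moreover have "\<forall>u\<in>{t..t + m}. dist (\<tau> u) (\<sigma> t) = u - t"
    using \<eta>(1)[of _ 0] \<eta>(2) m0 by (auto simp: \<tau>r)
  ultimately show ?thesis unfolding m_def by blast
qed

lemma hook_left:
  fixes \<sigma> :: "real \<Rightarrow> 'a::metric_space"
  assumes X: "proper_geodesic_space TYPE('a)" and q: "qie l e {s..t} \<sigma>" and st: "s \<le> t"
    and near: "\<And>u. u \<in> {s..t} \<Longrightarrow> dist z (\<sigma> s) \<le> dist z (\<sigma> u) + 1"
  shows "\<exists>\<tau>. qie (3 * l) (e + 2) {s - dist z (\<sigma> s)..t} \<tau> \<and> (\<forall>u\<in>{s..t}. \<tau> u = \<sigma> u) \<and>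
    \<tau> (s - dist z (\<sigma> s)) = z"
proof -
  have q': "qie l e {-t..-s} (\<lambda>u. \<sigma> (- u))"
    by (rule qie_isometry_compose[OF q]) (auto simp: dist_real_def)
  obtain \<tau> where \<tau>: "qie (3 * l) (e + 2) {-t..-s + dist z (\<sigma> s)} \<tau>"
      "\<forall>u\<in>{-t..-s}. \<tau> u = \<sigma> (- u)" "\<tau> (-s + dist z (\<sigma> s)) = z"
    using hook_right[OF X q', of z] st near by auto
  have "qie (3 * l) (e + 2) {s - dist z (\<sigma> s)..t} (\<lambda>u. \<tau> (- u))"
    by (rule qie_isometry_compose[OF \<tau>(1)]) (auto simp: dist_real_def)
  moreover have "\<tau> (- u) = \<sigma> u" if "u \<in> {s..t}" for u using \<tau>(2)[rule_format, of "- u"] that by simp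
  moreover have "\<tau> (- (s - dist z (\<sigma> s))) = z" using \<tau>(3) by simp
  ultimately show ?thesis by (intro exI[of _ "\<lambda>u. \<tau> (- u)"] conjI ballI)
qed

text \<open>Hooks at both ends join two points of \<open>A\<close>, with constants
  \<open>(1, 0)\<close>, \<open>(3, 2)\<close>, \<open>(9, 4)\<close> successively, so the bound
  does not depend on how far these points are from the geodesic.\<close>

lemma morse_double_hook:
  fixes \<gamma> :: "real \<Rightarrow> 'a::metric_space"
  assumes X: "proper_geodesic_space TYPE('a)" and g: "geodesic_on I \<gamma>"
    and s: "s\<^sub>1 \<in> I" "s\<^sub>2 \<in> I" "s\<^sub>1 \<le> s\<^sub>2"
    and n1: "\<And>s. s \<in> I \<Longrightarrow> dist z\<^sub>1 (\<gamma> s\<^sub>1) \<le> dist z\<^sub>1 (\<gamma> s)"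
    and n2: "\<And>s. s \<in> I \<Longrightarrow> dist z\<^sub>2 (\<gamma> s\<^sub>2) \<le> dist z\<^sub>2 (\<gamma> s)"
    and far: "2 * (dist z\<^sub>1 (\<gamma> s\<^sub>1) + dist z\<^sub>2 (\<gamma> s\<^sub>2)) \<le> s\<^sub>2 - s\<^sub>1"
    and A: "morse_set N A" "z\<^sub>1 \<in> A" "z\<^sub>2 \<in> A" and t: "t \<in> {s\<^sub>1..s\<^sub>2}"
  shows "within_distance (N (9, 4)) (\<gamma> t) A"
proof -
  have I: "{s\<^sub>1..s\<^sub>2} \<subseteq> I"
    using g s unfolding geodesic_on_def closed_interval_def is_interval_1 by (meson atLeastAtMost_iff subsetI)
  define s2' where "s2' = s\<^sub>2 + dist z\<^sub>2 (\<gamma> s\<^sub>2)"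
  have "dist z\<^sub>2 (\<gamma> s\<^sub>2) \<le> dist z\<^sub>2 (\<gamma> u) + 1" if "u \<in> {s\<^sub>1..s\<^sub>2}" for u
    using n2[of u] that I by (simp add: subset_iff)
  from hook_right[OF X geodesic_qie[OF g I] s(3) this]
  obtain \<tau> where \<tau>: "qie 3 2 {s\<^sub>1..s2'} \<tau>" "\<And>u. u\<in>{s\<^sub>1..s\<^sub>2} \<Longrightarrow> \<tau> u = \<gamma> u" "\<tau> s2' = z\<^sub>2"
      "\<And>u. u\<in>{s\<^sub>2..s2'} \<Longrightarrow> dist (\<tau> u) (\<gamma> s\<^sub>2) = u - s\<^sub>2"
    unfolding s2'_def by (simp only: mult_1_right add_0) blast
  have ge: "s\<^sub>2 \<le> s2'" unfolding s2'_def by simp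
  have e: "\<tau> s\<^sub>1 = \<gamma> s\<^sub>1" using \<tau>(2)[of s\<^sub>1] s(3) by simp
  have "dist z\<^sub>1 (\<tau> s\<^sub>1) \<le> dist z\<^sub>1 (\<tau> u) + 1" if u: "u \<in> {s\<^sub>1..s2'}" for u
  proof (cases "u \<le> s\<^sub>2")
    case True
    then have "u \<in> I" using u I by auto
    then show ?thesis using \<tau>(2)[of u] \<tau>(2)[of s\<^sub>1] n1[of u] u True s(3) by simp
  next
    case False
    then have "dist (\<tau> u) (\<gamma> s\<^sub>2) \<le> dist z\<^sub>2 (\<gamma> s\<^sub>2)" using \<tau>(4)[of u] u unfolding s2'_def by auto
    moreover have "dist (\<gamma> s\<^sub>1) (\<gamma> s\<^sub>2) = s\<^sub>2 - s\<^sub>1" using geodesic_onD[OF g s(1,2)] s(3) by simp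
    ultimately have "dist z\<^sub>1 (\<gamma> s\<^sub>1) \<le> dist z\<^sub>1 (\<tau> u)"
      using far dist_triangle[of "\<gamma> s\<^sub>1" "\<gamma> s\<^sub>2" z\<^sub>1] dist_triangle[of z\<^sub>1 "\<gamma> s\<^sub>2" "\<tau> u"]
        zero_le_dist[of z\<^sub>2 "\<gamma> s\<^sub>2"] dist_commute[of "\<gamma> s\<^sub>1" z\<^sub>1] zero_le_dist[of z\<^sub>1 "\<gamma> s\<^sub>1"]
      by argo
    then show ?thesis unfolding e by simp
  qed
  from hook_left[OF X \<tau>(1) order_trans[OF s(3) ge] this]
  obtain \<tau>' where \<tau>': "qie 9 4 {s\<^sub>1 - dist z\<^sub>1 (\<tau> s\<^sub>1)..s2'} \<tau>'"
      "\<And>u. u\<in>{s\<^sub>1..s2'} \<Longrightarrow> \<tau>' u = \<tau> u" "\<tau>' (s\<^sub>1 - dist z\<^sub>1 (\<tau> s\<^sub>1)) = z\<^sub>1"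
    by auto
  have "within_distance (N (9, 4)) (\<tau>' t) A"
  proof (rule morse_setD[OF A(1) _ \<tau>'(1)])
    have "s\<^sub>1 - dist z\<^sub>1 (\<tau> s\<^sub>1) \<le> s\<^sub>1" by simp
    then show "s\<^sub>1 - dist z\<^sub>1 (\<tau> s\<^sub>1) \<le> s2'" "t \<in> {s\<^sub>1 - dist z\<^sub>1 (\<tau> s\<^sub>1)..s2'}"
      using s(3) ge t unfolding atLeastAtMost_iff by linarith+
    show "\<tau>' s2' \<in> A" using \<tau>'(2)[of s2'] \<tau>(3) A(3) s(3) ge by simp
    show "\<tau>' (s\<^sub>1 - dist z\<^sub>1 (\<tau> s\<^sub>1)) \<in> A" using \<tau>'(3) A(2) by simp
  qed
  moreover have "\<tau>' t = \<gamma> t" using \<tau>'(2)[of t] \<tau>(2)[of t] t ge by auto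
  ultimately show ?thesis by simp
qed

lemma ex_nearest_point:
  assumes g: "geodesic_on I \<gamma>"
  shows "\<exists>q\<in>I. \<forall>s\<in>I. dist z (\<gamma> q) \<le> dist z (\<gamma> s)"
proof -
  obtain s0 where s0: "s0 \<in> I" using g unfolding geodesic_on_def closed_interval_def by blast
  define R where "R = dist z (\<gamma> s0)"
  \<comment> \<open>Parameters farther than \<open>2 * R\<close> from \<open>s0\<close> give points
    at distance at least \<open>R\<close> from \<open>z\<close>, so a minimum over this compact part
    is a global one.\<close>
  define C where "C = I \<inter> cball s0 (2 * R)"
  have "compact C" using g unfolding C_def geodesic_on_def closed_interval_def
    by (intro closed_Int_compact) auto
  moreover have "s0 \<in> C" using s0 by (simp add: C_def R_def)
  moreover have "continuous_on C (\<lambda>s. dist z (\<gamma> s))"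
  proof (intro continuous_intros)
    have "1-lipschitz_on C \<gamma>"
      using geodesic_onD[OF g] by (intro lipschitz_onI) (auto simp: C_def dist_real_def)
    then show "continuous_on C \<gamma>" by (rule lipschitz_on_continuous_on)
  qed
  ultimately obtain q where q: "q \<in> C" "\<forall>s\<in>C. dist z (\<gamma> q) \<le> dist z (\<gamma> s)"
    using continuous_attains_inf[of C "\<lambda>s. dist z (\<gamma> s)"] by blast
  have "dist z (\<gamma> q) \<le> dist z (\<gamma> s)" if s: "s \<in> I" for s
  proof (cases "s \<in> C")
    case False
    then have "2 * R < dist (\<gamma> s0) (\<gamma> s)"
      using s s0 geodesic_onD[OF g s0 s] by (auto simp: C_def dist_real_def)
    then have "R \<le> dist z (\<gamma> s)" using dist_triangle[of "\<gamma> s0" "\<gamma> s" z]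
      by (simp add: R_def dist_commute)
    moreover have "dist z (\<gamma> q) \<le> R" using q(2) \<open>s0 \<in> C\<close> by (auto simp: R_def)
    ultimately show ?thesis by simp
  qed (use q in blast)
  then show ?thesis using q(1) by (auto simp: C_def)
qed

text \<open>A hook starts at the nearest point to its target in \<open>A\<close>. A target close to
  \<open>\<gamma> T\<close> is therefore projected back, which moves the parameter by at most
  \<open>2 * H\<close>.\<close>

lemma ex_nearest_near:
  assumes g: "geodesic_on I \<gamma>" and "T \<in> I" "within_distance H (\<gamma> T) A"
  shows "\<exists>z\<in>A. \<exists>q\<in>I. (\<forall>s\<in>I. dist z (\<gamma> q) \<le> dist z (\<gamma> s)) \<and> dist z (\<gamma> q) \<le> H \<and> \<bar>q - T\<bar> \<le> 2 * H"
proof -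
  obtain z where z: "z \<in> A" "dist (\<gamma> T) z \<le> H" using assms(3) unfolding within_distance_def by blast
  obtain q where q: "q \<in> I" "\<forall>s\<in>I. dist z (\<gamma> q) \<le> dist z (\<gamma> s)" using ex_nearest_point[OF g] by blast
  have "dist z (\<gamma> q) \<le> H" using q(2)[rule_format, OF assms(2)] z(2) by (simp add: dist_commute)
  moreover from this have "\<bar>q - T\<bar> \<le> 2 * H"
    using z(2) geodesic_onD[OF g q(1) assms(2)] dist_triangle[of "\<gamma> q" "\<gamma> T" z] by (simp add: dist_commute)
  ultimately show ?thesis using z(1) q by blast
qed

text \<open>The arbitrary \<open>H\<close> disappears from the conclusion because it only decides
  how far beyond \<open>t\<close> the second hook is attached. The first hook sits at
  \<open>s\<close>, whence the assumption that \<open>s\<close> is nearest to a point of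
  \<open>A\<close>.\<close>

lemma ray_near_morse_set:
  fixes \<gamma> :: "real \<Rightarrow> 'a::metric_space"
  assumes X: "proper_geodesic_space TYPE('a)" and g: "geodesic_on I \<gamma>" and I: "{s..} \<subseteq> I"
    and z: "z \<in> A" "\<And>u. u \<in> I \<Longrightarrow> dist z (\<gamma> s) \<le> dist z (\<gamma> u)"
    and H: "\<And>u. s \<le> u \<Longrightarrow> within_distance H (\<gamma> u) A" and A: "morse_set N A" and t: "s \<le> t"
  shows "within_distance (N (9, 4)) (\<gamma> t) A"
proof -
  define m where "m = dist z (\<gamma> s)"
  have H0: "0 \<le> H" using H[of s] within_distance_nonneg by blast
  have m0: "0 \<le> m" by (simp add: m_def)
  \<comment> \<open>The nearest point \<open>q\<close> may lie \<open>2 * H\<close> before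
    \<open>T\<close>; this still leaves \<open>q - s\<close> at least \<open>2 * (m + H)\<close>, as
    the double hook requires.\<close>
  define T where "T = t + 2 * m + 4 * H"
  have T: "s \<le> T" using t H0 m0 by (simp add: T_def)
  obtain z' q where q: "z' \<in> A" "q \<in> I" "\<forall>s\<in>I. dist z' (\<gamma> q) \<le> dist z' (\<gamma> s)"
      "dist z' (\<gamma> q) \<le> H" "\<bar>q - T\<bar> \<le> 2 * H"
    using ex_nearest_near[OF g _ H[OF T]] T I by auto
  have qt: "t + 2 * m + 2 * H \<le> q" using q(5) by (auto simp: T_def)
  show ?thesis
  proof (rule morse_double_hook[where s\<^sub>1 = s and s\<^sub>2 = q, OF X g _ q(2) _ z(2) _ _ A z(1) q(1)])
    show "s \<in> I" using I by auto
    show "s \<le> q" using qt t m0 H0 by simp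
    show "2 * (dist z (\<gamma> s) + dist z' (\<gamma> q)) \<le> q - s"
      using qt q(4) t unfolding m_def by argo
    show "t \<in> {s..q}" using t qt m0 H0 by simp
  qed (use q(3) in auto)
qed

lemma line_near_morse_set:
  fixes \<gamma> :: "real \<Rightarrow> 'a::metric_space"
  assumes X: "proper_geodesic_space TYPE('a)" and g: "geodesic_on UNIV \<gamma>"
    and H: "\<And>u. within_distance H (\<gamma> u) A" and A: "morse_set N A"
  shows "within_distance (N (9, 4)) (\<gamma> t) A"
proof -
  have H0: "0 \<le> H" using H[of 0] within_distance_nonneg by blast
  \<comment> \<open>The offsets \<open>- 2 * H\<close> and \<open>6 * H\<close> put \<open>t\<close>
    between \<open>q'\<close> and \<open>q\<close> with a gap of \<open>4 * H\<close>, twice the sum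
    of two hooks of length at most \<open>H\<close>.\<close>
  obtain z' q' where q': "z' \<in> A" "\<forall>s. dist z' (\<gamma> q') \<le> dist z' (\<gamma> s)"
      "dist z' (\<gamma> q') \<le> H" "\<bar>q' - (t - 2 * H)\<bar> \<le> 2 * H"
    using ex_nearest_near[OF g _ H[of "t - 2 * H"]] by auto
  obtain z q where q: "z \<in> A" "\<forall>s. dist z (\<gamma> q) \<le> dist z (\<gamma> s)"
      "dist z (\<gamma> q) \<le> H" "\<bar>q - (t + 6 * H)\<bar> \<le> 2 * H"
    using ex_nearest_near[OF g _ H[of "t + 6 * H"]] by auto
  have le: "q' \<le> t" "t + 4 * H \<le> q" using q(4) q'(4) by auto
  show ?thesis
  proof (rule morse_double_hook[where s\<^sub>1 = q' and s\<^sub>2 = q, OF X g _ _ _ _ _ _ A q'(1) q(1)])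
    show "2 * (dist z' (\<gamma> q') + dist z (\<gamma> q)) \<le> q - q'" using le q(3) q'(3) by argo
    show "t \<in> {q'..q}" "q' \<le> q" using le H0 by auto
  qed (use q(2) q'(2) in auto)
qed

section \<open>Morse sets\<close>

text \<open>\<open>g\<close> may jump, so \<open>c\<close> is attained only up to \<open>J\<close>.
  The witness is almost the last parameter with value at most \<open>c\<close>; at most 1 / 2
  further on the value is already at least \<open>c\<close>.\<close>

lemma coarse_ivt:
  fixes g :: "real \<Rightarrow> real"
  assumes ab: "a \<le> b"
    and J: "\<And>u v. u \<in> {a..b} \<Longrightarrow> v \<in> {a..b} \<Longrightarrow> \<bar>u - v\<bar> \<le> 1 \<Longrightarrow> \<bar>g u - g v\<bar> \<le> J"
    and c: "g a \<le> c" "c \<le> g b"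
  shows "\<exists>v\<in>{a..b}. c - J \<le> g v \<and> g v \<le> c"
proof -
  define S where "S = {v \<in> {a..b}. g v \<le> c}"
  have S: "a \<in> S" "bdd_above S" using ab c by (auto simp: S_def intro!: bdd_aboveI[of _ b])
  have "Sup S - 1 / 2 < Sup S" by simp
  then obtain v where v: "v \<in> S" "Sup S - 1 / 2 < v" using less_cSup_iff[OF _ S(2)] S(1) by blast
  define w where "w = min (v + 1 / 2) b"
  have w: "w \<in> {a..b}" "\<bar>w - v\<bar> \<le> 1" using v(1) by (auto simp: w_def S_def)
  have "c \<le> g w"
  proof (cases "w = b")
    case False
    then have "Sup S < w" using v(2) by (auto simp: w_def min_def split: if_splits)
    then have "w \<notin> S" using cSup_upper[OF _ S(2)] by force
    then show ?thesis using w(1) by (auto simp: S_def)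
  qed (use c in simp)
  then show ?thesis using J[OF w(1) _ w(2)] v(1) by (intro bexI[of _ v]) (auto simp: S_def)
qed

text \<open>The gauges constructed below are arbitrary real functions; their sign at the relevant
  arguments comes from testing the Morse condition on a constant path.\<close>

lemma morse_set_nonneg:
  assumes "morse_set N A" "a \<in> A" "1 \<le> l" "0 \<le> e"
  shows "0 \<le> N (l, e)"
proof -
  have "qie l e {0..0::real} (\<lambda>_. a)" using assms(3,4) by (simp add: quasi_isometric_embedding_def)
  from morse_setD[OF assms(1) _ this] have "within_distance (N (l, e)) a A" using assms(2) by auto
  then show ?thesis unfolding within_distance_def using zero_le_dist order_trans by blast
qed

lemma morse_set_mono:
  assumes "morse_set N A" "\<And>l e. 1 \<le> l \<Longrightarrow> 0 \<le> e \<Longrightarrow> N (l, e) \<le> M (l, e)"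
  shows "morse_set M A"
  unfolding morse_set_def
proof (intro allI impI ballI)
  fix l e s t :: real and \<sigma> :: "real \<Rightarrow> 'a" and u
  assume *: "s \<le> t \<and> qie l e {s..t} \<sigma> \<and> \<sigma> s \<in> A \<and> \<sigma> t \<in> A" and "u \<in> {s..t}"
  then have "within_distance (N (l, e)) (\<sigma> u) A" using morse_setD[OF assms(1)] by blast
  moreover have "N (l, e) \<le> M (l, e)"
    using * by (intro assms(2) qieD(1,2)[of l e "{s..t}" \<sigma>]) auto
  ultimately show "within_distance (M (l, e)) (\<sigma> u) A" by (rule within_distance_mono) simp
qed

lemma morse_set_near_endpoints:
  fixes s t u :: real
  assumes A: "morse_set N A" and q: "qie l e {s..t} \<sigma>" "s \<le> t" and D: "0 \<le> D"
    and ends: "within_distance D (\<sigma> s) A" "within_distance D (\<sigma> t) A" and u: "u \<in> {s..t}"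
  shows "within_distance (N (l, e + 2 * D) + D) (\<sigma> u) A"
proof -
  obtain a b where ab: "a \<in> A" "dist (\<sigma> s) a \<le> D" "b \<in> A" "dist (\<sigma> t) b \<le> D"
    using ends unfolding within_distance_def by blast
  have N0: "0 \<le> N (l, e + 2 * D)"
    using morse_set_nonneg[OF A ab(1)] qieD[OF q(1)] D by simp
  show ?thesis
  \<comment> \<open>The endpoint of a one-point path cannot be replaced by both \<open>a\<close> and
    \<open>b\<close>.\<close>
  proof (cases "s = t")
    case True
    then have "u = s" using u by simp
    then show ?thesis using within_distance_mono[OF ends(1), of _ A] N0 by simp
  next
    case False
    define \<tau> where "\<tau> = \<sigma>(s := a, t := b)"
    have close: "dist (\<tau> u) (\<sigma> u) \<le> D" for u using ab D by (auto simp: \<tau>_def dist_commute)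
    have "qie l (e + 2 * D) {s..t} \<tau>" by (rule qie_perturb[OF q(1) D close])
    from morse_setD[OF A q(2) this _ _ u] have "within_distance (N (l, e + 2 * D)) (\<tau> u) A"
      using ab False by (simp add: \<tau>_def)
    then show ?thesis using close[of u] by (intro within_distance_triangle) (auto simp: dist_commute)
  qed
qed

text \<open>Moving both endpoints of a path by \<open>D\<close> costs \<open>2 * D\<close> in the
  additive constant. Of the outer \<open>2 * D\<close>, one \<open>D\<close> returns from the
  modified path to the original one, the other passes from one set to the other.\<close>

definition thicken :: "real \<Rightarrow> gauge \<Rightarrow> gauge" where
  "thicken D N = (\<lambda>(l, e). N (l, e + 2 * D) + 2 * D)"

lemma morse_set_thicken:
  assumes A: "morse_set N A" and D: "0 \<le> D"
    and AB: "\<And>x. x \<in> A \<Longrightarrow> within_distance D x B" "\<And>y. y \<in> B \<Longrightarrow> within_distance D y A"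
  shows "morse_set (thicken D N) B"
  unfolding morse_set_def
proof (intro allI impI ballI)
  fix l e s t :: real and \<sigma> :: "real \<Rightarrow> 'a" and u
  assume *: "s \<le> t \<and> qie l e {s..t} \<sigma> \<and> \<sigma> s \<in> B \<and> \<sigma> t \<in> B" and u: "u \<in> {s..t}"
  then have "within_distance (N (l, e + 2 * D) + D) (\<sigma> u) A"
    using morse_set_near_endpoints[OF A, of l e s t \<sigma> D u] D AB(2) by auto
  then obtain a where "a \<in> A" "dist (\<sigma> u) a \<le> N (l, e + 2 * D) + D" unfolding within_distance_def by blast
  then show "within_distance (thicken D N (l, e)) (\<sigma> u) B"
    using within_distance_triangle[OF AB(1)] by (fastforce simp: thicken_def algebra_simps)
qed

text \<open>Serves to create the common point that \<open>morse_set_Un\<close> asks for, or the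
  target of a hook.\<close>

lemma morse_set_insert:
  assumes "morse_set N A" "0 \<le> D" "within_distance D x A"
  shows "morse_set (thicken D N) (insert x A)"
  using assms by (intro morse_set_thicken[OF assms(1,2)]) (auto intro: within_distance_self)

definition join_gauge :: "gauge \<Rightarrow> gauge" where
  "join_gauge N = (\<lambda>(l, e). max (N (l, e)) (N (3 * l, e + 2)))"

text \<open>Cut \<open>\<sigma>\<close> at the parameter \<open>w\<close> almost nearest to the
  common point \<open>z\<close>. Each half, hooked to \<open>z\<close>, has both ends in a single
  one of the two sets.\<close>

lemma morse_set_crossing:
  fixes \<sigma> :: "real \<Rightarrow> 'a::metric_space"
  assumes X: "proper_geodesic_space TYPE('a)"
    and AB: "morse_set N A" "morse_set N B" "z \<in> A" "z \<in> B"
    and q: "qie l e {s..t} \<sigma>" "s \<le> t" "\<sigma> s \<in> A" "\<sigma> t \<in> B" and u: "u \<in> {s..t}"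
  shows "within_distance (N (3 * l, e + 2)) (\<sigma> u) (A \<union> B)"
proof -
  let ?D = "(\<lambda>u. dist z (\<sigma> u)) ` {s..t}"
  have bdd: "bdd_below ?D" by (intro bdd_belowI[of _ 0]) auto
  obtain w where w: "w \<in> {s..t}" "dist z (\<sigma> w) < Inf ?D + 1"
    using cInf_lessD[of ?D "Inf ?D + 1"] q(2) by auto
  have near: "dist z (\<sigma> w) \<le> dist z (\<sigma> v) + 1" if "v \<in> {s..t}" for v
    using w(2) cInf_lower[OF _ bdd, of "dist z (\<sigma> v)"] that by force
  show ?thesis
  proof (cases "u \<le> w")
    case True
    have "qie l e {s..w} \<sigma>" by (rule qie_subset[OF q(1)]) (use w(1) in auto)
    from hook_right[OF X this, of z] near w(1) obtain \<tau> where
      \<tau>: "qie (3 * l) (e + 2) {s..w + dist z (\<sigma> w)} \<tau>" "\<forall>u\<in>{s..w}. \<tau> u = \<sigma> u" "\<tau> (w + dist z (\<sigma> w)) = z"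
      by auto
    have "within_distance (N (3 * l, e + 2)) (\<tau> u) A"
      by (rule morse_setD[OF AB(1) _ \<tau>(1)]) (use \<tau> w u True q AB in \<open>auto simp: add_increasing2\<close>)
    then show ?thesis using \<tau>(2) u True by (auto intro: within_distance_mono)
  next
    case False
    have "qie l e {w..t} \<sigma>" by (rule qie_subset[OF q(1)]) (use w(1) in auto)
    from hook_left[OF X this, of z] near w(1) obtain \<tau> where
      \<tau>: "qie (3 * l) (e + 2) {w - dist z (\<sigma> w)..t} \<tau>" "\<forall>u\<in>{w..t}. \<tau> u = \<sigma> u" "\<tau> (w - dist z (\<sigma> w)) = z"
      by auto
    have *: "w - dist z (\<sigma> w) \<le> t" "w - dist z (\<sigma> w) \<le> u"
      using zero_le_dist[of z "\<sigma> w"] w u False unfolding atLeastAtMost_iff by linarith+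
    have "within_distance (N (3 * l, e + 2)) (\<tau> u) B"
      by (rule morse_setD[OF AB(2) _ \<tau>(1)]) (use \<tau> w u False q AB * in auto)
    then show ?thesis using \<tau>(2) u False by (auto intro: within_distance_mono)
  qed
qed

lemma morse_set_Un:
  fixes A B :: "'a::metric_space set"
  assumes X: "proper_geodesic_space TYPE('a)"
    and AB: "morse_set N A" "morse_set N B" "z \<in> A" "z \<in> B"
  shows "morse_set (join_gauge N) (A \<union> B)"
  unfolding morse_set_def
proof (intro allI impI ballI)
  fix l e s t :: real and \<sigma> :: "real \<Rightarrow> 'a" and u
  assume *: "s \<le> t \<and> qie l e {s..t} \<sigma> \<and> \<sigma> s \<in> A \<union> B \<and> \<sigma> t \<in> A \<union> B" and u: "u \<in> {s..t}"
  have "within_distance (N (l, e)) (\<sigma> u) (A \<union> B) \<or> within_distance (N (3 * l, e + 2)) (\<sigma> u) (A \<union> B)"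
  proof -
    consider "\<sigma> s \<in> A" "\<sigma> t \<in> A" | "\<sigma> s \<in> B" "\<sigma> t \<in> B" | "\<sigma> s \<in> A" "\<sigma> t \<in> B" | "\<sigma> s \<in> B" "\<sigma> t \<in> A"
      using * by blast
    then show ?thesis
    proof cases
      case 1
      then have "within_distance (N (l, e)) (\<sigma> u) A" using morse_setD[OF AB(1) _ _ _ _ u] * by blast
      then show ?thesis by (auto intro: within_distance_mono)
    next
      case 2
      then have "within_distance (N (l, e)) (\<sigma> u) B" using morse_setD[OF AB(2) _ _ _ _ u] * by blast
      then show ?thesis by (auto intro: within_distance_mono)
    next
      case 3
      then show ?thesis using morse_set_crossing[OF X AB _ _ _ _ u] * by blast
    next
      case 4
      then show ?thesis using morse_set_crossing[OF X AB(2,1,4,3) _ _ _ _ u] * by (simp add: Un_commute)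
    qed
  qed
  then show "within_distance (join_gauge N (l, e)) (\<sigma> u) (A \<union> B)"
    unfolding join_gauge_def by (auto intro: within_distance_mono)
qed

text \<open>\<open>g\<close> is a signed coarse coordinate, measured from the end of a subgeodesic.
  A path with \<open>g u\<close> positive visits the strip between \<open>- J\<close> and 0 both
  before and after \<open>u\<close>; the two visits are close in space, hence in parameter, and
  \<open>u\<close> lies between them.\<close>

lemma quasi_geodesic_excursion:
  fixes g :: "real \<Rightarrow> real"
  assumes q: "qie l e {s..t} \<sigma>" and c: "0 \<le> c"
    and g: "\<And>v w. v \<in> {s..t} \<Longrightarrow> w \<in> {s..t} \<Longrightarrow> \<bar>\<bar>g v - g w\<bar> - dist (\<sigma> v) (\<sigma> w)\<bar> \<le> 2 * c"
    and ends: "g s \<le> 0" "g t \<le> 0" and u: "u \<in> {s..t}" "0 < g u" and J: "J = l + e + 2 * c"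
  shows "\<exists>v\<in>{s..t}. - J \<le> g v \<and> g v \<le> 0 \<and> dist (\<sigma> u) (\<sigma> v) \<le> l * (l * (2 * c + J + e)) + e"
proof -
  have l: "1 \<le> l" "0 \<le> e" using qieD[OF q] by auto
  have jump: "\<bar>g v - g w\<bar> \<le> J" if vw: "v \<in> {s..t}" "w \<in> {s..t}" "\<bar>v - w\<bar> \<le> 1" for v w
  proof -
    have "dist (\<sigma> v) (\<sigma> w) \<le> l * dist v w + e" using qieD(4)[OF q] vw by blast
    moreover have "l * dist v w \<le> l" using vw(3) l by (simp add: dist_real_def mult_left_le)
    ultimately show ?thesis using g[OF vw(1,2)] J by linarith
  qed
  obtain v where v: "v \<in> {s..u}" "0 - J \<le> g v" "g v \<le> 0"
    using coarse_ivt[of s u g J 0] jump u ends by auto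
  \<comment> \<open>The visit after \<open>u\<close> is found by running the path backwards.\<close>
  have "\<exists>w\<in>{-t..-u}. 0 - J \<le> g (- w) \<and> g (- w) \<le> 0"
    by (rule coarse_ivt) (use jump u ends in auto)
  then obtain w' where w': "w' \<in> {-t..-u}" "0 - J \<le> g (- w')" "g (- w') \<le> 0" by blast
  define w where "w = - w'"
  have w: "w \<in> {u..t}" "0 - J \<le> g w" "g w \<le> 0" using w' by (auto simp: w_def)
  have "\<bar>g v - g w\<bar> \<le> J" using v w by auto
  then have "dist (\<sigma> v) (\<sigma> w) \<le> 2 * c + J" using g[of v w] v(1) w(1) u by auto
  then have "dist v w \<le> l * (2 * c + J + e)" using qie_inverse_bound[OF q, of v w] v(1) w(1) u by auto
  then have "dist u v \<le> l * (2 * c + J + e)" using v(1) w(1) by (auto simp: dist_real_def)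
  then have "l * dist u v \<le> l * (l * (2 * c + J + e))" using l by (intro mult_left_mono) auto
  then have "dist (\<sigma> u) (\<sigma> v) \<le> l * (l * (2 * c + J + e)) + e" using qieD(4)[OF q, of u v] v(1) u by auto
  then show ?thesis using v u by auto
qed

definition subgeodesic_gauge :: "gauge \<Rightarrow> gauge" where
  "subgeodesic_gauge N = (\<lambda>(l, e). let c = N (l, e); J = l + e + 2 * c in
     (l * (l * (2 * c + J + e)) + e) + c + J)"

text \<open>\<open>morse_geodesic\<close> speaks of all subgeodesics, while forming unions only
  controls the whole image. Where the projection of \<open>\<sigma>\<close> passes an end of
  \<open>J'\<close>, the excursion estimate keeps \<open>\<sigma> u\<close> near that end.\<close>

lemma morse_geodesic_if_morse_set:
  fixes \<gamma> :: "real \<Rightarrow> 'a::metric_space"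
  assumes g: "geodesic_on I \<gamma>" and N: "morse_set N (\<gamma> ` I)"
  shows "morse_geodesic (subgeodesic_gauge N) I \<gamma>"
  unfolding morse_geodesic_def morse_on_iff
proof (intro conjI allI impI g)
  fix J' assume J': "closed_interval J' \<and> J' \<subseteq> I"
  show "morse_set (subgeodesic_gauge N) (\<gamma> ` J')"
    unfolding morse_set_def
  proof (intro allI impI ballI)
    fix l e s t :: real and \<sigma> :: "real \<Rightarrow> 'a" and u
    assume *: "s \<le> t \<and> qie l e {s..t} \<sigma> \<and> \<sigma> s \<in> \<gamma> ` J' \<and> \<sigma> t \<in> \<gamma> ` J'" and u: "u \<in> {s..t}"
    then have q: "qie l e {s..t} \<sigma>" by blast
    have l: "1 \<le> l" "0 \<le> e" using qieD[OF q] by auto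
    define c where "c = N (l, e)"
    define J where "J = l + e + 2 * c"
    define B where "B = l * (l * (2 * c + J + e)) + e"
    have sg: "subgeodesic_gauge N (l, e) = B + c + J"
      unfolding subgeodesic_gauge_def Let_def B_def J_def c_def by simp
    obtain a where "\<sigma> s = \<gamma> a" "a \<in> J'" using * by blast
    then have aI: "\<gamma> a \<in> \<gamma> ` I" using J' by blast
    have c0: "0 \<le> c" unfolding c_def by (rule morse_set_nonneg[OF N aI]) (use l in auto)
    have J0: "0 \<le> J" using c0 l by (simp add: J_def)
    have B0: "0 \<le> B" using c0 l J0 by (simp add: B_def)
    have "\<exists>w\<in>I. dist (\<sigma> v) (\<gamma> w) \<le> c \<and> (v = s \<or> v = t \<longrightarrow> w \<in> J')" if v: "v \<in> {s..t}" for v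
    proof (cases "v = s \<or> v = t")
      case True
      then obtain w where "w \<in> J'" "\<sigma> v = \<gamma> w" using * by blast
      then show ?thesis using J' c0 by (intro bexI[of _ w]) auto
    next
      case False
      have "within_distance c (\<sigma> v) (\<gamma> ` I)"
        unfolding c_def by (rule morse_setD[OF N _ q]) (use * J' v in auto)
      then show ?thesis using False unfolding within_distance_def by blast
    qed
    then obtain \<tau> where \<tau>: "\<And>v. v \<in> {s..t} \<Longrightarrow> \<tau> v \<in> I" "\<And>v. v \<in> {s..t} \<Longrightarrow> dist (\<sigma> v) (\<gamma> (\<tau> v)) \<le> c"
        "\<tau> s \<in> J'" "\<tau> t \<in> J'"
      using * by (metis atLeastAtMost_iff order_refl)
    have coarse: "\<bar>\<bar>\<tau> v - \<tau> w\<bar> - dist (\<sigma> v) (\<sigma> w)\<bar> \<le> 2 * c" if "v \<in> {s..t}" "w \<in> {s..t}" for v w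
      using \<tau>(2)[OF that(1)] \<tau>(2)[OF that(2)] geodesic_onD[OF g \<tau>(1)[OF that(1)] \<tau>(1)[OF that(2)]]
        dist_triangle[of "\<sigma> v" "\<sigma> w" "\<gamma> (\<tau> v)"] dist_triangle[of "\<gamma> (\<tau> v)" "\<sigma> w" "\<gamma> (\<tau> w)"]
        dist_triangle[of "\<gamma> (\<tau> v)" "\<gamma> (\<tau> w)" "\<sigma> v"] dist_triangle[of "\<sigma> v" "\<gamma> (\<tau> w)" "\<sigma> w"]
      by (auto simp: dist_commute)
    \<comment> \<open>\<open>j\<close> is the end that is passed and \<open>G\<close> the coordinate
      beyond it; leaving \<open>G\<close> abstract covers the upper and the lower end.\<close>
    have outside: "within_distance (B + c + J) (\<sigma> u) (\<gamma> ` J')"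
      if j: "j \<in> J'" and G: "\<And>v. \<bar>G v\<bar> = \<bar>\<tau> v - j\<bar>" "\<And>v w. \<bar>G v - G w\<bar> = \<bar>\<tau> v - \<tau> w\<bar>"
        "G s \<le> 0" "G t \<le> 0" "0 < G u" for G :: "real \<Rightarrow> real" and j
    proof -
      obtain v where v: "v \<in> {s..t}" "- J \<le> G v" "G v \<le> 0" "dist (\<sigma> u) (\<sigma> v) \<le> B"
        using quasi_geodesic_excursion[OF q c0, of G u J] coarse G(2-) u unfolding B_def J_def by auto
      have "dist (\<gamma> (\<tau> v)) (\<gamma> j) \<le> J"
        using geodesic_onD[OF g \<tau>(1)[OF v(1)], of j] j J' G(1)[of v] v(2,3) by auto
      then have "dist (\<sigma> u) (\<gamma> j) \<le> B + c + J"
        using v(4) \<tau>(2)[OF v(1)] dist_triangle[of "\<sigma> u" "\<gamma> j" "\<sigma> v"] dist_triangle[of "\<sigma> v" "\<gamma> j" "\<gamma> (\<tau> v)"]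
        by linarith
      then show ?thesis using j unfolding within_distance_def by blast
    qed
    have J'ci: "closed J'" "J' \<noteq> {}" and J'int: "\<And>a b x. a \<in> J' \<Longrightarrow> b \<in> J' \<Longrightarrow> a \<le> x \<Longrightarrow> x \<le> b \<Longrightarrow> x \<in> J'"
      using J' unfolding closed_interval_def is_interval_1 by blast+
    consider "\<tau> u \<in> J'" | "\<tau> u \<notin> J'" "\<tau> s \<le> \<tau> u" | "\<tau> u \<notin> J'" "\<tau> u \<le> \<tau> s" by linarith
    then show "within_distance (subgeodesic_gauge N (l, e)) (\<sigma> u) (\<gamma> ` J')"
    proof cases
      case 1
      then show ?thesis using \<tau>(2)[OF u] B0 J0 unfolding within_distance_def sg
        by (intro bexI[of _ "\<gamma> (\<tau> u)"]) auto
    next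
      case 2
      then have up: "x < \<tau> u" if "x \<in> J'" for x using J'int[OF \<tau>(3) that, of "\<tau> u"] by force
      then have bdd: "bdd_above J'" by (meson bdd_above.I less_imp_le)
      have j: "Sup J' \<in> J'" using closed_contains_Sup[OF J'ci(2) bdd J'ci(1)] .
      show ?thesis unfolding sg
        using outside[OF j, of "\<lambda>v. \<tau> v - Sup J'"] up[OF j] cSup_upper[OF \<tau>(3) bdd] cSup_upper[OF \<tau>(4) bdd]
        by auto
    next
      case 3
      then have low: "\<tau> u < x" if "x \<in> J'" for x using J'int[OF that \<tau>(3), of "\<tau> u"] by force
      then have bdd: "bdd_below J'" by (meson bdd_below.I less_imp_le)
      have j: "Inf J' \<in> J'" using closed_contains_Inf[OF J'ci(2) bdd J'ci(1)] .
      show ?thesis unfolding sg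
        using outside[OF j, of "\<lambda>v. Inf J' - \<tau> v"] low[OF j] cInf_lower[OF \<tau>(3) bdd] cInf_lower[OF \<tau>(4) bdd]
        by auto
    qed
  qed
qed

text \<open>\<open>\<tau>\<close> is unbounded, since \<open>g\<close> runs to infinity, and moves
  in bounded jumps; so it comes close to every level above its current value.\<close>

lemma coarse_cover:
  fixes \<tau> :: "real \<Rightarrow> real"
  assumes \<alpha>: "geodesic_on {0..} \<alpha>" and g: "qie l e {0..} g" and E: "0 \<le> E"
    and \<tau>: "\<And>t. 0 \<le> t \<Longrightarrow> 0 \<le> \<tau> t" "\<And>t. 0 \<le> t \<Longrightarrow> dist (g t) (\<alpha> (\<tau> t)) \<le> E"
    and t: "0 \<le> t" "\<tau> t \<le> w"
  shows "\<exists>v\<ge>t. w - (l + e + 2 * E) \<le> \<tau> v \<and> \<tau> v \<le> w"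
proof -
  have l: "1 \<le> l" "0 \<le> e" using qieD[OF g] by auto
  have coarse: "\<bar>\<bar>\<tau> u - \<tau> v\<bar> - dist (g u) (g v)\<bar> \<le> 2 * E" if "0 \<le> u" "0 \<le> v" for u v
    using \<tau>(2)[OF that(1)] \<tau>(2)[OF that(2)] geodesic_onD[OF \<alpha>, of "\<tau> u" "\<tau> v"] \<tau>(1)[OF that(1)] \<tau>(1)[OF that(2)]
        dist_triangle[of "g u" "g v" "\<alpha> (\<tau> u)"] dist_triangle[of "\<alpha> (\<tau> u)" "g v" "\<alpha> (\<tau> v)"]
        dist_triangle[of "\<alpha> (\<tau> u)" "\<alpha> (\<tau> v)" "g u"] dist_triangle[of "g u" "\<alpha> (\<tau> v)" "g v"]
      by (auto simp: dist_commute)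
  have jump: "\<bar>\<tau> u - \<tau> v\<bar> \<le> l + e + 2 * E" if uv: "0 \<le> u" "0 \<le> v" "\<bar>u - v\<bar> \<le> 1" for u v
  proof -
    have "dist (g u) (g v) \<le> l * dist u v + e" using qieD(4)[OF g] uv by auto
    moreover have "l * dist u v \<le> l" using uv(3) l by (simp add: dist_real_def mult_left_le)
    ultimately show ?thesis using coarse[OF uv(1,2)] by linarith
  qed
  have w0: "0 \<le> w" using \<tau>(1)[OF t(1)] t(2) by linarith
  \<comment> \<open>By the time \<open>b\<close> the parameter has changed by at least
    \<open>w + 1\<close>. As \<open>\<tau>\<close> is nonnegative and \<open>\<tau> t\<close> is at
    most \<open>w\<close>, this must be an increase.\<close>
  define b where "b = t + l * (w + e + 2 * E + 1)"
  have bt: "t \<le> b" using l w0 E by (simp add: b_def)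
  have "w + 2 * E + 1 \<le> dist (g t) (g b)"
    using qieD(3)[OF g, of t b] bt t l by (simp add: b_def dist_real_def abs_minus_commute w0 E)
  then have "w + 1 \<le> \<bar>\<tau> t - \<tau> b\<bar>" using coarse[of t b] bt t by linarith
  then have "w \<le> \<tau> b" using t(2) \<tau>(1)[OF t(1)] \<tau>(1)[of b] bt t(1) by linarith
  then show ?thesis using coarse_ivt[of t b \<tau> "l + e + 2 * E" w] jump t bt by auto
qed

section \<open>Rays, lines and their endpoints\<close>

lemma morse_geodesicD:
  assumes "morse_geodesic N I \<gamma>"
  shows "geodesic_on I \<gamma>" "closed_interval J \<Longrightarrow> J \<subseteq> I \<Longrightarrow> morse_set N (\<gamma> ` J)"
  using assms unfolding morse_geodesic_def morse_on_iff by auto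

lemma ex_near_parameter:
  assumes "\<And>t::real. 0 \<le> t \<Longrightarrow> within_distance C (g t) (\<alpha> ` {0::real..})"
  shows "\<exists>\<tau>. \<forall>t\<ge>0. 0 \<le> \<tau> t \<and> dist (g t) (\<alpha> (\<tau> t)) \<le> C"
proof -
  have "\<exists>w. 0 \<le> t \<longrightarrow> 0 \<le> w \<and> dist (g t) (\<alpha> w) \<le> C" for t
    using assms[of t] unfolding within_distance_def by auto
  then show ?thesis by (rule choice[OF allI])
qed

text \<open>The piece of \<open>\<alpha>\<close> before \<open>\<tau> 0\<close> may be far from
  \<open>\<gamma>\<close>, so \<open>\<gamma>\<close> is compared with the rest of
  \<open>\<alpha>\<close>, to which its Hausdorff distance is at most \<open>5 * C + 1\<close>. The
  rest is Morse by the convention on subgeodesics.\<close>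

lemma morse_set_near_morse_ray:
  assumes \<alpha>: "morse_geodesic N {0..} \<alpha>" and \<gamma>: "geodesic_on {0..} \<gamma>"
    and close: "\<And>t. 0 \<le> t \<Longrightarrow> within_distance C (\<gamma> t) (\<alpha> ` {0..})"
  shows "morse_set (thicken (5 * C + 1) N) (\<gamma> ` {0..})"
proof -
  note \<alpha>g = morse_geodesicD(1)[OF \<alpha>]
  have C: "0 \<le> C" by (rule within_distance_nonneg[OF close[OF order_refl]])
  obtain \<tau> where \<tau>: "\<And>t. 0 \<le> t \<Longrightarrow> 0 \<le> \<tau> t" "\<And>t. 0 \<le> t \<Longrightarrow> dist (\<gamma> t) (\<alpha> (\<tau> t)) \<le> C"
    using ex_near_parameter[of C \<gamma> \<alpha>, OF close] by auto
  have cover: "\<exists>v\<ge>t. w - (1 + 2 * C) \<le> \<tau> v \<and> \<tau> v \<le> w" if "0 \<le> t" "\<tau> t \<le> w" for t w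
    using coarse_cover[OF \<alpha>g geodesic_qie[OF \<gamma> order_refl] C \<tau> that] by simp
  have A: "morse_set N (\<alpha> ` {\<tau> 0..})" by (rule morse_geodesicD(2)[OF \<alpha>]) (use \<tau>(1)[of 0] in auto)
  show ?thesis
  proof (rule morse_set_thicken[OF A])
    show "0 \<le> 5 * C + 1" using C by simp
  next
    fix x assume "x \<in> \<alpha> ` {\<tau> 0..}"
    then obtain w where w: "x = \<alpha> w" "\<tau> 0 \<le> w" by auto
    obtain v where v: "0 \<le> v" "w - (1 + 2 * C) \<le> \<tau> v" "\<tau> v \<le> w" using cover[of 0 w] w by auto
    have "dist (\<alpha> w) (\<alpha> (\<tau> v)) \<le> 1 + 2 * C"
      using geodesic_onD[OF \<alpha>g, of w "\<tau> v"] v \<tau>(1)[OF v(1)] by auto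
    then have "dist x (\<gamma> v) \<le> 5 * C + 1"
      using \<tau>(2)[OF v(1)] C dist_triangle[of "\<alpha> w" "\<gamma> v" "\<alpha> (\<tau> v)"] w(1) by (simp add: dist_commute)
    then show "within_distance (5 * C + 1) x (\<gamma> ` {0..})" using v(1) unfolding within_distance_def by auto
  next
    fix y assume "y \<in> \<gamma> ` {0..}"
    then obtain t where t: "y = \<gamma> t" "0 \<le> t" by auto
    have "\<exists>w\<ge>\<tau> 0. dist (\<gamma> t) (\<alpha> w) \<le> 5 * C + 1"
    proof (cases "\<tau> 0 \<le> \<tau> t")
      case True
      then show ?thesis using \<tau>(2)[OF t(2)] C by (intro exI[of _ "\<tau> t"]) auto
    next
      case False
      \<comment> \<open>If \<open>\<gamma>\<close> starts by running backwards along
        \<open>\<alpha>\<close>, it has to return to near \<open>\<alpha> (\<tau> 0)\<close> at some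
        later time \<open>v\<close>. Then \<open>\<gamma> v\<close> is near
        \<open>\<gamma> 0\<close>, so \<open>v\<close>, and with it \<open>t\<close>, is
        small.\<close>
      then obtain v where v: "t \<le> v" "\<tau> 0 - (1 + 2 * C) \<le> \<tau> v" "\<tau> v \<le> \<tau> 0" using cover[of t "\<tau> 0"] t by auto
      have v0: "0 \<le> v" using v(1) t(2) by simp
      have "dist (\<alpha> (\<tau> v)) (\<alpha> (\<tau> 0)) \<le> 1 + 2 * C"
        using geodesic_onD[OF \<alpha>g, of "\<tau> v" "\<tau> 0"] v \<tau>(1)[OF v0] \<tau>(1)[of 0] by auto
      then have "dist (\<gamma> v) (\<gamma> 0) \<le> 1 + 4 * C"
        using \<tau>(2)[OF v0] \<tau>(2)[of 0] dist_triangle[of "\<gamma> v" "\<gamma> 0" "\<alpha> (\<tau> v)"]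
          dist_triangle[of "\<alpha> (\<tau> v)" "\<gamma> 0" "\<alpha> (\<tau> 0)"] by (simp add: dist_commute)
      then have "dist (\<gamma> t) (\<gamma> 0) \<le> 1 + 4 * C"
        using geodesic_onD[OF \<gamma>, of v 0] geodesic_onD[OF \<gamma>, of t 0] v v0 t(2) by simp
      then have "dist (\<gamma> t) (\<alpha> (\<tau> 0)) \<le> 5 * C + 1"
        using \<tau>(2)[of 0] dist_triangle[of "\<gamma> t" "\<alpha> (\<tau> 0)" "\<gamma> 0"] by simp
      then show ?thesis by blast
    qed
    then show "within_distance (5 * C + 1) y (\<alpha> ` {\<tau> 0..})" using t(1) unfolding within_distance_def by auto
  qed
qed

lemma finite_hausdorff_sym: "finite_hausdorff A B \<Longrightarrow> finite_hausdorff B A"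
  unfolding finite_hausdorff_def by blast

lemma finite_hausdorffI:
  assumes "\<And>x. x \<in> A \<Longrightarrow> within_distance C x B" "\<And>y. y \<in> B \<Longrightarrow> within_distance D y A"
  shows "finite_hausdorff A B"
  unfolding finite_hausdorff_def
  by (intro exI[of _ "max C D"]) (auto intro: within_distance_mono assms)

text \<open>One-sided closeness suffices: by \<open>coarse_cover\<close>, \<open>g\<close> skips no
  long piece of \<open>\<alpha>\<close> beyond \<open>\<tau> 0\<close>, and the piece before it has
  length \<open>\<tau> 0\<close>.\<close>

lemma finite_hausdorff_if_near_ray:
  assumes \<alpha>: "geodesic_on {0..} \<alpha>" and g: "qie l e {0..} g"
    and close: "\<And>t::real. 0 \<le> t \<Longrightarrow> within_distance E (g t) (\<alpha> ` {0::real..})"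
  shows "finite_hausdorff (g ` {0..}) (\<alpha> ` {0..})"
proof -
  have E: "0 \<le> E" by (rule within_distance_nonneg[OF close[OF order_refl]])
  have l: "1 \<le> l" "0 \<le> e" using qieD[OF g] by auto
  obtain \<tau> where \<tau>: "\<And>t. 0 \<le> t \<Longrightarrow> 0 \<le> \<tau> t" "\<And>t. 0 \<le> t \<Longrightarrow> dist (g t) (\<alpha> (\<tau> t)) \<le> E"
    using ex_near_parameter[of E g \<alpha>, OF close] by auto
  show ?thesis
  proof (rule finite_hausdorffI)
    show "within_distance E x (\<alpha> ` {0..})" if "x \<in> g ` {0..}" for x using close that by auto
  next
    fix y assume "y \<in> \<alpha> ` {0..}"
    then obtain w where w: "y = \<alpha> w" "0 \<le> w" by auto
    have "\<exists>v\<ge>0. \<bar>w - \<tau> v\<bar> \<le> l + e + 2 * E + \<tau> 0"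
    proof (cases "\<tau> 0 \<le> w")
      case True
      obtain v where "0 \<le> v" "w - (l + e + 2 * E) \<le> \<tau> v" "\<tau> v \<le> w"
        using coarse_cover[OF \<alpha> g E \<tau> order_refl True] by blast
      then show ?thesis using \<tau>(1)[of 0] by (intro exI[of _ v]) auto
    next
      case False
      then show ?thesis using w(2) l E by (intro exI[of _ 0]) auto
    qed
    then obtain v where v: "0 \<le> v" "\<bar>w - \<tau> v\<bar> \<le> l + e + 2 * E + \<tau> 0" by blast
    then have "dist y (g v) \<le> l + e + 2 * E + \<tau> 0 + E"
      using geodesic_onD[OF \<alpha>, of w "\<tau> v"] \<tau>(1,2)[OF v(1)] w
        dist_triangle[of "\<alpha> w" "g v" "\<alpha> (\<tau> v)"] by (simp add: dist_commute)
    then show "within_distance (l + e + 2 * E + \<tau> 0 + E) y (g ` {0..})"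
      using v(1) unfolding within_distance_def by auto
  qed
qed

lemma bpoint_nonempty: "b \<in> visual_boundary p \<Longrightarrow> \<exists>\<beta>. \<beta> \<in> b"
  unfolding visual_boundary_def
  using in_quotient_imp_non_empty[OF equiv_asymptotic_rel] by blast

lemma bpoint_mem_iff:
  assumes "b \<in> visual_boundary p" "\<beta> \<in> b"
  shows "\<beta>' \<in> b \<longleftrightarrow> geodesic_ray p \<beta>' \<and> finite_hausdorff (\<beta> ` {0..}) (\<beta>' ` {0..})"
proof -
  note e = equiv_asymptotic_rel[of p]
  have b: "b \<in> {\<gamma>. geodesic_ray p \<gamma>} // asymptotic_rel p" using assms(1) unfolding visual_boundary_def .
  have ray: "geodesic_ray p \<beta>" using in_quotient_imp_subset[OF e b] assms(2) by blast
  have "\<beta>' \<in> b \<longleftrightarrow> (\<beta>, \<beta>') \<in> asymptotic_rel p"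
    using in_quotient_imp_closed[OF e b assms(2)] in_quotient_imp_in_rel[OF e b] assms(2) by blast
  then show ?thesis using ray unfolding asymptotic_rel_def by simp
qed

lemma bpoint_ray:
  assumes "b \<in> visual_boundary p" "\<beta> \<in> b"
  shows "geodesic_ray p \<beta>"
  using bpoint_mem_iff[OF assms] assms(2) by blast

lemma bpoint_eqI:
  assumes a: "a \<in> visual_boundary p" "\<alpha> \<in> a" and b: "b \<in> visual_boundary p" "\<beta> \<in> b"
    and h: "finite_hausdorff (\<alpha> ` {0..}) (\<beta> ` {0..})"
  shows "a = b"
proof (rule set_eqI)
  fix \<delta>
  show "\<delta> \<in> a \<longleftrightarrow> \<delta> \<in> b"
    using bpoint_mem_iff[OF a] bpoint_mem_iff[OF b] h finite_hausdorff_trans finite_hausdorff_sym by blast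
qed

lemma asymptotic_to_cong:
  assumes "asymptotic_to A b" "finite_hausdorff A B"
  shows "asymptotic_to B b"
  using assms finite_hausdorff_trans[of B A] finite_hausdorff_sym unfolding asymptotic_to_def by blast

lemma asymptotic_to_imp_finite_hausdorff:
  assumes "b \<in> visual_boundary p" "asymptotic_to A b" "asymptotic_to B b"
  shows "finite_hausdorff A B"
proof -
  obtain \<alpha> \<beta> where *: "\<alpha> \<in> b" "finite_hausdorff A (\<alpha> ` {0..})" "\<beta> \<in> b" "finite_hausdorff B (\<beta> ` {0..})"
    using assms unfolding asymptotic_to_def by blast
  then have "finite_hausdorff (\<alpha> ` {0..}) (\<beta> ` {0..})" using bpoint_mem_iff[OF assms(1)] by blast
  then show ?thesis using * finite_hausdorff_trans finite_hausdorff_sym by metis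
qed

lemma asymptotic_to_unique:
  assumes "a \<in> visual_boundary p" "b \<in> visual_boundary p" "asymptotic_to A a" "asymptotic_to A b"
  shows "a = b"
proof -
  obtain \<alpha> \<beta> where *: "\<alpha> \<in> a" "finite_hausdorff A (\<alpha> ` {0..})" "\<beta> \<in> b" "finite_hausdorff A (\<beta> ` {0..})"
    using assms unfolding asymptotic_to_def by blast
  then have "finite_hausdorff (\<alpha> ` {0..}) (\<beta> ` {0..})"
    using finite_hausdorff_trans finite_hausdorff_sym by metis
  then show ?thesis using bpoint_eqI assms(1,2) * by metis
qed

lemma image_half_line:
  "(\<lambda>t. \<gamma> (s + t)) ` {0..} = \<gamma> ` {s::real..}" "(\<lambda>t. \<gamma> (s - t)) ` {0..} = \<gamma> ` {..s}"
  "(\<lambda>t. \<gamma> (- t)) ` {..s} = \<gamma> ` {-s..}" "(\<lambda>t. \<gamma> (- t)) ` {s..} = \<gamma> ` {..-s}"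
proof -
  show "(\<lambda>t. \<gamma> (s + t)) ` {0..} = \<gamma> ` {s..}"
    by (force simp: image_iff intro: bexI[of _ "_ - s"])
  show "(\<lambda>t. \<gamma> (s - t)) ` {0..} = \<gamma> ` {..s}"
    by (force simp: image_iff intro: bexI[of _ "s - _"])
  show "(\<lambda>t. \<gamma> (- t)) ` {..s} = \<gamma> ` {-s..}" "(\<lambda>t. \<gamma> (- t)) ` {s..} = \<gamma> ` {..-s}"
    by (force simp: image_iff intro: bexI[of _ "- _"])+
qed

lemma range_reverse: "range (\<lambda>t. \<gamma> (- t)) = range (\<gamma> :: real \<Rightarrow> 'a)"
proof -
  have "range \<gamma> = \<gamma> ` range uminus" by simp
  then show ?thesis by (simp only: image_image)
qed

lemma line_between_sym: "line_between a b \<gamma> \<Longrightarrow> line_between b a (\<lambda>t. \<gamma> (- t))"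
  using geodesic_on_shift(2)[of \<gamma> 0] unfolding line_between_def by (simp add: image_half_line)

lemma finite_hausdorff_half_lines:
  fixes u v :: real
  assumes "geodesic_on UNIV \<gamma>"
  shows "finite_hausdorff (\<gamma> ` {u..}) (\<gamma> ` {v..})"
proof -
  have "within_distance \<bar>u - v\<bar> x (\<gamma> ` {v..})" if x: "x \<in> \<gamma> ` {u..}" for x and u v :: real
  proof -
    obtain t where t: "x = \<gamma> t" "u \<le> t" using x by (blast elim: imageE)
    have "dist (\<gamma> t) (\<gamma> (max t v)) \<le> \<bar>u - v\<bar>" using geodesic_onD[OF assms, of t "max t v"] t by auto
    then show ?thesis using t(1) unfolding within_distance_def by auto
  qed
  then show ?thesis by (intro finite_hausdorffI) auto
qed

lemma line_between_forward:
  assumes "line_between a b \<gamma>"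
  shows "asymptotic_to (\<gamma> ` {s..}) b"
  using assms asymptotic_to_cong finite_hausdorff_half_lines unfolding line_between_def by blast

lemma line_between_backward:
  assumes "line_between a b \<gamma>"
  shows "asymptotic_to (\<gamma> ` {..s}) a"
  using line_between_forward[OF line_between_sym[OF assms], of "- s"] by (simp add: image_half_line)

lemma line_betweenD: "line_between a b \<gamma> \<Longrightarrow> geodesic_on UNIV \<gamma>"
  unfolding line_between_def by blast

lemma closed_interval_translation:
  assumes "closed_interval J"
  shows "closed_interval ((\<lambda>t. s + t) ` J)" "closed_interval ((\<lambda>t. s - t) ` J)"
proof -
  have m: "closed_interval ((\<lambda>t. s + t) ` J)" if "closed_interval J" for J
    using that closed_translation[of J s] unfolding closed_interval_def by simp
  have "closed_interval (uminus ` J)"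
    using assms closed_negations[of J] unfolding closed_interval_def by simp
  from m[OF this] show "closed_interval ((\<lambda>t. s - t) ` J)" by (simp add: image_image)
  show "closed_interval ((\<lambda>t. s + t) ` J)" by (rule m[OF assms])
qed

lemma morse_geodesic_half_lines:
  assumes "morse_geodesic N UNIV \<gamma>"
  shows "morse_geodesic N {0..} (\<lambda>t. \<gamma> (s + t))" "morse_geodesic N {0..} (\<lambda>t. \<gamma> (s - t))"
proof -
  have g: "geodesic_on {0..} (\<lambda>t. \<gamma> (s + t))" "geodesic_on {0..} (\<lambda>t. \<gamma> (s - t))"
    by (rule geodesic_on_subset[OF geodesic_on_shift(1)[OF morse_geodesicD(1)[OF assms]]], auto)
      (rule geodesic_on_subset[OF geodesic_on_shift(2)[OF morse_geodesicD(1)[OF assms]]], auto)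
  have "morse_set N ((\<lambda>t. \<gamma> (s + t)) ` J)" "morse_set N ((\<lambda>t. \<gamma> (s - t)) ` J)" if "closed_interval J" for J
    using morse_geodesicD(2)[OF assms closed_interval_translation(1)[OF that], of s]
      morse_geodesicD(2)[OF assms closed_interval_translation(2)[OF that], of s]
    by (auto simp: image_image)
  then show "morse_geodesic N {0..} (\<lambda>t. \<gamma> (s + t))" "morse_geodesic N {0..} (\<lambda>t. \<gamma> (s - t))"
    using g unfolding morse_geodesic_def morse_on_iff by auto
qed

section \<open>Lines between boundary points seen from a common point\<close>

definition sees :: "gauge \<Rightarrow> real \<Rightarrow> 'a::metric_space \<Rightarrow> 'a bpoint \<Rightarrow> bool" where
  "sees N D x b \<longleftrightarrow> (\<exists>\<rho>. morse_geodesic N {0..} \<rho> \<and> dist (\<rho> 0) x \<le> D \<and> asymptotic_to (\<rho> ` {0..}) b)"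

lemma sees_ends_of_near_line:
  assumes l: "line_between a b \<gamma>" and m: "morse_geodesic N UNIV \<gamma>" and x: "within_distance D x (range \<gamma>)"
  shows "sees N D x a" "sees N D x b"
proof -
  obtain s where s: "dist x (\<gamma> s) \<le> D" using x unfolding within_distance_def by blast
  show "sees N D x b" unfolding sees_def
    using morse_geodesic_half_lines(1)[OF m, of s] s line_between_forward[OF l, of s]
    by (intro exI[of _ "\<lambda>t. \<gamma> (s + t)"]) (auto simp: image_half_line dist_commute)
  show "sees N D x a" unfolding sees_def
    using morse_geodesic_half_lines(2)[OF m, of s] s line_between_backward[OF l, of s]
    by (intro exI[of _ "\<lambda>t. \<gamma> (s - t)"]) (auto simp: image_half_line dist_commute)
qed

definition half_line_gauge :: "real \<Rightarrow> gauge \<Rightarrow> gauge" where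
  "half_line_gauge D N = thicken (5 * (thicken D N (9, 4) + D) + 1) N"

text \<open>A hook from \<open>\<gamma> s\<close> to \<open>x\<close> is available because
  \<open>\<gamma> s\<close> is nearest to \<open>x\<close>. With \<open>x\<close> added to the image
  of \<open>\<alpha>\<close>, \<open>ray_near_morse_set\<close> replaces the unknown Hausdorff
  distance by a constant, after which \<open>\<gamma>\<close> is a ray uniformly close to a Morse
  ray.\<close>

lemma morse_set_half_line:
  fixes \<gamma> :: "real \<Rightarrow> 'a::metric_space"
  assumes X: "proper_geodesic_space TYPE('a)" and g: "geodesic_on UNIV \<gamma>"
    and near: "\<And>u. dist x (\<gamma> s) \<le> dist x (\<gamma> u)"
    and \<alpha>: "morse_geodesic N {0..} \<alpha>" "dist (\<alpha> 0) x \<le> D"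
    and h: "finite_hausdorff (\<gamma> ` {s..}) (\<alpha> ` {0..})"
  shows "morse_set (half_line_gauge D N) (\<gamma> ` {s..})"
proof -
  have D: "0 \<le> D" using \<alpha>(2) zero_le_dist order_trans by blast
  define A where "A = insert x (\<alpha> ` {0..})"
  have xA: "within_distance D x (\<alpha> ` {0..})"
    using \<alpha>(2) unfolding within_distance_def by (auto simp: dist_commute)
  have A: "morse_set (thicken D N) A"
    unfolding A_def by (rule morse_set_insert[OF _ D xA]) (rule morse_geodesicD(2)[OF \<alpha>(1)], auto)
  obtain H where H: "\<And>y. y \<in> \<gamma> ` {s..} \<Longrightarrow> within_distance H y (\<alpha> ` {0..})"
    using h unfolding finite_hausdorff_def by blast
  have near_A: "within_distance (thicken D N (9, 4)) (\<gamma> t) A" if "s \<le> t" for t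
    by (rule ray_near_morse_set[OF X g _ _ _ _ A that, of x H])
      (use near H in \<open>auto simp: A_def intro: within_distance_mono\<close>)
  have close: "within_distance (thicken D N (9, 4) + D) (\<gamma> t) (\<alpha> ` {0..})" if "s \<le> t" for t
  proof -
    from near_A[OF that] obtain y where y: "y \<in> A" "dist (\<gamma> t) y \<le> thicken D N (9, 4)" unfolding within_distance_def by blast
    have "within_distance D y (\<alpha> ` {0..})" using y(1) xA D by (auto simp: A_def intro: within_distance_self)
    from within_distance_triangle[OF this y(2)] show ?thesis by (simp add: add.commute)
  qed
  have "morse_set (half_line_gauge D N) ((\<lambda>t. \<gamma> (s + t)) ` {0..})"
    unfolding half_line_gauge_def
  proof (rule morse_set_near_morse_ray[OF \<alpha>(1)])
    show "geodesic_on {0..} (\<lambda>t. \<gamma> (s + t))"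
      using geodesic_on_subset[OF geodesic_on_shift(1)[OF g]] by auto
  qed (use close in auto)
  then show ?thesis by (simp add: image_half_line)
qed

text \<open>The preceding operations yield arbitrary functions, whereas 2-stability and the
  constants \<open>\<kappa>\<close> concern extensional nonnegative gauges. Enlarging a gauge is
  harmless by \<open>morse_geodesic_mono\<close>.\<close>

definition proper_gauge :: "gauge \<Rightarrow> gauge" where
  "proper_gauge N = restrict (\<lambda>z. max 0 (N z)) ({1..} \<times> {0..})"

lemma morse_gauge_proper_gauge [simp]: "morse_gauge (proper_gauge N)"
  unfolding morse_gauge_def proper_gauge_def by auto

lemma morse_geodesic_mono:
  assumes "morse_geodesic N I \<gamma>" "\<And>l e. 1 \<le> l \<Longrightarrow> 0 \<le> e \<Longrightarrow> N (l, e) \<le> M (l, e)"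
  shows "morse_geodesic M I \<gamma>"
  using assms(1) morse_set_mono[where N = N and M = M] assms(2) unfolding morse_geodesic_def morse_on_iff
  by blast

definition line_gauge :: "real \<Rightarrow> gauge \<Rightarrow> gauge" where
  "line_gauge D N = proper_gauge (subgeodesic_gauge (join_gauge (half_line_gauge D N)))"

text \<open>Cut the line at its point nearest to \<open>x\<close>: each half is Morse by comparison
  with the ray to its end, and the halves share the cut. The gauge depends neither on
  \<open>x\<close> nor on the line, which is the source of the later uniformity.\<close>

lemma morse_line_if_sees:
  fixes \<gamma> :: "real \<Rightarrow> 'a::metric_space"
  assumes X: "proper_geodesic_space TYPE('a)"
    and ab: "a \<in> visual_boundary p" "b \<in> visual_boundary p" "sees N D x a" "sees N D x b"
    and l: "line_between a b \<gamma>"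
  shows "morse_geodesic (line_gauge D N) UNIV \<gamma>"
proof -
  note g = line_betweenD[OF l]
  obtain \<alpha> where \<alpha>: "morse_geodesic N {0..} \<alpha>" "dist (\<alpha> 0) x \<le> D" "asymptotic_to (\<alpha> ` {0..}) a"
    using ab(3) unfolding sees_def by blast
  obtain \<beta> where \<beta>: "morse_geodesic N {0..} \<beta>" "dist (\<beta> 0) x \<le> D" "asymptotic_to (\<beta> ` {0..}) b"
    using ab(4) unfolding sees_def by blast
  obtain s where s: "\<And>u. dist x (\<gamma> s) \<le> dist x (\<gamma> u)" using ex_nearest_point[OF g, of x] by auto
  have r: "morse_set (half_line_gauge D N) (\<gamma> ` {s..})"
    by (rule morse_set_half_line[OF X g s \<beta>(1,2)
          asymptotic_to_imp_finite_hausdorff[OF ab(2) line_between_forward[OF l] \<beta>(3)]])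
  note l' = line_between_sym[OF l]
  have "morse_set (half_line_gauge D N) ((\<lambda>t. \<gamma> (- t)) ` {-s..})"
    by (rule morse_set_half_line[OF X line_betweenD[OF l'] _ \<alpha>(1,2)
          asymptotic_to_imp_finite_hausdorff[OF ab(1) line_between_forward[OF l'] \<alpha>(3)]])
      (use s in auto)
  then have "morse_set (half_line_gauge D N) (\<gamma> ` {..s})" by (simp add: image_half_line)
  from morse_set_Un[OF X this r, of "\<gamma> s"]
  have "morse_set (join_gauge (half_line_gauge D N)) (\<gamma> ` {..s} \<union> \<gamma> ` {s..})" by auto
  moreover have "\<gamma> ` {..s} \<union> \<gamma> ` {s..} = \<gamma> ` UNIV" by (auto simp: image_Un[symmetric])
  ultimately have "morse_geodesic (subgeodesic_gauge (join_gauge (half_line_gauge D N))) UNIV \<gamma>"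
    using morse_geodesic_if_morse_set[OF g] by simp
  then show ?thesis unfolding line_gauge_def by (rule morse_geodesic_mono) (simp add: proper_gauge_def)
qed

lemma morse_gauge_line_gauge [simp]: "morse_gauge (line_gauge D N)"
  unfolding line_gauge_def by simp

section \<open>Existence of lines and slim triangles\<close>

text \<open>Pointwise compactness is enough: by the growth bound all approximations lie in a product
  of balls, compact by Tychonoff's theorem, and being isometric on a window is a closed condition
  there. \<open>infdist\<close> makes closeness to \<open>A\<close> a closed condition as well; its
  infimum need not be attained, hence \<open>C + 1\<close>.\<close>

lemma ex_isometric_limit:
  fixes q :: "'a::metric_space" and A B :: "'a set"
  assumes X: "proper_geodesic_space TYPE('a)" and ne: "A \<noteq> {}" "B \<noteq> {}"
    and approx: "\<And>k::nat. \<exists>\<delta>. (\<forall>s\<in>{- real k..real k}. \<forall>t\<in>{- real k..real k}. dist (\<delta> s) (\<delta> t) = \<bar>s - t\<bar>) \<and>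
      (\<forall>t\<in>{- real k..0}. within_distance C (\<delta> t) A) \<and> (\<forall>t\<in>{0..real k}. within_distance C (\<delta> t) B) \<and>
      (\<forall>t::real. dist q (\<delta> t) \<le> R + \<bar>t\<bar>)"
  shows "\<exists>\<gamma>. geodesic_on UNIV \<gamma> \<and> (\<forall>t\<le>0. within_distance (C + 1) (\<gamma> t) A) \<and>
    (\<forall>t\<ge>0. within_distance (C + 1) (\<gamma> t) B)"
proof -
  define S where "S = Pi\<^sub>E UNIV (\<lambda>t::real. cball q (R + \<bar>t\<bar>))"
  have "compactin (product_topology (\<lambda>_. euclidean) UNIV) S"
    unfolding S_def using X by (simp add: compactin_PiE proper_geodesic_space_def)
  then have S: "compact S" by (simp add: euclidean_product_topology)
  define F where "F k = {f. (\<forall>s t. s \<in> {-real k..k} \<longrightarrow> t \<in> {-real k..k} \<longrightarrow> dist (f s) (f t) = \<bar>s - t\<bar>) \<and>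
    (\<forall>t. t \<in> {-real k..0} \<longrightarrow> infdist (f t) A \<le> C) \<and> (\<forall>t. t \<in> {0..real k} \<longrightarrow> infdist (f t) B \<le> C)}" for k :: nat
  have clF: "closed (F k)" for k
    unfolding F_def
    by (intro closed_Collect_conj closed_Collect_all closed_Collect_imp open_Collect_const
        closed_Collect_eq closed_Collect_le continuous_on_dist continuous_on_infdist continuous_on_const
        continuous_on_product_coordinates)
  have mono: "F k \<subseteq> F j" if "j \<le> k" for j k using that unfolding F_def by auto
  have inf_le: "infdist x D \<le> C" if "within_distance C x D" for x and D :: "'a set"
    using that unfolding within_distance_def by (auto intro: infdist_le2)
  have SF: "S \<inter> F k \<noteq> {}" for k
  proof -
    obtain \<delta> where \<delta>: "\<forall>s\<in>{-real k..k}. \<forall>t\<in>{-real k..k}. dist (\<delta> s) (\<delta> t) = \<bar>s - t\<bar>"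
      "\<forall>t\<in>{-real k..0}. within_distance C (\<delta> t) A" "\<forall>t\<in>{0..real k}. within_distance C (\<delta> t) B"
      "\<forall>t::real. dist q (\<delta> t) \<le> R + \<bar>t\<bar>" using approx[of k] by blast
    have "\<delta> \<in> S" using \<delta>(4) by (simp add: S_def PiE_iff)
    moreover have "\<delta> \<in> F k" using \<delta>(1-3) inf_le unfolding F_def by blast
    ultimately show ?thesis by blast
  qed
  have "S \<inter> (\<Inter>k\<in>UNIV. F k) \<noteq> {}"
  proof (rule compact_imp_fip_image[OF S clF])
    fix I' :: "nat set" assume "finite I'"
    then obtain m where "\<forall>i\<in>I'. i \<le> m" using finite_nat_set_iff_bounded_le by blast
    then have "F m \<subseteq> (\<Inter>i\<in>I'. F i)" using mono by blast
    then show "S \<inter> (\<Inter>i\<in>I'. F i) \<noteq> {}" using SF[of m] by blast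
  qed
  then obtain \<gamma> where \<gamma>: "\<And>k. \<gamma> \<in> F k" by blast
  have big: "\<exists>k::nat. \<bar>s\<bar> \<le> k \<and> \<bar>t\<bar> \<le> k" for s t :: real
    using real_arch_simple[of "max \<bar>s\<bar> \<bar>t\<bar>"] by auto
  have "geodesic_on UNIV \<gamma>" unfolding geodesic_on_def
  proof (intro conjI ballI)
    fix s t :: real
    obtain k :: nat where "\<bar>s\<bar> \<le> k" "\<bar>t\<bar> \<le> k" using big by blast
    then have "s \<in> {- real k..k}" "t \<in> {- real k..k}" by auto
    then show "dist (\<gamma> s) (\<gamma> t) = \<bar>s - t\<bar>" using \<gamma>[of k] unfolding F_def by blast
  qed simp
  moreover have wd: "within_distance (C + 1) x D" if D: "infdist x D \<le> C" "D \<noteq> {}" for x and D :: "'a set"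
  proof -
    have "Inf ((\<lambda>d. dist x d) ` D) < C + 1" using D by (simp add: infdist_notempty)
    then obtain d where "d \<in> D" "dist x d < C + 1" using cInf_lessD[of "(\<lambda>d. dist x d) ` D"] D(2) by blast
    then show ?thesis unfolding within_distance_def by force
  qed
  have "within_distance (C + 1) (\<gamma> t) A" if "t \<le> 0" for t
  proof -
    obtain k :: nat where "\<bar>t\<bar> \<le> k" using big by blast
    then show ?thesis using \<gamma>[of k] that wd ne unfolding F_def by auto
  qed
  moreover have "within_distance (C + 1) (\<gamma> t) B" if "t \<ge> 0" for t
  proof -
    obtain k :: nat where "\<bar>t\<bar> \<le> k" using big by blast
    then show ?thesis using \<gamma>[of k] that wd ne unfolding F_def by auto
  qed
  ultimately show ?thesis by blast
qed

lemma morse_boundaryD: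
  assumes "b \<in> morse_boundary p"
  shows "b \<in> visual_boundary p" "\<exists>N. \<exists>\<beta>\<in>b. morse_geodesic N {0..} \<beta>"
  using assms unfolding morse_boundary_def morse_stratum_def by auto

text \<open>Cut the geodesic at its point nearest to \<open>q\<close>; each half, hooked to
  \<open>q\<close>, is a \<open>(3, 2)\<close>-quasi-geodesic with both ends in a single
  set.\<close>

lemma segment_between_morse_rays:
  fixes A B :: "'a::metric_space set"
  assumes X: "proper_geodesic_space TYPE('a)"
    and A: "morse_set N A" "q \<in> A" "x \<in> A" and B: "morse_set N B" "q \<in> B" "y \<in> B"
  shows "\<exists>\<eta> L s. geodesic_on {0..L} \<eta> \<and> \<eta> 0 = x \<and> \<eta> L = y \<and> 0 \<le> s \<and> s \<le> L \<and>
    (\<forall>u\<in>{0..s}. within_distance (N (3, 2)) (\<eta> u) A) \<and> (\<forall>u\<in>{s..L}. within_distance (N (3, 2)) (\<eta> u) B)"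
proof -
  define L where "L = dist x y"
  obtain \<eta> where \<eta>: "\<forall>u\<in>{0..L}. \<forall>v\<in>{0..L}. dist (\<eta> u) (\<eta> v) = \<bar>u - v\<bar>" "\<eta> 0 = x" "\<eta> L = y"
    using ex_geodesic[OF X, of x y] unfolding L_def by blast
  have g: "geodesic_on {0..L} \<eta>" using \<eta>(1) by (simp add: geodesic_on_def L_def)
  obtain s where s: "s \<in> {0..L}" "\<And>u. u \<in> {0..L} \<Longrightarrow> dist q (\<eta> s) \<le> dist q (\<eta> u)"
    using ex_nearest_point[OF g] by blast
  have "\<exists>\<tau>. qie 3 2 {0..s + dist q (\<eta> s)} \<tau> \<and> (\<forall>u\<in>{0..s}. \<tau> u = \<eta> u) \<and> \<tau> (s + dist q (\<eta> s)) = q"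
  proof -
    have "dist q (\<eta> s) \<le> dist q (\<eta> u) + 1" if "u \<in> {0..s}" for u
      using s(2)[of u] s(1) that by auto
    from hook_right[OF X geodesic_qie[OF g, of "{0..s}"] _ this] show ?thesis using s(1) by auto
  qed
  then obtain \<tau> where \<tau>: "qie 3 2 {0..s + dist q (\<eta> s)} \<tau>" "\<And>u. u \<in> {0..s} \<Longrightarrow> \<tau> u = \<eta> u"
    "\<tau> (s + dist q (\<eta> s)) = q" by blast
  have "within_distance (N (3, 2)) (\<eta> u) A" if u: "u \<in> {0..s}" for u
  proof -
    have *: "0 \<le> s + dist q (\<eta> s)" "u \<le> s + dist q (\<eta> s)"
      using s(1) u zero_le_dist[of q "\<eta> s"] unfolding atLeastAtMost_iff by linarith+
    have "within_distance (N (3, 2)) (\<tau> u) A"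
      using s(1) u \<tau>(2)[of 0] \<tau>(3) \<eta>(2) A * by (intro morse_setD[OF A(1) _ \<tau>(1)]) auto
    then show ?thesis using \<tau>(2)[OF u] by simp
  qed
  moreover have "\<exists>\<tau>. qie 3 2 {s - dist q (\<eta> s)..L} \<tau> \<and> (\<forall>u\<in>{s..L}. \<tau> u = \<eta> u) \<and> \<tau> (s - dist q (\<eta> s)) = q"
  proof -
    have "dist q (\<eta> s) \<le> dist q (\<eta> u) + 1" if "u \<in> {s..L}" for u
      using s(2)[of u] s(1) that by auto
    from hook_left[OF X geodesic_qie[OF g, of "{s..L}"] _ this] show ?thesis using s(1) by auto
  qed
  then obtain \<tau>' where \<tau>': "qie 3 2 {s - dist q (\<eta> s)..L} \<tau>'" "\<And>u. u \<in> {s..L} \<Longrightarrow> \<tau>' u = \<eta> u"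
    "\<tau>' (s - dist q (\<eta> s)) = q" by blast
  have "within_distance (N (3, 2)) (\<eta> u) B" if u: "u \<in> {s..L}" for u
  proof -
    have *: "s - dist q (\<eta> s) \<le> L" "s - dist q (\<eta> s) \<le> u"
      using s(1) u zero_le_dist[of q "\<eta> s"] unfolding atLeastAtMost_iff by linarith+
    have "within_distance (N (3, 2)) (\<tau>' u) B"
      using s(1) u \<tau>'(2)[of L] \<tau>'(3) \<eta>(3) B * by (intro morse_setD[OF B(1) _ \<tau>'(1)]) auto
    then show ?thesis using \<tau>'(2)[OF u] by simp
  qed
  ultimately show ?thesis using g \<eta>(2,3) s(1) by (intro exI[of _ \<eta>] exI[of _ L] exI[of _ s]) auto
qed

text \<open>Otherwise arbitrarily long initial segments of \<open>\<alpha>\<close> have both ends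
  within \<open>D\<close> of \<open>\<beta>\<close>; the Morse property then keeps all of
  \<open>\<alpha>\<close> at bounded distance from \<open>\<beta>\<close>, and the two classes
  agree.\<close>

lemma morse_rays_diverge:
  assumes a: "a \<in> visual_boundary p" "\<alpha> \<in> a" and b: "b \<in> visual_boundary p" "\<beta> \<in> b" and "a \<noteq> b"
    and N: "morse_set N (\<beta> ` {0..})"
  shows "\<exists>R. \<forall>i\<ge>0. \<forall>j\<ge>0. dist (\<alpha> i) (\<beta> j) \<le> D \<longrightarrow> i \<le> R"
proof (rule ccontr)
  assume "\<not> ?thesis"
  then have far: "\<exists>i\<ge>t. \<exists>j\<ge>0. 0 \<le> i \<and> dist (\<alpha> i) (\<beta> j) \<le> D" for t by (meson less_imp_le linorder_not_le)
  have g: "geodesic_on {0..} \<alpha>" "geodesic_on {0..} \<beta>" and p: "\<alpha> 0 = p" "\<beta> 0 = p"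
    using bpoint_ray[OF a] bpoint_ray[OF b] unfolding geodesic_ray_def by auto
  have D: "0 \<le> D" using far[of 0] zero_le_dist order_trans by meson
  have "within_distance (N (1, 0 + 2 * D) + D) (\<alpha> t) (\<beta> ` {0..})" if t: "0 \<le> t" for t
  proof -
    obtain i j where ij: "t \<le> i" "0 \<le> j" "dist (\<alpha> i) (\<beta> j) \<le> D" using far[of t] by blast
    show ?thesis
    proof (rule morse_set_near_endpoints[OF N])
      show "qie 1 0 {0..i} \<alpha>" by (rule geodesic_qie[OF g(1)]) auto
      show "within_distance D (\<alpha> 0) (\<beta> ` {0..})" using D p by (auto intro!: within_distance_self image_eqI[of _ _ 0])
      show "within_distance D (\<alpha> i) (\<beta> ` {0..})" using ij unfolding within_distance_def by auto
    qed (use ij t D in auto)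
  qed
  from finite_hausdorff_if_near_ray[OF g(2) geodesic_qie[OF g(1) order_refl] this]
  have "a = b" using bpoint_eqI a b by blast
  with \<open>a \<noteq> b\<close> show False ..
qed

lemma ex_line_between:
  fixes p :: "'a::metric_space"
  assumes X: "proper_geodesic_space TYPE('a)"
    and ab: "a \<in> morse_boundary p" "b \<in> morse_boundary p" "a \<noteq> b"
  shows "\<exists>\<gamma>. line_between a b \<gamma>"
proof -
  note a = morse_boundaryD(1)[OF ab(1)] note b = morse_boundaryD(1)[OF ab(2)]
  obtain N\<^sub>1 \<alpha> where \<alpha>: "\<alpha> \<in> a" "morse_geodesic N\<^sub>1 {0..} \<alpha>" using morse_boundaryD(2)[OF ab(1)] by blast
  obtain N\<^sub>2 \<beta> where \<beta>: "\<beta> \<in> b" "morse_geodesic N\<^sub>2 {0..} \<beta>" using morse_boundaryD(2)[OF ab(2)] by blast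
  define N where "N z = max (N\<^sub>1 z) (N\<^sub>2 z)" for z
  define A where "A = \<alpha> ` {0..}"
  define B where "B = \<beta> ` {0..}"
  have A: "morse_set N A" unfolding A_def
    by (rule morse_set_mono[OF morse_geodesicD(2)[OF \<alpha>(2)]]) (auto simp: N_def)
  have B: "morse_set N B" unfolding B_def
    by (rule morse_set_mono[OF morse_geodesicD(2)[OF \<beta>(2)]]) (auto simp: N_def)
  have g: "geodesic_on {0..} \<alpha>" "geodesic_on {0..} \<beta>" and p: "\<alpha> 0 = p" "\<beta> 0 = p"
    using bpoint_ray[OF a \<alpha>(1)] bpoint_ray[OF b \<beta>(1)] unfolding geodesic_ray_def by auto
  define C where "C = N (3, 2)"
  obtain R where R: "\<And>i j. 0 \<le> i \<Longrightarrow> 0 \<le> j \<Longrightarrow> dist (\<alpha> i) (\<beta> j) \<le> 2 * C \<Longrightarrow> i \<le> R"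
    using morse_rays_diverge[OF a \<alpha>(1) b \<beta>(1) ab(3) B[unfolded B_def], of "2 * C"] by blast
  have approx: "\<exists>\<delta>. (\<forall>s\<in>{- real k..real k}. \<forall>t\<in>{- real k..real k}. dist (\<delta> s) (\<delta> t) = \<bar>s - t\<bar>) \<and>
      (\<forall>t\<in>{- real k..0}. within_distance C (\<delta> t) A) \<and> (\<forall>t\<in>{0..real k}. within_distance C (\<delta> t) B) \<and>
      (\<forall>t::real. dist p (\<delta> t) \<le> R + C + \<bar>t\<bar>)" for k :: nat
  proof -
    obtain n :: nat where n: "k + (R + C) \<le> n" using real_arch_simple by blast
    have mem: "p \<in> A" "p \<in> B" "\<alpha> n \<in> A" "\<beta> n \<in> B"
      using p by (auto simp: A_def B_def intro: image_eqI[of _ _ 0])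
    obtain \<eta> L s where \<eta>: "geodesic_on {0..L} \<eta>" "\<eta> 0 = \<alpha> n" "\<eta> L = \<beta> n" "0 \<le> s" "s \<le> L"
      "\<And>u. u \<in> {0..s} \<Longrightarrow> within_distance C (\<eta> u) A" "\<And>u. u \<in> {s..L} \<Longrightarrow> within_distance C (\<eta> u) B"
      using segment_between_morse_rays[OF X A mem(1,3) B mem(2,4)] unfolding C_def by blast
    obtain i where i: "0 \<le> i" "dist (\<eta> s) (\<alpha> i) \<le> C"
      using \<eta>(6)[of s] \<eta>(4) unfolding within_distance_def A_def by auto
    obtain j where j: "0 \<le> j" "dist (\<eta> s) (\<beta> j) \<le> C"
      using \<eta>(7)[of s] \<eta>(5) unfolding within_distance_def B_def by auto
    \<comment> \<open>At the cut the segment is close to both rays, so divergence keeps the cut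
      within \<open>R + C\<close> of \<open>p\<close>: the segments do not escape, and both halves
      become long.\<close>
    have "dist (\<alpha> i) (\<beta> j) \<le> 2 * C"
      using i(2) j(2) dist_triangle[of "\<alpha> i" "\<beta> j" "\<eta> s"] by (simp add: dist_commute)
    then have "i \<le> R" using R i j by blast
    then have ps: "dist p (\<eta> s) \<le> R + C"
      using i geodesic_onD[OF g(1), of i 0] p dist_triangle[of p "\<eta> s" "\<alpha> i"] by (simp add: dist_commute)
    have "dist p (\<alpha> n) = n" "dist p (\<beta> n) = n"
      using geodesic_onD[OF g(1), of 0 n] geodesic_onD[OF g(2), of 0 n] p by auto
    moreover have "dist (\<eta> s) (\<alpha> n) = s" "dist (\<eta> s) (\<beta> n) = L - s"
      using geodesic_onD[OF \<eta>(1), of s 0] geodesic_onD[OF \<eta>(1), of s L] \<eta>(2-5) by auto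
    ultimately have sk: "k \<le> s" "k \<le> L - s"
      using ps n dist_triangle[of p "\<alpha> n" "\<eta> s"] dist_triangle[of p "\<beta> n" "\<eta> s"] by auto
    \<comment> \<open>The segment is recentred at its cut; \<open>p\<close> is a filler outside the
      window that respects the growth bound.\<close>
    define \<delta> where "\<delta> t = (if \<bar>t\<bar> \<le> k then \<eta> (s + t) else p)" for t :: real
    have RC: "0 \<le> R + C" using ps zero_le_dist[of p "\<eta> s"] by linarith
    have "dist p (\<delta> t) \<le> R + C + \<bar>t\<bar>" for t
    proof (cases "\<bar>t\<bar> \<le> k")
      case True
      then have "s + t \<in> {0..L}" using sk unfolding atLeastAtMost_iff by linarith
      then have "dist (\<eta> s) (\<eta> (s + t)) = \<bar>t\<bar>" using geodesic_onD[OF \<eta>(1), of s "s + t"] \<eta>(4,5) by auto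
      then show ?thesis using True ps dist_triangle[of p "\<eta> (s + t)" "\<eta> s"] by (simp add: \<delta>_def)
    next
      case False then show ?thesis using RC by (simp add: \<delta>_def)
    qed
    moreover have "\<forall>u\<in>{-real k..k}. \<forall>v\<in>{-real k..k}. dist (\<delta> u) (\<delta> v) = \<bar>u - v\<bar>"
      using geodesic_onD[OF \<eta>(1)] sk by (auto simp: \<delta>_def)
    moreover have "\<forall>t\<in>{-real k..0}. within_distance C (\<delta> t) A" using \<eta>(6) sk by (auto simp: \<delta>_def)
    moreover have "\<forall>t\<in>{0..real k}. within_distance C (\<delta> t) B" using \<eta>(7) sk by (auto simp: \<delta>_def)
    ultimately show ?thesis by blast
  qed
  have "A \<noteq> {}" "B \<noteq> {}" by (auto simp: A_def B_def)
  from ex_isometric_limit[OF X this approx]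
  obtain \<gamma> where \<gamma>: "geodesic_on UNIV \<gamma>" "\<forall>t\<le>0. within_distance (C + 1) (\<gamma> t) A"
    "\<forall>t\<ge>0. within_distance (C + 1) (\<gamma> t) B" by blast
  have q: "qie 1 0 {0..} (\<lambda>t. \<gamma> (0 + t))" "qie 1 0 {0..} (\<lambda>t. \<gamma> (0 - t))"
    by (rule geodesic_qie[OF geodesic_on_shift(1)[OF \<gamma>(1)]], simp)
      (rule geodesic_qie[OF geodesic_on_shift(2)[OF \<gamma>(1)]], simp)
  have "finite_hausdorff ((\<lambda>t. \<gamma> (0 + t)) ` {0..}) (\<beta> ` {0..})"
    by (rule finite_hausdorff_if_near_ray[where E = "C + 1", OF g(2) q(1)]) (use \<gamma>(3) in \<open>auto simp: B_def\<close>)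
  moreover have "finite_hausdorff ((\<lambda>t. \<gamma> (0 - t)) ` {0..}) (\<alpha> ` {0..})"
    by (rule finite_hausdorff_if_near_ray[where E = "C + 1", OF g(1) q(2)]) (use \<gamma>(2) in \<open>auto simp: A_def\<close>)
  ultimately have "line_between a b \<gamma>"
    using \<gamma>(1) \<alpha>(1) \<beta>(1) unfolding line_between_def asymptotic_to_def image_half_line by blast
  then show ?thesis by blast
qed

lemma line_near_morse_line:
  fixes \<gamma> :: "real \<Rightarrow> 'a::metric_space"
  assumes X: "proper_geodesic_space TYPE('a)" and ab: "a \<in> visual_boundary p" "b \<in> visual_boundary p"
    and l: "line_between a b \<gamma>" "line_between a b \<gamma>'" and N: "morse_geodesic N UNIV \<gamma>"
  shows "within_distance (N (9, 4)) (\<gamma>' t) (range \<gamma>)"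
proof -
  have "finite_hausdorff (\<gamma>' ` {0..}) (\<gamma> ` {0..})" "finite_hausdorff (\<gamma>' ` {..0}) (\<gamma> ` {..0})"
    using asymptotic_to_imp_finite_hausdorff ab l unfolding line_between_def by blast+
  then obtain H\<^sub>1 H\<^sub>2 where H: "\<And>x. x \<in> \<gamma>' ` {0..} \<Longrightarrow> within_distance H\<^sub>1 x (\<gamma> ` {0..})"
    "\<And>x. x \<in> \<gamma>' ` {..0} \<Longrightarrow> within_distance H\<^sub>2 x (\<gamma> ` {..0})" unfolding finite_hausdorff_def by blast
  have "within_distance (max H\<^sub>1 H\<^sub>2) (\<gamma>' u) (range \<gamma>)" for u
  proof (cases "0 \<le> u")
    case True
    then have "within_distance H\<^sub>1 (\<gamma>' u) (\<gamma> ` {0..})" using H(1) by auto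
    then show ?thesis by (rule within_distance_mono) auto
  next
    case False
    then have "within_distance H\<^sub>2 (\<gamma>' u) (\<gamma> ` {..0})" using H(2) by auto
    then show ?thesis by (rule within_distance_mono) auto
  qed
  moreover have "morse_set N (range \<gamma>)" by (rule morse_geodesicD(2)[OF N]) auto
  ultimately show ?thesis by (rule line_near_morse_set[OF X line_betweenD[OF l(2)]])
qed

definition slim_constant :: "gauge \<Rightarrow> real \<Rightarrow> real" where
  "slim_constant N \<kappa> = join_gauge (thicken \<kappa> N) (9, 4)"

text \<open>Two sides need not meet, so a point of \<open>\<beta>\<close> within
  \<open>\<kappa>\<close> of \<open>\<gamma>\<close> is added to \<open>\<gamma>\<close>, which
  makes the union Morse. The third side is at finite distance from this union because of its ends,
  and \<open>line_near_morse_set\<close> makes that distance uniform.\<close>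

lemma ideal_triangle_slim:
  fixes p :: "'a::metric_space"
  assumes X: "proper_geodesic_space TYPE('a)" and \<kappa>: "triangle_constant p N \<kappa>"
    and v: "a \<in> morse_boundary p" "b \<in> morse_boundary p" "c \<in> morse_boundary p"
    and l: "line_between a b \<alpha>" "line_between b c \<beta>" "line_between c a \<gamma>"
    and m: "morse_geodesic N UNIV \<alpha>" "morse_geodesic N UNIV \<beta>" "morse_geodesic N UNIV \<gamma>"
  shows "within_distance (slim_constant N \<kappa>) (\<alpha> t) (range \<beta> \<union> range \<gamma>)"
proof -
  note vb = v[THEN morse_boundaryD(1)]
  have "\<exists>q\<^sub>1\<in>range \<alpha>. \<exists>q\<^sub>2\<in>range \<beta>. \<exists>q\<^sub>3\<in>range \<gamma>. dist q\<^sub>1 q\<^sub>2 \<le> \<kappa> \<and> dist q\<^sub>2 q\<^sub>3 \<le> \<kappa> \<and> dist q\<^sub>3 q\<^sub>1 \<le> \<kappa>"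
    using \<kappa>[unfolded triangle_constant_def, rule_format, of "Inr a" "Inr b" "Inr c" UNIV \<alpha> UNIV \<beta> UNIV \<gamma>] v l m
    by auto
  then obtain q\<^sub>2 q\<^sub>3 where q: "q\<^sub>2 \<in> range \<beta>" "q\<^sub>3 \<in> range \<gamma>" "dist q\<^sub>2 q\<^sub>3 \<le> \<kappa>" by blast
  have \<kappa>0: "0 \<le> \<kappa>" using q(3) zero_le_dist order_trans by blast
  have A: "morse_set (thicken \<kappa> N) (insert q\<^sub>2 (range \<beta>))"
    by (rule morse_set_insert[OF _ \<kappa>0]) (use morse_geodesicD(2)[OF m(2)] q \<kappa>0 in \<open>auto intro: within_distance_self\<close>)
  have B: "morse_set (thicken \<kappa> N) (insert q\<^sub>2 (range \<gamma>))"
    by (rule morse_set_insert[OF _ \<kappa>0]) (use morse_geodesicD(2)[OF m(3)] q in \<open>auto simp: within_distance_def\<close>)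
  have "insert q\<^sub>2 (range \<beta>) \<union> insert q\<^sub>2 (range \<gamma>) = range \<beta> \<union> range \<gamma>" using q(1) by blast
  then have P: "morse_set (join_gauge (thicken \<kappa> N)) (range \<beta> \<union> range \<gamma>)"
    using morse_set_Un[OF X A B, of q\<^sub>2] by simp
  have "finite_hausdorff (\<alpha> ` {0..}) (\<beta> ` {..0})" "finite_hausdorff (\<alpha> ` {..0}) (\<gamma> ` {0..})"
    using asymptotic_to_imp_finite_hausdorff vb l unfolding line_between_def by blast+
  then obtain H\<^sub>1 H\<^sub>2 where H: "\<And>x. x \<in> \<alpha> ` {0..} \<Longrightarrow> within_distance H\<^sub>1 x (\<beta> ` {..0})"
    "\<And>x. x \<in> \<alpha> ` {..0} \<Longrightarrow> within_distance H\<^sub>2 x (\<gamma> ` {0..})" unfolding finite_hausdorff_def by blast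
  have "within_distance (max H\<^sub>1 H\<^sub>2) (\<alpha> u) (range \<beta> \<union> range \<gamma>)" for u
  proof (cases "0 \<le> u")
    case True
    then have "within_distance H\<^sub>1 (\<alpha> u) (\<beta> ` {..0})" using H(1) by auto
    then show ?thesis by (rule within_distance_mono) auto
  next
    case False
    then have "within_distance H\<^sub>2 (\<alpha> u) (\<gamma> ` {0..})" using H(2) by auto
    then show ?thesis by (rule within_distance_mono) auto
  qed
  then show ?thesis unfolding slim_constant_def
    by (rule line_near_morse_set[OF X line_betweenD[OF l(1)] _ P])
qed

text \<open>A coarse comparison of Busemann functions: \<open>\<gamma>\<^sub>2 T\<close> far out is
  within \<open>N (9, 4)\<close> of some \<open>\<gamma>\<^sub>1 T'\<close>, so
  \<open>T - s\<^sub>2\<close> and \<open>T' - s\<^sub>1\<close> both approximate the distance from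
  \<open>x\<close> to it. Subtracting the same relation for \<open>y\<close> eliminates
  \<open>T\<close> and \<open>T'\<close>.\<close>

lemma asymptotic_lines_shift:
  fixes \<gamma>\<^sub>1 \<gamma>\<^sub>2 :: "real \<Rightarrow> 'a::metric_space"
  assumes X: "proper_geodesic_space TYPE('a)" and g: "geodesic_on UNIV \<gamma>\<^sub>1" "geodesic_on UNIV \<gamma>\<^sub>2"
    and N: "morse_set N (range \<gamma>\<^sub>1)" and h: "finite_hausdorff (\<gamma>\<^sub>1 ` {0..}) (\<gamma>\<^sub>2 ` {0..})"
    and x: "dist x (\<gamma>\<^sub>1 s\<^sub>1) \<le> K" "dist x (\<gamma>\<^sub>2 s\<^sub>2) \<le> K" and y: "dist y (\<gamma>\<^sub>1 t\<^sub>1) \<le> K" "dist y (\<gamma>\<^sub>2 t\<^sub>2) \<le> K"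
  shows "\<bar>(t\<^sub>1 - s\<^sub>1) - (t\<^sub>2 - s\<^sub>2)\<bar> \<le> 2 * N (9, 4) + 4 * K"
proof -
  define C where "C = N (9, 4)"
  have g2: "geodesic_on {0..} \<gamma>\<^sub>2" by (rule geodesic_on_subset[OF g(2)]) auto
  obtain H where H: "\<And>t. 0 \<le> t \<Longrightarrow> within_distance H (\<gamma>\<^sub>2 t) (\<gamma>\<^sub>1 ` {0..})"
    using h unfolding finite_hausdorff_def by blast
  obtain T0 where T0: "0 \<le> T0" "\<And>u. 0 \<le> u \<Longrightarrow> dist (\<gamma>\<^sub>1 0) (\<gamma>\<^sub>2 T0) \<le> dist (\<gamma>\<^sub>1 0) (\<gamma>\<^sub>2 u)"
    using ex_nearest_point[OF g2, of "\<gamma>\<^sub>1 0"] by auto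
  have near: "within_distance C (\<gamma>\<^sub>2 T) (range \<gamma>\<^sub>1)" if "T0 \<le> T" for T
    unfolding C_def
  proof (rule ray_near_morse_set[OF X g2 _ _ _ _ N that, of "\<gamma>\<^sub>1 0" H])
    show "within_distance H (\<gamma>\<^sub>2 u) (range \<gamma>\<^sub>1)" if "T0 \<le> u" for u
      using H[of u] T0(1) that by (auto intro: within_distance_mono)
  qed (use T0 in auto)
  \<comment> \<open>Large enough for \<open>T'\<close>, found without control on its direction, to
    lie beyond \<open>s\<^sub>1\<close> and \<open>t\<^sub>1\<close>; this fixes the signs in
    \<open>key\<close>.\<close>
  define T where "T = T0 + \<bar>s\<^sub>2\<bar> + \<bar>t\<^sub>2\<bar> + \<bar>s\<^sub>1\<bar> + \<bar>t\<^sub>1\<bar> + 2 * \<bar>H\<bar> + C + dist (\<gamma>\<^sub>2 0) (\<gamma>\<^sub>1 0)"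
  have C0: "0 \<le> C" using within_distance_nonneg[OF near[OF order_refl]] .
  have T: "T0 \<le> T" "s\<^sub>2 \<le> T" "t\<^sub>2 \<le> T" "0 \<le> T" using T0(1) C0 zero_le_dist[of "\<gamma>\<^sub>2 0" "\<gamma>\<^sub>1 0"]
    unfolding T_def by linarith+
  obtain T' where T': "dist (\<gamma>\<^sub>2 T) (\<gamma>\<^sub>1 T') \<le> C" using near[OF T(1)] unfolding within_distance_def by blast
  obtain w where w: "0 \<le> w" "dist (\<gamma>\<^sub>2 T) (\<gamma>\<^sub>1 w) \<le> H" using H[OF T(4)] unfolding within_distance_def by auto
  have "dist (\<gamma>\<^sub>2 T) (\<gamma>\<^sub>2 0) = T" "dist (\<gamma>\<^sub>1 w) (\<gamma>\<^sub>1 0) = w"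
    using geodesic_onD[OF g(2), of T 0] geodesic_onD[OF g(1), of w 0] T(4) w(1) by auto
  then have "T - H - dist (\<gamma>\<^sub>2 0) (\<gamma>\<^sub>1 0) \<le> w"
    using w(2) dist_triangle[of "\<gamma>\<^sub>2 T" "\<gamma>\<^sub>2 0" "\<gamma>\<^sub>1 w"] dist_triangle[of "\<gamma>\<^sub>1 w" "\<gamma>\<^sub>2 0" "\<gamma>\<^sub>1 0"]
      dist_commute[of "\<gamma>\<^sub>2 0" "\<gamma>\<^sub>1 0"] by linarith
  moreover have "\<bar>T' - w\<bar> \<le> C + H"
    using geodesic_onD[OF g(1), of T' w] T' w(2) dist_triangle[of "\<gamma>\<^sub>1 T'" "\<gamma>\<^sub>1 w" "\<gamma>\<^sub>2 T"]
    by (simp add: dist_commute)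
  ultimately have T's: "s\<^sub>1 \<le> T'" "t\<^sub>1 \<le> T'" using T0(1) unfolding T_def by linarith+
  have key: "\<bar>(T - u\<^sub>2) - (T' - u\<^sub>1)\<bar> \<le> C + 2 * K"
    if u: "u\<^sub>1 \<le> T'" "u\<^sub>2 \<le> T" "dist z (\<gamma>\<^sub>1 u\<^sub>1) \<le> K" "dist z (\<gamma>\<^sub>2 u\<^sub>2) \<le> K" for u\<^sub>1 u\<^sub>2 z
  proof -
    have "dist (\<gamma>\<^sub>2 T) (\<gamma>\<^sub>2 u\<^sub>2) = T - u\<^sub>2" "dist (\<gamma>\<^sub>1 T') (\<gamma>\<^sub>1 u\<^sub>1) = T' - u\<^sub>1"
      using geodesic_onD[OF g(2), of T u\<^sub>2] geodesic_onD[OF g(1), of T' u\<^sub>1] u by auto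
    then show ?thesis
      using u(3,4) T' dist_triangle[of "\<gamma>\<^sub>2 T" "\<gamma>\<^sub>2 u\<^sub>2" "\<gamma>\<^sub>1 T'"] dist_triangle[of "\<gamma>\<^sub>1 T'" "\<gamma>\<^sub>2 u\<^sub>2" "\<gamma>\<^sub>1 u\<^sub>1"]
        dist_triangle[of "\<gamma>\<^sub>1 u\<^sub>1" "\<gamma>\<^sub>2 u\<^sub>2" z] dist_triangle[of "\<gamma>\<^sub>1 T'" "\<gamma>\<^sub>1 u\<^sub>1" "\<gamma>\<^sub>2 T"]
        dist_triangle[of "\<gamma>\<^sub>2 T" "\<gamma>\<^sub>1 u\<^sub>1" "\<gamma>\<^sub>2 u\<^sub>2"] dist_commute[of z "\<gamma>\<^sub>1 u\<^sub>1"]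
        dist_commute[of "\<gamma>\<^sub>2 u\<^sub>2" "\<gamma>\<^sub>1 u\<^sub>1"] dist_commute[of "\<gamma>\<^sub>1 T'" "\<gamma>\<^sub>2 T"]
      by linarith
  qed
  show ?thesis
    using key[OF T's(1) T(2) x] key[OF T's(2) T(3) y] unfolding C_def by linarith
qed

section \<open>Centers and cross-ratios\<close>

definition near_line :: "real \<Rightarrow> 'a::metric_space \<Rightarrow> 'a bpoint \<Rightarrow> 'a bpoint \<Rightarrow> bool" where
  "near_line T x a b \<longleftrightarrow> (\<exists>\<gamma>. line_between a b \<gamma> \<and> within_distance T x (range \<gamma>))"

text \<open>The sides of an ideal triangle are chosen independently, so being a center splits into
  one condition per side, and symmetry and monotonicity can be checked sidewise.\<close>

lemma centers_iff:
  "x \<in> centers K a b c \<longleftrightarrow> near_line K x a b \<and> near_line K x b c \<and> near_line K x c a"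
  unfolding centers_def ideal_triangle_def close_to_sides_def near_line_def by auto

lemma near_line_sym: "near_line T x a b \<Longrightarrow> near_line T x b a"
  unfolding near_line_def using line_between_sym range_reverse by metis

lemma near_line_mono: "near_line T x a b \<Longrightarrow> T \<le> U \<Longrightarrow> near_line U x a b"
  unfolding near_line_def using within_distance_mono by blast

lemma near_line_move: "near_line T x a b \<Longrightarrow> dist y x \<le> D \<Longrightarrow> near_line (T + D) y a b"
  unfolding near_line_def using within_distance_triangle by blast

lemma near_line_nonneg: "near_line T x a b \<Longrightarrow> 0 \<le> T"
  unfolding near_line_def using within_distance_nonneg by blast

lemma centers_mono: "x \<in> centers K a b c \<Longrightarrow> K \<le> L \<Longrightarrow> x \<in> centers L a b c"
  unfolding centers_iff using near_line_mono by blast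

lemma centers_move: "x \<in> centers K a b c \<Longrightarrow> dist y x \<le> D \<Longrightarrow> y \<in> centers (K + D) a b c"
  unfolding centers_iff using near_line_move by blast

lemma centers_perm: "centers K a b c = centers K b c a" "centers K a b c = centers K b a c"
  using near_line_sym by (auto simp: centers_iff set_eq_iff)

lemma morse_pair_iff:
  "[a, b] \<in> morse_tuples p 2 N \<longleftrightarrow> a \<noteq> b \<and> a \<in> morse_boundary p \<and> b \<in> morse_boundary p \<and>
    (\<forall>\<gamma>. line_between a b \<gamma> \<or> line_between b a \<gamma> \<longrightarrow> morse_geodesic N UNIV \<gamma>)"
  unfolding morse_tuples_def by auto

lemma morse_pair_sym: "[a, b] \<in> morse_tuples p 2 N \<Longrightarrow> [b, a] \<in> morse_tuples p 2 N"
  unfolding morse_pair_iff by blast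

lemma morse_triple_iff:
  "[a, b, c] \<in> morse_tuples p 3 N \<longleftrightarrow>
    [a, b] \<in> morse_tuples p 2 N \<and> [b, c] \<in> morse_tuples p 2 N \<and> [c, a] \<in> morse_tuples p 2 N"
  unfolding morse_tuples_def by auto

lemma morse_quadruple_iff:
  "[a, b, c, d] \<in> morse_tuples p 4 N \<longleftrightarrow>
    [a, b, c] \<in> morse_tuples p 3 N \<and> [a, d] \<in> morse_tuples p 2 N \<and> [b, d] \<in> morse_tuples p 2 N \<and>
    [c, d] \<in> morse_tuples p 2 N"
  unfolding morse_tuples_def by auto

lemma near_fixed_line:
  fixes p :: "'a::metric_space"
  assumes X: "proper_geodesic_space TYPE('a)" and ab: "[a, b] \<in> morse_tuples p 2 N"
    and x: "near_line K x a b" and l: "line_between a b \<alpha>"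
  shows "within_distance (K + N (9, 4)) x (range \<alpha>)"
proof -
  obtain \<gamma> t where \<gamma>: "line_between a b \<gamma>" "dist x (\<gamma> t) \<le> K"
    using x unfolding near_line_def within_distance_def by blast
  have "within_distance (N (9, 4)) (\<gamma> t) (range \<alpha>)"
    using line_near_morse_line[OF X _ _ l \<gamma>(1)] ab l morse_boundaryD(1) unfolding morse_pair_iff by blast
  from within_distance_triangle[OF this \<gamma>(2)] show ?thesis by (simp add: add.commute)
qed

text \<open>With \<open>L = K + N (9, 4)\<close>, the displacement along a side is at most half of
  \<open>3 * (2 * N (9, 4) + 4 * L)\<close>, and passing from \<open>x\<close> and \<open>y\<close>
  to that side adds \<open>2 * L\<close>.\<close>

definition center_bound :: "gauge \<Rightarrow> real \<Rightarrow> real" where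
  "center_bound N K = 8 * K + 11 * N (9, 4)"

text \<open>
  Let \<open>\<delta>\<^sub>1, \<delta>\<^sub>2, \<delta>\<^sub>3\<close> be the signed displacements from \<open>x\<close> to \<open>y\<close> along the cyclically oriented
  sides. The two sides at a vertex are asymptotic there with opposite orientations, so
  \<open>\<delta>\<^sub>1 \<approx> - \<delta>\<^sub>2 \<approx> \<delta>\<^sub>3 \<approx> - \<delta>\<^sub>1\<close> and all of them are bounded.
\<close>

lemma centers_close:
  fixes p :: "'a::metric_space"
  assumes X: "proper_geodesic_space TYPE('a)" and abc: "[a, b, c] \<in> morse_tuples p 3 N"
    and x: "x \<in> centers K a b c" and y: "y \<in> centers K a b c"
  shows "dist x y \<le> center_bound N K"
proof -
  note pairs = abc[unfolded morse_triple_iff]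
  have vb: "a \<in> visual_boundary p" "b \<in> visual_boundary p" "c \<in> visual_boundary p"
    using pairs morse_boundaryD(1) unfolding morse_pair_iff by blast+
  obtain \<alpha> \<beta> \<gamma> where l: "line_between a b \<alpha>" "line_between b c \<beta>" "line_between c a \<gamma>"
    using x unfolding centers_iff near_line_def by blast
  define L where "L = K + N (9, 4)"
  have near: "within_distance L z (range \<alpha>)" "within_distance L z (range \<beta>)" "within_distance L z (range \<gamma>)"
    if "z \<in> centers K a b c" for z
    using that near_fixed_line[OF X _ _ l(1)] near_fixed_line[OF X _ _ l(2)] near_fixed_line[OF X _ _ l(3)] pairs
    unfolding centers_iff L_def by blast+
  obtain s\<^sub>1 s\<^sub>2 s\<^sub>3 where s: "dist x (\<alpha> s\<^sub>1) \<le> L" "dist x (\<beta> s\<^sub>2) \<le> L" "dist x (\<gamma> s\<^sub>3) \<le> L"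
    using near[OF x] unfolding within_distance_def by blast
  obtain t\<^sub>1 t\<^sub>2 t\<^sub>3 where t: "dist y (\<alpha> t\<^sub>1) \<le> L" "dist y (\<beta> t\<^sub>2) \<le> L" "dist y (\<gamma> t\<^sub>3) \<le> L"
    using near[OF y] unfolding within_distance_def by blast
  have m: "morse_set N (range \<alpha>)" "morse_set N (range \<beta>)" "morse_set N (range \<gamma>)"
    using pairs l morse_geodesicD(2)[of N UNIV _ UNIV] unfolding morse_pair_iff by auto
  have shift: "\<bar>(v\<^sub>1 - u\<^sub>1) + (v\<^sub>2 - u\<^sub>2)\<bar> \<le> 2 * N (9, 4) + 4 * L"
    if "line_between i j \<mu>" "line_between j k \<nu>" "j \<in> visual_boundary p" "morse_set N (range \<mu>)"
      "dist x (\<mu> u\<^sub>1) \<le> L" "dist x (\<nu> u\<^sub>2) \<le> L" "dist y (\<mu> v\<^sub>1) \<le> L" "dist y (\<nu> v\<^sub>2) \<le> L"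
    for i j k \<mu> \<nu> u\<^sub>1 u\<^sub>2 v\<^sub>1 v\<^sub>2
  proof -
    note l' = line_between_sym[OF that(2)]
    have "finite_hausdorff (\<mu> ` {0..}) ((\<lambda>t. \<nu> (- t)) ` {0..})"
      using asymptotic_to_imp_finite_hausdorff[OF that(3)] that(1) l' unfolding line_between_def by blast
    from asymptotic_lines_shift[OF X line_betweenD[OF that(1)] line_betweenD[OF l'] that(4) this that(5) _ that(7),
        of "- u\<^sub>2" "- v\<^sub>2"] that(6,8)
    show ?thesis by (simp add: algebra_simps)
  qed
  have "\<bar>(t\<^sub>1 - s\<^sub>1) + (t\<^sub>2 - s\<^sub>2)\<bar> \<le> 2 * N (9, 4) + 4 * L"
    by (rule shift[OF l(1,2) vb(2) m(1) s(1,2) t(1,2)])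
  moreover have "\<bar>(t\<^sub>2 - s\<^sub>2) + (t\<^sub>3 - s\<^sub>3)\<bar> \<le> 2 * N (9, 4) + 4 * L"
    by (rule shift[OF l(2,3) vb(3) m(2) s(2,3) t(2,3)])
  moreover have "\<bar>(t\<^sub>3 - s\<^sub>3) + (t\<^sub>1 - s\<^sub>1)\<bar> \<le> 2 * N (9, 4) + 4 * L"
    by (rule shift[OF l(3,1) vb(1) m(3) s(3,1) t(3,1)])
  ultimately have "\<bar>2 * (t\<^sub>1 - s\<^sub>1)\<bar> \<le> 3 * (2 * N (9, 4) + 4 * L)" unfolding abs_le_iff by argo
  then have "2 * \<bar>t\<^sub>1 - s\<^sub>1\<bar> \<le> 3 * (2 * N (9, 4) + 4 * L)" by (simp only: abs_mult abs_numeral)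
  moreover have "dist (\<alpha> s\<^sub>1) (\<alpha> t\<^sub>1) = \<bar>t\<^sub>1 - s\<^sub>1\<bar>" using geodesic_onD[OF line_betweenD[OF l(1)], of s\<^sub>1 t\<^sub>1] by simp
  ultimately show ?thesis
    using s(1) t(1) dist_triangle[of x y "\<alpha> s\<^sub>1"] dist_triangle[of "\<alpha> s\<^sub>1" y "\<alpha> t\<^sub>1"] dist_commute[of y "\<alpha> t\<^sub>1"]
    unfolding center_bound_def L_def by argo
qed

lemma ex_center:
  fixes p :: "'a::metric_space"
  assumes X: "proper_geodesic_space TYPE('a)" and \<kappa>: "triangle_constant p N \<kappa>"
    and abc: "[a, b, c] \<in> morse_tuples p 3 N"
  shows "\<exists>x. x \<in> centers \<kappa> a b c"
proof -
  note pairs = abc[unfolded morse_triple_iff morse_pair_iff]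
  obtain \<alpha> \<beta> \<gamma> where l: "line_between a b \<alpha>" "line_between b c \<beta>" "line_between c a \<gamma>"
    using ex_line_between[OF X] pairs by metis
  have m: "morse_geodesic N UNIV \<alpha>" "morse_geodesic N UNIV \<beta>" "morse_geodesic N UNIV \<gamma>"
    using l pairs by blast+
  have "\<exists>q\<^sub>1\<in>range \<alpha>. \<exists>q\<^sub>2\<in>range \<beta>. \<exists>q\<^sub>3\<in>range \<gamma>. dist q\<^sub>1 q\<^sub>2 \<le> \<kappa> \<and> dist q\<^sub>2 q\<^sub>3 \<le> \<kappa> \<and> dist q\<^sub>3 q\<^sub>1 \<le> \<kappa>"
    using \<kappa>[unfolded triangle_constant_def, rule_format, of "Inr a" "Inr b" "Inr c" UNIV \<alpha> UNIV \<beta> UNIV \<gamma>] pairs l m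
    by auto
  then obtain q\<^sub>1 q\<^sub>2 q\<^sub>3 where q: "q\<^sub>1 \<in> range \<alpha>" "q\<^sub>2 \<in> range \<beta>" "q\<^sub>3 \<in> range \<gamma>"
    "dist q\<^sub>1 q\<^sub>2 \<le> \<kappa>" "dist q\<^sub>3 q\<^sub>1 \<le> \<kappa>" by blast
  have "0 \<le> \<kappa>" using q(4) zero_le_dist order_trans by blast
  then have "within_distance \<kappa> q\<^sub>1 (range \<alpha>)" "within_distance \<kappa> q\<^sub>1 (range \<beta>)" "within_distance \<kappa> q\<^sub>1 (range \<gamma>)"
    using q(1-3,4,5) dist_commute[of q\<^sub>1 q\<^sub>3] within_distance_self unfolding within_distance_def by metis+
  then show ?thesis using l unfolding centers_iff near_line_def by blast
qed

section \<open>Visible points and separated directions\<close>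

definition visible :: "'a::metric_space \<Rightarrow> gauge \<Rightarrow> real \<Rightarrow> 'a \<Rightarrow> 'a bpoint \<Rightarrow> bool" where
  "visible p N D x b \<longleftrightarrow> b \<in> morse_boundary p \<and> sees N D x b"

lemma visible_if_near_line:
  assumes "[a, b] \<in> morse_tuples p 2 N" "near_line D x a b"
  shows "visible p N D x a" "visible p N D x b"
proof -
  obtain \<gamma> where "line_between a b \<gamma>" "within_distance D x (range \<gamma>)" using assms(2) unfolding near_line_def by blast
  then show "visible p N D x a" "visible p N D x b"
    using sees_ends_of_near_line assms(1) unfolding visible_def morse_pair_iff by blast+
qed

lemma visible_if_center:
  assumes "[a, b, c] \<in> morse_tuples p 3 N" "x \<in> centers D a b c"
  shows "visible p N D x a" "visible p N D x b" "visible p N D x c"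
  using assms visible_if_near_line unfolding morse_triple_iff centers_iff by blast+

text \<open>This gives points taken from different triples a common gauge, to which 2-stability and
  the triangle constants apply.\<close>

lemma morse_pair_if_visible:
  fixes p :: "'a::metric_space"
  assumes X: "proper_geodesic_space TYPE('a)" and "visible p N D x a" "visible p N D x b" "a \<noteq> b"
  shows "[a, b] \<in> morse_tuples p 2 (line_gauge D N)"
  using assms morse_line_if_sees[OF X, of a p b N D x] morse_line_if_sees[OF X, of b p a N D x] morse_boundaryD(1)
  unfolding visible_def morse_pair_iff by blast

text \<open>Seen from \<open>x\<close>, the points \<open>a\<close> and \<open>b\<close> lie in directions that are distinct at scale \<open>T\<close>.\<close>

definition separated :: "real \<Rightarrow> 'a::metric_space \<Rightarrow> 'a bpoint \<Rightarrow> 'a bpoint \<Rightarrow> bool" where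
  "separated T x a b \<longleftrightarrow> a \<noteq> b \<and> near_line T x a b"

lemma separated_sym: "separated T x a b \<Longrightarrow> separated T x b a"
  unfolding separated_def using near_line_sym by blast

lemma separated_mono: "separated T x a b \<Longrightarrow> T \<le> U \<Longrightarrow> separated U x a b"
  unfolding separated_def using near_line_mono by blast

text \<open>A coarse form of the inequality for Gromov products: by slimness, a point near the side
  from \<open>a\<close> to \<open>b\<close> is near one of the other two sides, so \<open>c\<close>
  cannot lie in the direction of both \<open>a\<close> and \<open>b\<close>.\<close>

lemma separated_split:
  fixes p :: "'a::metric_space"
  assumes X: "proper_geodesic_space TYPE('a)" and \<kappa>: "triangle_constant p (line_gauge D N) \<kappa>"
    and v: "visible p N D x a" "visible p N D x b" "visible p N D x c" and ab: "separated T x a b"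
    and S: "slim_constant (line_gauge D N) \<kappa> \<le> S" "0 \<le> S"
  shows "separated (T + S) x a c \<or> separated (T + S) x b c"
proof -
  consider "c = a" | "c = b" | "c \<noteq> a" "c \<noteq> b" by blast
  then show ?thesis
  proof cases
    case 1
    then show ?thesis using ab separated_sym separated_mono[of T x a b "T + S"] S(2) by auto
  next
    case 2
    then show ?thesis using ab separated_mono[of T x a b "T + S"] S(2) by auto
  next
    case 3
    have mb: "a \<in> morse_boundary p" "b \<in> morse_boundary p" "c \<in> morse_boundary p"
      using v unfolding visible_def by auto
    obtain \<alpha> t where \<alpha>: "line_between a b \<alpha>" "dist x (\<alpha> t) \<le> T" "a \<noteq> b"
      using ab unfolding separated_def near_line_def within_distance_def by blast
    obtain \<beta> \<gamma> where l: "line_between b c \<beta>" "line_between c a \<gamma>"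
      using ex_line_between[OF X] mb 3 by metis
    note pairs = morse_pair_if_visible[OF X v(1,2) \<alpha>(3)] morse_pair_if_visible[OF X v(2,3)]
      morse_pair_if_visible[OF X v(3,1)]
    have "within_distance (slim_constant (line_gauge D N) \<kappa>) (\<alpha> t) (range \<beta> \<union> range \<gamma>)"
      by (rule ideal_triangle_slim[OF X \<kappa> mb \<alpha>(1) l]) (use pairs \<alpha>(1) l 3 in \<open>auto simp: morse_pair_iff\<close>)
    from within_distance_triangle[OF this \<alpha>(2)]
    have "within_distance (T + S) x (range \<beta> \<union> range \<gamma>)" by (rule within_distance_mono) (use S in auto)
    then have "within_distance (T + S) x (range \<beta>) \<or> within_distance (T + S) x (range \<gamma>)"
      unfolding within_distance_def by blast
    then show ?thesis using l 3 near_line_sym unfolding separated_def near_line_def by metis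
  qed
qed

lemma diameter_le_two_radius:
  assumes "S \<subseteq> cball x C" "0 \<le> C"
  shows "diameter S \<le> 2 * C" "bounded S" "0 \<le> diameter S"
proof -
  show b: "bounded S" using assms(1) bounded_subset bounded_cball by blast
  show "0 \<le> diameter S" by (rule diameter_ge_0[OF b])
  have "dist y z \<le> 2 * C" if "y \<in> S" "z \<in> S" for y z
  proof -
    have "dist x y \<le> C" "dist x z \<le> C" using that assms(1) by auto
    then show ?thesis using dist_triangle[of y z x] by (simp add: dist_commute)
  qed
  then show "diameter S \<le> 2 * C" using assms(2) unfolding diameter_def by (auto intro!: cSUP_least)
qed

section \<open>Images of centers under a quasi-moebius map\<close>

locale quasi_moebius_map =
  fixes \<kappa> :: "gauge \<Rightarrow> real" and p :: "'a::metric_space" and r :: "'b::metric_space"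
    and h :: "'a bpoint \<Rightarrow> 'b bpoint"
  assumes X: "proper_geodesic_space TYPE('a)" and Y: "proper_geodesic_space TYPE('b)"
    and \<kappa>: "\<And>M. morse_gauge M \<Longrightarrow> triangle_constant p M (\<kappa> M) \<and> triangle_constant r M (\<kappa> M)"
    and stable: "two_stable p r h" and moebius: "quasi_moebius \<kappa> p r h"
begin

lemma image_triple:
  assumes "map h ` morse_tuples p 2 M \<subseteq> morse_tuples r 2 M'"
  shows "[a, b] \<in> morse_tuples p 2 M \<Longrightarrow> [h a, h b] \<in> morse_tuples r 2 M'"
    "[a, b, c] \<in> morse_tuples p 3 M \<Longrightarrow> [h a, h b, h c] \<in> morse_tuples r 3 M'"
proof -
  have *: "[h a, h b] \<in> morse_tuples r 2 M'" if "[a, b] \<in> morse_tuples p 2 M" for a b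
    using imageI[OF that, of "map h"] assms by auto
  then show "[a, b] \<in> morse_tuples p 2 M \<Longrightarrow> [h a, h b] \<in> morse_tuples r 2 M'"
    "[a, b, c] \<in> morse_tuples p 3 M \<Longrightarrow> [h a, h b, h c] \<in> morse_tuples r 3 M'"
    by (simp_all add: morse_triple_iff)
qed

text \<open>The centers of \<open>(u, w, v)\<close> and \<open>(u, w', v)\<close> all lie near
  \<open>x\<close>, so the cross-ratio of \<open>u, w, v, w'\<close> is bounded, and by monotonicity
  of \<open>\<psi>\<close> so is that of the images. \<open>centers_close\<close> mediates between
  the radii \<open>T\<close>, \<open>K\<close> and those built into the cross-ratio.\<close>

lemma image_centers_exchange:
  assumes M: "morse_gauge M" and M': "morse_gauge M'" "map h ` morse_tuples p 2 M \<subseteq> morse_tuples r 2 M'"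
  shows "\<exists>E. \<forall>x u v w w' y y'. [u, v, w] \<in> morse_tuples p 3 M \<and> [u, v, w'] \<in> morse_tuples p 3 M \<and>
    (w \<noteq> w' \<longrightarrow> [w, w'] \<in> morse_tuples p 2 M) \<and> x \<in> centers T u v w \<and> x \<in> centers T u v w' \<and>
    y \<in> centers K (h u) (h v) (h w) \<and> y' \<in> centers K (h u) (h v) (h w') \<longrightarrow> dist y y' \<le> E"
proof -
  obtain \<psi> where \<psi>: "mono_on {0..} \<psi>" "\<psi> ` {0..} \<subseteq> {0..}"
    "\<And>a b c d. [a, b, c, d] \<in> morse_tuples p 4 M \<Longrightarrow>
      cross_ratio \<kappa> M' (h a) (h b) (h c) (h d) \<le> \<psi> (cross_ratio \<kappa> M a b c d)"
    using moebius M M' unfolding quasi_moebius_def by metis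
  define C\<^sub>1 where "C\<^sub>1 = center_bound M (max T (\<kappa> M))"
  define C\<^sub>2 where "C\<^sub>2 = center_bound M' (max K (\<kappa> M'))"
  have C1: "dist x y \<le> C\<^sub>1"
    if "[a, b, c] \<in> morse_tuples p 3 M" "x \<in> centers T a b c" "y \<in> centers (\<kappa> M) a b c" for x y a b c
    unfolding C\<^sub>1_def
    by (rule centers_close[OF X that(1) centers_mono[OF that(2)] centers_mono[OF that(3)]]) auto
  have C2: "dist x y \<le> C\<^sub>2"
    if "[a, b, c] \<in> morse_tuples r 3 M'" "x \<in> centers K a b c \<or> x \<in> centers (\<kappa> M') a b c"
      "y \<in> centers K a b c \<or> y \<in> centers (\<kappa> M') a b c" for x y a b c
  proof -
    have "z \<in> centers (max K (\<kappa> M')) a b c" if "z \<in> centers K a b c \<or> z \<in> centers (\<kappa> M') a b c" for z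
      using that by (auto elim: centers_mono)
    then have "x \<in> centers (max K (\<kappa> M')) a b c" "y \<in> centers (max K (\<kappa> M')) a b c"
      using that(2,3) by blast+
    then show ?thesis unfolding C\<^sub>2_def by (rule centers_close[OF Y that(1)])
  qed
  \<comment> \<open>\<open>C\<^sub>2\<close> is paid at both ends for passing to radius
    \<open>\<kappa> M'\<close>; the last term bounds the cross-ratio of the images.\<close>
  define E where "E = 2 * C\<^sub>2 + \<psi> (2 * C\<^sub>1)"
  have "dist y y' \<le> E"
    if H: "[u, v, w] \<in> morse_tuples p 3 M" "[u, v, w'] \<in> morse_tuples p 3 M"
      "w \<noteq> w' \<Longrightarrow> [w, w'] \<in> morse_tuples p 2 M" "x \<in> centers T u v w" "x \<in> centers T u v w'"
      "y \<in> centers K (h u) (h v) (h w)" "y' \<in> centers K (h u) (h v) (h w')" for x u v w w' y y'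
  proof -
    \<comment> \<open>The cross-ratio exchanges its second and fourth entries, so the point to be
      exchanged goes to the middle.\<close>
    have H1: "[u, w, v] \<in> morse_tuples p 3 M" "[u, w', v] \<in> morse_tuples p 3 M"
      using H(1,2) morse_pair_sym unfolding morse_triple_iff by blast+
    have perm: "centers L a b c = centers L a c b" for L and a b c :: "'c::metric_space bpoint"
      using centers_perm by metis
    obtain z where z: "z \<in> centers (\<kappa> M) u w v" using ex_center[OF X _ H1(1)] \<kappa>[OF M] by blast
    have C1_0: "0 \<le> C\<^sub>1" using C1[OF H1(1) _ z, of x] H(4) perm zero_le_dist order_trans by metis
    have C2_0: "0 \<le> C\<^sub>2" using C2[OF image_triple(2)[OF M'(2) H(1)], of y y] H(6) by simp
    have \<psi>0: "0 \<le> \<psi> (2 * C\<^sub>1)" using \<psi>(2) C1_0 by (simp add: image_subset_iff)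
    note I1 = image_triple(2)[OF M'(2) H1(1)] note I2 = image_triple(2)[OF M'(2) H1(2)]
    have y1: "y \<in> centers K (h u) (h w) (h v)" "y' \<in> centers K (h u) (h w') (h v)"
      using H(6,7) perm by metis+
    show ?thesis
    proof (cases "w = w'")
      case True
      then have "dist y y' \<le> C\<^sub>2" using C2[OF I1] y1 by blast
      then show ?thesis using C2_0 \<psi>0 unfolding E_def by simp
    next
      case False
      have q: "[u, w, v, w'] \<in> morse_tuples p 4 M"
        using H1 H(2) H(3)[OF False] morse_pair_sym unfolding morse_quadruple_iff morse_triple_iff by blast
      have "centers (\<kappa> M) u w v \<union> centers (\<kappa> M) u w' v \<subseteq> cball x C\<^sub>1"
        using C1[OF H1(1)] C1[OF H1(2)] H(4,5) perm[of T u v] by auto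
      note d = diameter_le_two_radius[OF this C1_0]
      have "cross_ratio \<kappa> M u w v w' \<le> 2 * C\<^sub>1" "0 \<le> cross_ratio \<kappa> M u w v w'"
        using d unfolding cross_ratio_def by auto
      then have "\<psi> (cross_ratio \<kappa> M u w v w') \<le> \<psi> (2 * C\<^sub>1)" using \<psi>(1) by (auto simp: mono_on_def)
      with \<psi>(3)[OF q] have cr: "cross_ratio \<kappa> M' (h u) (h w) (h v) (h w') \<le> \<psi> (2 * C\<^sub>1)" by linarith
      obtain z where z: "z \<in> centers (\<kappa> M') (h u) (h w) (h v)" using ex_center[OF Y _ I1] \<kappa>[OF M'(1)] by blast
      obtain z' where z': "z' \<in> centers (\<kappa> M') (h u) (h w') (h v)" using ex_center[OF Y _ I2] \<kappa>[OF M'(1)] by blast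
      let ?S = "centers (\<kappa> M') (h u) (h w) (h v) \<union> centers (\<kappa> M') (h u) (h w') (h v)"
      have "centers (\<kappa> M') (h u) (h w) (h v) \<subseteq> cball z C\<^sub>2" "centers (\<kappa> M') (h u) (h w') (h v) \<subseteq> cball z' C\<^sub>2"
        using C2[OF I1] C2[OF I2] z z' by auto
      \<comment> \<open>A bound on \<open>diameter\<close> bounds distances only once the set is
        known to be bounded.\<close>
      then have "bounded ?S" using bounded_subset bounded_cball by (metis bounded_Un)
      then have "dist z z' \<le> \<psi> (2 * C\<^sub>1)"
        using diameter_bounded_bound[of ?S z z'] z z' cr unfolding cross_ratio_def by auto
      moreover have "dist y z \<le> C\<^sub>2" "dist z' y' \<le> C\<^sub>2" using C2[OF I1] C2[OF I2] y1 z z' by auto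
      ultimately show ?thesis
        using dist_triangle[of y y' z] dist_triangle[of z y' z'] unfolding E_def by linarith
    qed
  qed
  then show ?thesis by blast
qed

text \<open>
  Seen from a common center of \<open>(a, b, c)\<close> and \<open>(a', b', c')\<close>, a direction is close to at most one
  of three separated directions. Hence the points of the first triple can be replaced one at a
  time by those of the second, keeping \<open>x\<close> a center; each replacement is controlled by a
  cross-ratio.
\<close>

lemma image_centers_close:
  "\<exists>E. \<forall>x x' a b c a' b' c' y y'. [a, b, c] \<in> morse_tuples p 3 N \<longrightarrow> x \<in> centers K a b c \<longrightarrow>
    y \<in> centers L (h a) (h b) (h c) \<longrightarrow> [a', b', c'] \<in> morse_tuples p 3 N \<longrightarrow> x' \<in> centers K a' b' c' \<longrightarrow>
    y' \<in> centers L (h a') (h b') (h c') \<longrightarrow> dist x x' \<le> D \<longrightarrow> dist y y' \<le> E"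
proof -
  define K' where "K' = K + D"
  define M where "M = line_gauge K' N"
  have M: "morse_gauge M" by (simp add: M_def)
  obtain M' where M': "morse_gauge M'" "map h ` morse_tuples p 2 M \<subseteq> morse_tuples r 2 M'"
    using stable M unfolding two_stable_def by blast
  define S where "S = max 0 (slim_constant M (\<kappa> M))"
  \<comment> \<open>One \<open>S\<close> for bringing in \<open>a'\<close> and one for
    \<open>b'\<close>; bringing in \<open>c'\<close> adds none, as the second triple is already
    separated at scale \<open>K'\<close>.\<close>
  define T where "T = K' + S + S"
  define L' where "L' = max L (\<kappa> M')"
  obtain E where E: "\<And>x u v w w' y y'. [u, v, w] \<in> morse_tuples p 3 M \<Longrightarrow> [u, v, w'] \<in> morse_tuples p 3 M \<Longrightarrow>
    (w \<noteq> w' \<Longrightarrow> [w, w'] \<in> morse_tuples p 2 M) \<Longrightarrow> x \<in> centers T u v w \<Longrightarrow> x \<in> centers T u v w' \<Longrightarrow>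
    y \<in> centers L' (h u) (h v) (h w) \<Longrightarrow> y' \<in> centers L' (h u) (h v) (h w') \<Longrightarrow> dist y y' \<le> E"
    using image_centers_exchange[OF M M', of T L'] by blast
  have "dist y y' \<le> 3 * E"
    if H: "[a, b, c] \<in> morse_tuples p 3 N" "[a', b', c'] \<in> morse_tuples p 3 N"
      "x \<in> centers K a b c" "x' \<in> centers K a' b' c'" "dist x x' \<le> D"
      "y \<in> centers L (h a) (h b) (h c)" "y' \<in> centers L (h a') (h b') (h c')" for x x' a b c a' b' c' y y'
  proof -
    have D: "0 \<le> D" using H(5) zero_le_dist order_trans by blast
    have x1: "x \<in> centers K' a b c" unfolding K'_def by (rule centers_mono[OF H(3)]) (use D in simp)
    have x2: "x \<in> centers K' a' b' c'" unfolding K'_def by (rule centers_move[OF H(4,5)])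
    define V where "V = {b. visible p N K' x b}"
    have V: "a \<in> V" "b \<in> V" "c \<in> V" "a' \<in> V" "b' \<in> V" "c' \<in> V"
      using visible_if_center[OF H(1) x1] visible_if_center[OF H(2) x2] by (auto simp: V_def)
    have pair: "[u, v] \<in> morse_tuples p 2 M" if "u \<in> V" "v \<in> V" "u \<noteq> v" for u v
      using that morse_pair_if_visible[OF X] unfolding V_def M_def by blast
    have split: "separated (U + S) x u w \<or> separated (U + S) x v w"
      if "u \<in> V" "v \<in> V" "w \<in> V" "separated U x u v" for U u v w
      by (rule separated_split[OF X, of p K' N "\<kappa> M"])
        (use that \<kappa>[OF M] in \<open>auto simp: V_def M_def S_def\<close>)
    define tri where "tri U u v w \<longleftrightarrow> u \<in> V \<and> v \<in> V \<and> w \<in> V \<and>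
      separated U x u v \<and> separated U x v w \<and> separated U x w u" for U u v w
    have tri_center: "[u, v, w] \<in> morse_tuples p 3 M \<and> x \<in> centers T u v w" if "tri U u v w" "U \<le> T" for U u v w
      using that pair near_line_mono unfolding tri_def separated_def morse_triple_iff centers_iff by blast
    have tri_mono: "tri U' u v w" if "tri U u v w" "U \<le> U'" for U U' u v w
      using that separated_mono unfolding tri_def by blast
    have tri_perm: "tri U u v w \<longleftrightarrow> tri U v w u" "tri U u v w \<longleftrightarrow> tri U v u w" for U u v w
      using separated_sym unfolding tri_def by blast+
    define Z where "Z u v w = centers L' (h u) (h v) (h w)" for u v w
    have Z_perm: "Z u v w = Z v w u" "Z u v w = Z v u w" for u v w unfolding Z_def by (rule centers_perm)+
    have Z_ne: "\<exists>z. z \<in> Z u v w" if "tri U u v w" "U \<le> T" for U u v w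
    proof -
      have "[h u, h v, h w] \<in> morse_tuples r 3 M'" using image_triple(2)[OF M'(2)] tri_center[OF that] by blast
      then obtain z where "z \<in> centers (\<kappa> M') (h u) (h v) (h w)" using ex_center[OF Y] \<kappa>[OF M'(1)] by blast
      then show ?thesis unfolding Z_def L'_def using centers_mono by (metis max.cobounded2)
    qed
    have step: "dist z z' \<le> E" if "tri T u v w" "tri T u v w'" "z \<in> Z u v w" "z' \<in> Z u v w'" for u v w w' z z'
    proof (rule E)
      show "w \<noteq> w' \<Longrightarrow> [w, w'] \<in> morse_tuples p 2 M" using that pair unfolding tri_def by blast
    qed (use that tri_center[OF that(1)] tri_center[OF that(2)] in \<open>auto simp: Z_def\<close>)
    have S0: "0 \<le> S" by (simp add: S_def)
    have T: "K' \<le> T" "K' + S \<le> T" using S0 by (auto simp: T_def)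
    have t1: "tri K' a b c" and t2: "tri K' a' b' c'"
      using V x1 x2 H(1,2) unfolding tri_def separated_def centers_iff morse_triple_iff morse_pair_iff by auto
    have y: "y \<in> Z a b c" and y': "y' \<in> Z a' b' c'"
      using H(6,7) centers_mono unfolding Z_def L'_def by (metis max.cobounded1)+
    have "\<exists>v w z. tri (K' + S) a' v w \<and> z \<in> Z a' v w \<and> dist y z \<le> E"
    proof -
      have "tri (K' + S) a' b c \<or> tri (K' + S) a' c a \<or> tri (K' + S) a' a b"
        using t1 V split[of a b a' K'] split[of b c a' K'] split[of c a a' K'] separated_mono[of K' x _ _ "K' + S"]
          separated_sym S0 unfolding tri_def by (metis le_add_same_cancel1)
      moreover have "\<exists>z. z \<in> Z a' v w \<and> dist y z \<le> E"
        if t: "tri (K' + S) a' v w" "tri K' v w u" "y \<in> Z v w u" for u v w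
      proof -
        obtain z where z: "z \<in> Z a' v w" using Z_ne[OF t(1) T(2)] by blast
        have "tri T v w u" using tri_mono[OF t(2) T(1)] .
        moreover have "tri T v w a'" using tri_mono[OF t(1) T(2)] tri_perm(1)[of T a' v w] by blast
        moreover have "z \<in> Z v w a'" using z Z_perm(1)[of a' v w] by simp
        ultimately show ?thesis using step t(3) z by blast
      qed
      ultimately show ?thesis using t1 y tri_perm(1) Z_perm(1) by metis
    qed
    then obtain v w z where z: "tri (K' + S) a' v w" "z \<in> Z a' v w" "dist y z \<le> E" by blast
    have "\<exists>w z'. tri T a' b' w \<and> z' \<in> Z a' b' w \<and> dist z z' \<le> E"
    proof -
      have ab: "separated T x a' b'" using t2 T(1) separated_mono unfolding tri_def by blast
      \<comment> \<open>\<open>a'\<close> and \<open>b'\<close> are separated anyway, so it remains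
        to keep whichever of \<open>v\<close>, \<open>w\<close> is separated from
        \<open>b'\<close>.\<close>
      have "separated T x v b' \<or> separated T x w b'"
        using split[of v w b' "K' + S"] z(1) V unfolding tri_def T_def by blast
      moreover have tT: "tri T a' v w" using tri_mono[OF z(1) T(2)] .
      ultimately have "tri T a' v b' \<or> tri T a' w b'"
        using ab separated_sym V unfolding tri_def by blast
      moreover have "\<exists>z'. z' \<in> Z a' b' u \<and> dist z z' \<le> E"
        if t: "tri T a' u b'" "tri T a' u w'" "z \<in> Z a' u w'" for u w'
      proof -
        obtain z' where z': "z' \<in> Z a' u b'" using Z_ne[OF t(1)] by blast
        moreover have "Z a' u b' = Z a' b' u" using Z_perm by metis
        ultimately show ?thesis using step[OF t(2,1,3) z'] by blast
      qed
      moreover have "tri T a' w v" "z \<in> Z a' w v" using tT z(2) tri_perm Z_perm by metis+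
      ultimately show ?thesis using tT z(2) tri_perm by metis
    qed
    then obtain w z' where z': "tri T a' b' w" "z' \<in> Z a' b' w" "dist z z' \<le> E" by blast
    have "dist z' y' \<le> E" using step[OF z'(1) tri_mono[OF t2 T(1)] z'(2) y'] .
    then show ?thesis
      using z(3) z'(3) dist_triangle[of y y' z] dist_triangle[of z y' z'] by linarith
  qed
  then show ?thesis by blast
qed

end

section \<open>The center map\<close>

definition sup_gauge :: "gauge \<Rightarrow> gauge \<Rightarrow> gauge" where
  "sup_gauge N M = proper_gauge (\<lambda>z. max (N z) (M z))"

lemma morse_gauge_sup_gauge [simp]: "morse_gauge (sup_gauge N M)"
  by (simp add: sup_gauge_def)

lemma morse_geodesic_sup_gauge:
  assumes "morse_geodesic N I \<gamma>"
  shows "morse_geodesic (sup_gauge N M) I \<gamma>" "morse_geodesic (sup_gauge M N) I \<gamma>"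
  by (rule morse_geodesic_mono[OF assms]; simp add: sup_gauge_def proper_gauge_def)+

lemma morse_pair_sup_gauge:
  assumes "[a, b] \<in> morse_tuples p 2 N"
  shows "[a, b] \<in> morse_tuples p 2 (sup_gauge N M)" "[a, b] \<in> morse_tuples p 2 (sup_gauge M N)"
  using assms morse_geodesic_sup_gauge unfolding morse_pair_iff by blast+

lemma morse_triple_sup_gauge:
  assumes "[a, b, c] \<in> morse_tuples p 3 N"
  shows "[a, b, c] \<in> morse_tuples p 3 (sup_gauge N M)" "[a, b, c] \<in> morse_tuples p 3 (sup_gauge M N)"
  using assms morse_pair_sup_gauge unfolding morse_triple_iff by blast+

text \<open>Representatives of \<open>a\<close> and \<open>b\<close> start at \<open>p\<close>, so
  both points are visible from \<open>p\<close> with \<open>D = 0\<close>.\<close>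

lemma ex_morse_pair:
  fixes p :: "'a::metric_space"
  assumes X: "proper_geodesic_space TYPE('a)"
    and ab: "a \<in> morse_boundary p" "b \<in> morse_boundary p" "a \<noteq> b"
  shows "\<exists>N. [a, b] \<in> morse_tuples p 2 N"
proof -
  obtain N\<^sub>1 \<alpha> where \<alpha>: "\<alpha> \<in> a" "morse_geodesic N\<^sub>1 {0..} \<alpha>" using morse_boundaryD(2)[OF ab(1)] by blast
  obtain N\<^sub>2 \<beta> where \<beta>: "\<beta> \<in> b" "morse_geodesic N\<^sub>2 {0..} \<beta>" using morse_boundaryD(2)[OF ab(2)] by blast
  have vis: "visible p M 0 p c" if c: "c \<in> morse_boundary p" "\<rho> \<in> c" "morse_geodesic M {0..} \<rho>" for M c \<rho>
  proof -
    note cv = morse_boundaryD(1)[OF c(1)]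
    have "finite_hausdorff (\<rho> ` {0..}) (\<rho> ` {0..})" using bpoint_mem_iff[OF cv c(2), of \<rho>] c(2) by blast
    moreover have "\<rho> 0 = p" using bpoint_ray[OF cv c(2)] unfolding geodesic_ray_def by blast
    ultimately show ?thesis using c unfolding visible_def sees_def asymptotic_to_def by force
  qed
  have "visible p (sup_gauge N\<^sub>1 N\<^sub>2) 0 p a" "visible p (sup_gauge N\<^sub>1 N\<^sub>2) 0 p b"
    using vis ab(1,2) \<alpha> \<beta> morse_geodesic_sup_gauge by blast+
  then show ?thesis using morse_pair_if_visible[OF X _ _ ab(3)] by blast
qed

section \<open>Coarsely Lipschitz maps and quasi-rays near a line\<close>

lemma coarse_lipschitz_if_unit_bound:
  fixes f :: "'a::metric_space \<Rightarrow> 'b::metric_space"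
  assumes X: "proper_geodesic_space TYPE('a)" and E: "0 \<le> E"
    and unit: "\<And>x y. dist x y \<le> 1 \<Longrightarrow> dist (f x) (f y) \<le> E"
  shows "dist (f x) (f y) \<le> E * dist x y + E"
proof -
  have steps: "dist x y \<le> real n \<Longrightarrow> dist (f x) (f y) \<le> E * n" for n y
  proof (induction n arbitrary: y)
    case (Suc n)
    obtain \<eta> where \<eta>: "\<forall>u\<in>{0..dist x y}. \<forall>v\<in>{0..dist x y}. dist (\<eta> u) (\<eta> v) = \<bar>u - v\<bar>"
      "\<eta> 0 = x" "\<eta> (dist x y) = y" using ex_geodesic[OF X, of x y] by blast
    define s where "s = min (real n) (dist x y)"
    have s: "s \<in> {0..dist x y}" by (simp add: s_def)
    have "dist x (\<eta> s) = s" using \<eta>(1)[rule_format, of 0 s] \<eta>(2) s by simp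
    then have "dist (f x) (f (\<eta> s)) \<le> E * n" using Suc.IH[of "\<eta> s"] by (simp add: s_def)
    moreover have "dist (\<eta> s) y = dist x y - s" using \<eta>(1)[rule_format, of s "dist x y"] \<eta>(3) s by simp
    then have "dist (f (\<eta> s)) (f y) \<le> E" using unit[of "\<eta> s" y] Suc.prems by (simp add: s_def min_def)
    ultimately show ?case using dist_triangle[of "f x" "f y" "f (\<eta> s)"] by (simp add: algebra_simps)
  qed simp
  define n where "n = nat \<lceil>dist x y\<rceil>"
  have "real n = of_int \<lceil>dist x y\<rceil>" by (simp add: n_def)
  then have "dist x y \<le> n" "n \<le> dist x y + 1" by linarith+
  then have "dist (f x) (f y) \<le> E * n" "E * n \<le> E * (dist x y + 1)"
    using steps E by (auto intro: mult_left_mono)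
  then show ?thesis by (simp add: algebra_simps)
qed

lemma quasi_isometry_if_coarse_inverse:
  fixes f :: "'a::metric_space \<Rightarrow> 'b::metric_space" and g :: "'b \<Rightarrow> 'a"
  assumes E: "0 \<le> E" "0 \<le> E'" and f: "\<And>x y. dist (f x) (f y) \<le> E * dist x y + E"
    and g: "\<And>x y. dist (g x) (g y) \<le> E' * dist x y + E'"
    and gf: "\<And>x. dist (g (f x)) x \<le> D" and fg: "\<And>y. dist (f (g y)) y \<le> D'"
  shows "quasi_isometry f"
proof -
  define l where "l = 1 + E + E'"
  have D: "0 \<le> D" using gf zero_le_dist order_trans by blast
  have "quasi_isometric_embedding l (l + 2 * D) UNIV f"
    unfolding quasi_isometric_embedding_def
  proof (intro conjI ballI)
    show "1 \<le> l" "0 \<le> l + 2 * D" using E D by (auto simp: l_def)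
    fix x y
    have "E * dist x y \<le> l * dist x y" "E' * dist (f x) (f y) \<le> l * dist (f x) (f y)"
      using E by (auto simp: l_def intro: mult_right_mono)
    then have up: "dist (f x) (f y) \<le> l * dist x y + l"
      and "dist (g (f x)) (g (f y)) \<le> l * dist (f x) (f y) + l"
      using f[of x y] g[of "f x" "f y"] E unfolding l_def by linarith+
    then have "dist x y \<le> l * dist (f x) (f y) + l + 2 * D"
      using gf[of x] gf[of y] dist_triangle[of x y "g (f x)"] dist_triangle[of "g (f x)" y "g (f y)"]
      by (simp add: dist_commute)
    then have "1 / l * dist x y \<le> 1 / l * (l * dist (f x) (f y) + l + 2 * D)"
      using E by (intro mult_left_mono) (auto simp: l_def)
    also have "\<dots> = dist (f x) (f y) + 1 + 2 * D / l" using E by (simp add: l_def field_simps)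
    also have "2 * D / l \<le> 2 * D" using D E by (simp add: l_def divide_le_eq mult_left_le algebra_simps)
    finally show "1 / l * dist x y - (l + 2 * D) \<le> dist (f x) (f y)" using E by (simp add: l_def)
    show "dist (f x) (f y) \<le> l * dist x y + (l + 2 * D)" using up D by simp
  qed
  moreover have "\<forall>x. dist (g (f x)) x \<le> max D D'" "\<forall>y. dist (f (g y)) y \<le> max D D'"
    using gf fg by (simp_all add: le_max_iff_disj)
  ultimately show ?thesis unfolding quasi_isometry_def using D by (meson le_max_iff_disj)
qed

lemma finite_hausdorff_if_eventually_near_ray:
  fixes T :: real
  assumes \<alpha>: "geodesic_on {0..} \<alpha>" and g: "qie l e {0..} g" and T: "0 \<le> T"
    and close: "\<And>t. T \<le> t \<Longrightarrow> within_distance E (g t) (\<alpha> ` {0::real..})"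
  shows "finite_hausdorff (g ` {0..}) (\<alpha> ` {0..})"
proof -
  have l: "1 \<le> l" "0 \<le> e" using qieD[OF g] by auto
  have q: "qie l e {0..} (\<lambda>t. g (T + t))"
    by (rule qie_isometry_compose[OF g]) (use T in \<open>auto simp: dist_real_def\<close>)
  have "finite_hausdorff ((\<lambda>t. g (T + t)) ` {0..}) (\<alpha> ` {0..})"
    by (rule finite_hausdorff_if_near_ray[OF \<alpha> q, of E]) (use close in auto)
  then have "finite_hausdorff (g ` {T..}) (\<alpha> ` {0..})" by (simp add: image_half_line)
  moreover have "finite_hausdorff (g ` {0..}) (g ` {T..})"
  proof (rule finite_hausdorffI)
    fix x assume "x \<in> g ` {0..}"
    then obtain t where t: "x = g t" "0 \<le> t" by auto
    have "dist (g t) (g (max t T)) \<le> l * dist t (max t T) + e" using qieD(4)[OF g] t T by auto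
    also have "\<dots> \<le> l * T + e" using l t T by (auto simp: dist_real_def intro!: mult_left_mono)
    finally show "within_distance (l * T + e) x (g ` {T..})" using t(1) unfolding within_distance_def by auto
  next
    show "within_distance 0 y (g ` {0..})" if "y \<in> g ` {T..}" for y
      using that T by (intro within_distance_self) auto
  qed
  ultimately show ?thesis using finite_hausdorff_trans by blast
qed

text \<open>The coarse coordinate \<open>\<tau>\<close> along the line eventually exceeds the jump
  size \<open>J\<close> in absolute value. From then on it cannot change sign, so the quasi-ray
  stays near one of the two half lines.\<close>

lemma quasi_ray_near_line:
  fixes \<gamma> :: "real \<Rightarrow> 'a::metric_space"
  assumes \<gamma>: "geodesic_on UNIV \<gamma>" and g: "qie l e {0..} g"
    and close: "\<And>t::real. 0 \<le> t \<Longrightarrow> within_distance E (g t) (range \<gamma>)"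
  shows "finite_hausdorff (g ` {0..}) (\<gamma> ` {0..}) \<or> finite_hausdorff (g ` {0..}) (\<gamma> ` {..0})"
proof -
  have l: "1 \<le> l" "0 \<le> e" using qieD[OF g] by auto
  have E: "0 \<le> E" by (rule within_distance_nonneg[OF close[OF order_refl]])
  have "\<exists>w. 0 \<le> t \<longrightarrow> dist (g t) (\<gamma> w) \<le> E" for t
    using close[of t] unfolding within_distance_def by auto
  then obtain \<tau> where \<tau>: "\<And>t. 0 \<le> t \<Longrightarrow> dist (g t) (\<gamma> (\<tau> t)) \<le> E" by metis
  have coarse: "\<bar>\<bar>\<tau> u - \<tau> v\<bar> - dist (g u) (g v)\<bar> \<le> 2 * E" if "0 \<le> u" "0 \<le> v" for u v
    using \<tau>[OF that(1)] \<tau>[OF that(2)] geodesic_onD[OF \<gamma>, of "\<tau> u" "\<tau> v"]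
        dist_triangle[of "g u" "g v" "\<gamma> (\<tau> u)"] dist_triangle[of "\<gamma> (\<tau> u)" "g v" "\<gamma> (\<tau> v)"]
        dist_triangle[of "\<gamma> (\<tau> u)" "\<gamma> (\<tau> v)" "g u"] dist_triangle[of "g u" "\<gamma> (\<tau> v)" "g v"]
      by (auto simp: dist_commute)
  define J where "J = l + e + 2 * E"
  have jump: "\<bar>\<tau> u - \<tau> v\<bar> \<le> J" if uv: "0 \<le> u" "0 \<le> v" "\<bar>u - v\<bar> \<le> 1" for u v
  proof -
    have "dist (g u) (g v) \<le> l * dist u v + e" using qieD(4)[OF g] uv by auto
    moreover have "l * dist u v \<le> l" using uv(3) l by (simp add: dist_real_def mult_left_le)
    ultimately show ?thesis using coarse[OF uv(1,2)] unfolding J_def by linarith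
  qed
  define T where "T = l * (e + 2 * E + J + 1 + \<bar>\<tau> 0\<bar>)"
  have T0: "0 \<le> T" using l E by (simp add: T_def J_def)
  have far: "J < \<bar>\<tau> t\<bar>" if t: "T \<le> t" for t
  proof -
    have "e + 2 * E + J + 1 + \<bar>\<tau> 0\<bar> \<le> t / l" using t l by (simp add: T_def le_divide_eq mult.commute)
    moreover have "t / l - e \<le> dist (g t) (g 0)" using qieD(3)[OF g, of t 0] t T0 by (simp add: dist_real_def)
    ultimately show ?thesis using coarse[of t 0] t T0 by linarith
  qed
  \<comment> \<open>Applied to \<open>\<tau>\<close> and to its negative; a change of sign would
    produce, by \<open>coarse_ivt\<close>, a value of size at most \<open>J\<close>.\<close>
  have sgn: "0 \<le> \<sigma> t"
    if \<sigma>: "\<And>u v. \<bar>\<sigma> u - \<sigma> v\<bar> = \<bar>\<tau> u - \<tau> v\<bar>" "\<And>u. \<bar>\<sigma> u\<bar> = \<bar>\<tau> u\<bar>" "0 \<le> \<sigma> T" and t: "T \<le> t" for \<sigma> t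
  proof (rule ccontr)
    assume "\<not> 0 \<le> \<sigma> t"
    then have "\<exists>v\<in>{T..t}. 0 - J \<le> - \<sigma> v \<and> - \<sigma> v \<le> 0"
      using t \<sigma>(1,3) jump T0 by (intro coarse_ivt) (auto simp: abs_minus_commute)
    then obtain v where v: "v \<in> {T..t}" "0 - J \<le> - \<sigma> v" "- \<sigma> v \<le> 0" by blast
    then have "\<bar>\<tau> v\<bar> \<le> J" using \<sigma>(2)[of v] by linarith
    then show False using far[of v] v(1) by auto
  qed
  show ?thesis
  proof (cases "0 \<le> \<tau> T")
    case True
    have "within_distance E (g t) (\<gamma> ` {0..})" if "T \<le> t" for t
      using sgn[of \<tau>, OF _ _ True that] \<tau>[of t] T0 that unfolding within_distance_def by auto
    from finite_hausdorff_if_eventually_near_ray[OF geodesic_on_subset[OF \<gamma>, of "{0..}"] g T0 this]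
    show ?thesis by simp
  next
    case False
    have "within_distance E (g t) ((\<lambda>t. \<gamma> (0 - t)) ` {0..})" if "T \<le> t" for t
    proof -
      have "0 \<le> - \<tau> t" using sgn[of "\<lambda>u. - \<tau> u" t] False that by (simp add: abs_minus_commute)
      then show ?thesis using \<tau>[of t] T0 that unfolding image_half_line within_distance_def by auto
    qed
    from finite_hausdorff_if_eventually_near_ray[OF geodesic_on_subset[OF geodesic_on_shift(2)[OF \<gamma>], of "{0..}"] g T0 this]
    have "finite_hausdorff (g ` {0..}) ((\<lambda>t. \<gamma> (0 - t)) ` {0..})" by simp
    then show ?thesis by (simp add: image_half_line)
  qed
qed

text \<open>The form in which \<open>center_map\<close> enters the estimates: no exceptional point,
  and one radius for source and image. It also describes the map built from the inverse of
  \<open>h\<close>.\<close>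

definition tracks_centers ::
    "'a::metric_space \<Rightarrow> ('a bpoint \<Rightarrow> 'b::metric_space bpoint) \<Rightarrow> gauge \<Rightarrow> real \<Rightarrow> ('a \<Rightarrow> 'b) \<Rightarrow> bool" where
  "tracks_centers p h N K f \<longleftrightarrow> (\<forall>x. \<exists>a b c. [a, b, c] \<in> morse_tuples p 3 N \<and> x \<in> centers K a b c \<and>
     f x \<in> centers K (h a) (h b) (h c))"

lemma coveredD:
  fixes p x :: "'a::metric_space"
  assumes "covered_by_centers p N K"
  shows "\<exists>a b c. [a, b, c] \<in> morse_tuples p 3 N \<and> x \<in> centers K a b c"
  using assms[unfolded covered_by_centers_def, THEN equalityD1] by blast

context quasi_moebius_map
begin

lemma ex_image_center:
  assumes M: "morse_gauge M"
  shows "\<exists>L. \<forall>a b c. [a, b, c] \<in> morse_tuples p 3 M \<longrightarrow> (\<exists>y. y \<in> centers L (h a) (h b) (h c))"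
proof -
  obtain M' where M': "morse_gauge M'" "map h ` morse_tuples p 2 M \<subseteq> morse_tuples r 2 M'"
    using stable M unfolding two_stable_def by blast
  have "\<exists>y. y \<in> centers (\<kappa> M') (h a) (h b) (h c)" if "[a, b, c] \<in> morse_tuples p 3 M" for a b c
    by (rule ex_center[OF Y _ image_triple(2)[OF M'(2) that]]) (use \<kappa>[OF M'(1)] in blast)
  then show ?thesis by blast
qed

lemma ex_tracks_centers:
  assumes N: "morse_gauge N" and cov: "covered_by_centers p N K"
  shows "\<exists>L f. tracks_centers p h N L f"
proof -
  obtain L where L: "\<And>a b c. [a, b, c] \<in> morse_tuples p 3 N \<Longrightarrow> \<exists>y. y \<in> centers L (h a) (h b) (h c)"
    using ex_image_center[OF N] by blast
  have "\<exists>y a b c. [a, b, c] \<in> morse_tuples p 3 N \<and> x \<in> centers (max K L) a b c \<and>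
    y \<in> centers (max K L) (h a) (h b) (h c)" for x
  proof -
    obtain a b c where abc: "[a, b, c] \<in> morse_tuples p 3 N" "x \<in> centers K a b c" using coveredD[OF cov] by blast
    obtain y where "y \<in> centers L (h a) (h b) (h c)" using L[OF abc(1)] by blast
    then have "y \<in> centers (max K L) (h a) (h b) (h c)" by (rule centers_mono) simp
    moreover have "x \<in> centers (max K L) a b c" by (rule centers_mono[OF abc(2)]) simp
    ultimately show ?thesis using abc(1) by blast
  qed
  then have "\<exists>f. \<forall>x. \<exists>a b c. [a, b, c] \<in> morse_tuples p 3 N \<and> x \<in> centers (max K L) a b c \<and>
    f x \<in> centers (max K L) (h a) (h b) (h c)" by (rule choice[OF allI])
  then show ?thesis unfolding tracks_centers_def by blast
qed

text \<open>The prescribed value \<open>f p = r\<close> bears no relation to centers. It is at some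
  finite distance from the value of another tracking map \<open>g\<close>, and for a single point a
  larger radius absorbs this distance.\<close>

lemma center_map_tracks_centers:
  assumes N: "morse_gauge N" and cov: "covered_by_centers p N K" and f: "center_map p r h N K f"
  shows "\<exists>L. tracks_centers p h N L f"
proof -
  obtain M g where g: "tracks_centers p h N M g" using ex_tracks_centers[OF N cov] by blast
  define L where "L = max K (M + dist (f p) (g p))"
  have "\<exists>a b c. [a, b, c] \<in> morse_tuples p 3 N \<and> x \<in> centers L a b c \<and> f x \<in> centers L (h a) (h b) (h c)" for x
  proof (cases "x = p")
    case True
    obtain a b c where abc: "[a, b, c] \<in> morse_tuples p 3 N" "x \<in> centers M a b c" "g x \<in> centers M (h a) (h b) (h c)"
      using g unfolding tracks_centers_def by blast
    have "x \<in> centers L a b c" by (rule centers_mono[OF abc(2)]) (simp add: L_def le_max_iff_disj)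
    moreover have "f x \<in> centers L (h a) (h b) (h c)"
      by (rule centers_mono[OF centers_move[OF abc(3) order_refl]]) (simp add: L_def True)
    ultimately show ?thesis using abc(1) by blast
  next
    case False
    then obtain a b c T where *: "[a, b, c] \<in> morse_tuples p 3 N" "ideal_triangle a b c T" "close_to_sides K x T"
      "f x \<in> centers K (h a) (h b) (h c)" using f unfolding center_map_def by blast
    then have "x \<in> centers K a b c" unfolding centers_def by blast
    then have "x \<in> centers L a b c" by (rule centers_mono) (simp add: L_def)
    moreover have "f x \<in> centers L (h a) (h b) (h c)" by (rule centers_mono[OF *(4)]) (simp add: L_def)
    ultimately show ?thesis using *(1) by blast
  qed
  then show ?thesis unfolding tracks_centers_def by blast
qed

lemma tracks_centers_coarse_lipschitz:
  assumes f: "tracks_centers p h N K f"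
  shows "\<exists>E\<ge>0. \<forall>x y. dist (f x) (f y) \<le> E * dist x y + E"
proof -
  obtain E where E: "\<forall>x x' a b c a' b' c' y y'. [a, b, c] \<in> morse_tuples p 3 N \<longrightarrow>
    x \<in> centers K a b c \<longrightarrow> y \<in> centers K (h a) (h b) (h c) \<longrightarrow> [a', b', c'] \<in> morse_tuples p 3 N \<longrightarrow>
    x' \<in> centers K a' b' c' \<longrightarrow> y' \<in> centers K (h a') (h b') (h c') \<longrightarrow> dist x x' \<le> 1 \<longrightarrow> dist y y' \<le> E"
    using image_centers_close[of N K K 1] by blast
  have unit: "dist (f x) (f y) \<le> E" if d: "dist x y \<le> 1" for x y
  proof -
    obtain a b c where abc: "[a, b, c] \<in> morse_tuples p 3 N" "x \<in> centers K a b c"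
        "f x \<in> centers K (h a) (h b) (h c)"
      using f unfolding tracks_centers_def by blast
    obtain a' b' c' where abc': "[a', b', c'] \<in> morse_tuples p 3 N" "y \<in> centers K a' b' c'"
        "f y \<in> centers K (h a') (h b') (h c')"
      using f unfolding tracks_centers_def by blast
    show ?thesis by (rule E[rule_format, OF abc abc' d])
  qed
  have "0 \<le> E" using unit[of p p] by simp
  then have "dist (f x) (f y) \<le> E * dist x y + E" for x y
    by (rule coarse_lipschitz_if_unit_bound[where f = f, OF X _ unit])
  with \<open>0 \<le> E\<close> show ?thesis by blast
qed

text \<open>Two triples have \<open>g y\<close> as a center: the one chosen by \<open>f\<close>, and
  the image under \<open>h'\<close> of the one chosen by \<open>g\<close> at \<open>y\<close>. Since
  \<open>h\<close> undoes \<open>h'\<close>, their images under \<open>h\<close> have centers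
  \<open>f (g y)\<close> and \<open>y\<close>.\<close>

lemma tracks_centers_inverse:
  assumes f: "tracks_centers p h N K f" and g: "tracks_centers r h' N L g"
    and h': "map h' ` morse_tuples r 2 N \<subseteq> morse_tuples p 2 N'" "\<And>b. b \<in> morse_boundary r \<Longrightarrow> h (h' b) = b"
  shows "\<exists>D. \<forall>y. dist (f (g y)) y \<le> D"
proof -
  define M where "M = sup_gauge N N'"
  define C where "C = max K L"
  obtain E where E: "\<forall>x x' a b c a' b' c' y y'. [a, b, c] \<in> morse_tuples p 3 M \<longrightarrow>
    x \<in> centers C a b c \<longrightarrow> y \<in> centers C (h a) (h b) (h c) \<longrightarrow> [a', b', c'] \<in> morse_tuples p 3 M \<longrightarrow>
    x' \<in> centers C a' b' c' \<longrightarrow> y' \<in> centers C (h a') (h b') (h c') \<longrightarrow> dist x x' \<le> 0 \<longrightarrow> dist y y' \<le> E"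
    using image_centers_close[of M C C 0] by blast
  have "dist (f (g y)) y \<le> E" for y
  proof -
    obtain a b c where abc: "[a, b, c] \<in> morse_tuples p 3 N" "g y \<in> centers K a b c"
        "f (g y) \<in> centers K (h a) (h b) (h c)"
      using f unfolding tracks_centers_def by blast
    obtain u v w where uvw: "[u, v, w] \<in> morse_tuples r 3 N" "y \<in> centers L u v w"
        "g y \<in> centers L (h' u) (h' v) (h' w)"
      using g unfolding tracks_centers_def by blast
    have "[h' s, h' t] \<in> morse_tuples p 2 N'" if "[s, t] \<in> morse_tuples r 2 N" for s t
      using imageI[OF that, of "map h'"] h'(1) by auto
    then have "[h' u, h' v, h' w] \<in> morse_tuples p 3 N'" using uvw(1) unfolding morse_triple_iff by blast
    then have t: "[h' u, h' v, h' w] \<in> morse_tuples p 3 M" "[a, b, c] \<in> morse_tuples p 3 M"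
      using abc(1) morse_triple_sup_gauge unfolding M_def by blast+
    have "h (h' u) = u" "h (h' v) = v" "h (h' w) = w"
      using uvw(1) h'(2) unfolding morse_triple_iff morse_pair_iff by auto
    then have y: "y \<in> centers C (h (h' u)) (h (h' v)) (h (h' w))"
      using centers_mono[OF uvw(2), of C] by (simp add: C_def)
    have C: "K \<le> C" "L \<le> C" by (auto simp: C_def)
    show ?thesis
      by (rule E[rule_format, OF t(2) centers_mono[OF abc(2) C(1)] centers_mono[OF abc(3) C(1)] t(1) centers_mono[OF uvw(3) C(2)] y])
        simp
  qed
  then show ?thesis by blast
qed

text \<open>\<open>a\<close> and \<open>b\<close> each rule out at most one of the three separated
  points chosen by \<open>f\<close> at \<open>x\<close>, so some \<open>i\<close> among them is
  separated from both. Comparing the two triples puts \<open>f x\<close> near a center of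
  \<open>(h a, h b, h i)\<close>, hence near \<open>\<gamma>'\<close>.\<close>

lemma tracks_centers_image_line:
  assumes f: "tracks_centers p h N K f"
    and ab: "a \<in> morse_boundary p" "b \<in> morse_boundary p" "a \<noteq> b"
    and l: "line_between a b \<gamma>" "line_between (h a) (h b) \<gamma>'"
  shows "\<exists>E. \<forall>t. within_distance E (f (\<gamma> t)) (range \<gamma>')"
proof -
  obtain M\<^sub>0 where M0: "[a, b] \<in> morse_tuples p 2 M\<^sub>0" using ex_morse_pair[OF X ab] by blast
  \<comment> \<open>\<open>M\<^sub>1\<close> makes all five points visible from \<open>x\<close>,
    \<open>M\<close> makes the pairs among them Morse, and \<open>M\<^sub>2\<close> receives both
    triples to be compared. All may depend on \<open>a\<close> and \<open>b\<close>.\<close>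
  define M\<^sub>1 where "M\<^sub>1 = sup_gauge M\<^sub>0 N"
  define M where "M = line_gauge K M\<^sub>1"
  have M: "morse_gauge M" by (simp add: M_def)
  define S where "S = max 0 (slim_constant M (\<kappa> M))"
  obtain M' where M': "morse_gauge M'" "map h ` morse_tuples p 2 M \<subseteq> morse_tuples r 2 M'"
    using stable M unfolding two_stable_def by blast
  define C where "C = max (K + S) (\<kappa> M')"
  define M\<^sub>2 where "M\<^sub>2 = sup_gauge N M"
  obtain E where E: "\<forall>x x' a b c a' b' c' y y'. [a, b, c] \<in> morse_tuples p 3 M\<^sub>2 \<longrightarrow>
    x \<in> centers C a b c \<longrightarrow> y \<in> centers C (h a) (h b) (h c) \<longrightarrow> [a', b', c'] \<in> morse_tuples p 3 M\<^sub>2 \<longrightarrow>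
    x' \<in> centers C a' b' c' \<longrightarrow> y' \<in> centers C (h a') (h b') (h c') \<longrightarrow> dist x x' \<le> 0 \<longrightarrow> dist y y' \<le> E"
    using image_centers_close[of M\<^sub>2 C C 0] by blast
  have "within_distance (\<kappa> M' + M' (9, 4) + E) (f (\<gamma> t)) (range \<gamma>')" for t
  proof -
    define x where "x = \<gamma> t"
    obtain u v w where uvw: "[u, v, w] \<in> morse_tuples p 3 N" "x \<in> centers K u v w" "f x \<in> centers K (h u) (h v) (h w)"
      using f unfolding tracks_centers_def by blast
    have K0: "0 \<le> K" using uvw(2) near_line_nonneg unfolding centers_iff by blast
    have nab: "near_line K x a b" unfolding near_line_def x_def
      using l(1) K0 by (intro exI[of _ \<gamma>]) (auto intro: within_distance_self)
    have pab: "[a, b] \<in> morse_tuples p 2 M\<^sub>1" and tuvw: "[u, v, w] \<in> morse_tuples p 3 M\<^sub>1"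
      using morse_pair_sup_gauge(1)[OF M0] morse_triple_sup_gauge(2)[OF uvw(1)] unfolding M\<^sub>1_def by auto
    note vis = visible_if_near_line[OF pab nab] visible_if_center[OF tuvw uvw(2)]
    have sep: "separated K x u v" "separated K x v w" "separated K x w u"
      using uvw(1,2) unfolding separated_def centers_iff morse_triple_iff morse_pair_iff by auto
    have split: "separated (K + S) x s q \<or> separated (K + S) x s' q"
      if "visible p M\<^sub>1 K x s" "visible p M\<^sub>1 K x s'" "visible p M\<^sub>1 K x q" "separated K x s s'" for s s' q
      by (rule separated_split[OF X, of p K M\<^sub>1 "\<kappa> M"]) (use that \<kappa>[OF M] in \<open>auto simp: M_def S_def\<close>)
    have "\<exists>i. visible p M\<^sub>1 K x i \<and> separated (K + S) x i a \<and> separated (K + S) x i b"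
      using split[OF vis(3,4,1) sep(1)] split[OF vis(4,5,1) sep(2)] split[OF vis(5,3,1) sep(3)]
        split[OF vis(3,4,2) sep(1)] split[OF vis(4,5,2) sep(2)] split[OF vis(5,3,2) sep(3)] vis by blast
    then obtain i where i: "visible p M\<^sub>1 K x i" "separated (K + S) x i a" "separated (K + S) x i b" by blast
    have "i \<noteq> a" "i \<noteq> b" using i(2,3) unfolding separated_def by auto
    then have abi: "[a, b, i] \<in> morse_tuples p 3 M"
      using morse_pair_if_visible[OF X] vis i(1) ab(3) unfolding morse_triple_iff M_def by metis
    have "x \<in> centers (K + S) a b i"
      using i(2,3) near_line_sym near_line_mono[OF nab, of "K + S"] unfolding centers_iff separated_def S_def by auto
    then have xabi: "x \<in> centers C a b i" by (rule centers_mono) (simp add: C_def)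
    obtain y where y: "y \<in> centers (\<kappa> M') (h a) (h b) (h i)"
      using ex_center[OF Y _ image_triple(2)[OF M'(2) abi]] \<kappa>[OF M'(1)] by blast
    have KC: "K \<le> C" by (simp add: C_def S_def le_max_iff_disj)
    have t: "[u, v, w] \<in> morse_tuples p 3 M\<^sub>2" "[a, b, i] \<in> morse_tuples p 3 M\<^sub>2"
      unfolding M\<^sub>2_def by (rule morse_triple_sup_gauge[OF uvw(1)], rule morse_triple_sup_gauge[OF abi])
    have "y \<in> centers C (h a) (h b) (h i)" by (rule centers_mono[OF y]) (simp add: C_def)
    then have "dist (f x) y \<le> E"
      by (rule E[rule_format, OF t(1) centers_mono[OF uvw(2) KC] centers_mono[OF uvw(3) KC] t(2) xabi]) simp
    moreover have "within_distance (\<kappa> M' + M' (9, 4)) y (range \<gamma>')"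
      by (rule near_fixed_line[OF Y _ _ l(2)])
        (use image_triple(2)[OF M'(2) abi] y in \<open>auto simp: morse_triple_iff centers_iff\<close>)
    ultimately show ?thesis using within_distance_triangle unfolding x_def by blast
  qed
  then show ?thesis by blast
qed

lemma tracks_centers_image_ray:
  assumes f: "tracks_centers p h N K f" "qie l e UNIV f"
    and h: "inj_on h (morse_boundary p)" "h ` morse_boundary p \<subseteq> morse_boundary r"
    and b: "b \<in> morse_boundary p" "\<beta> \<in> b"
  shows "asymptotic_to (f ` \<beta> ` {0..}) (h b)"
proof -
  have l: "1 \<le> l" "0 \<le> e" using qieD[OF f(2)] by auto
  have f_close: "within_distance (l * H + e) (f x) (f ` A)" if x: "within_distance H x A" for H x A
  proof -
    obtain y where y: "y \<in> A" "dist x y \<le> H" using x unfolding within_distance_def by blast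
    have "dist (f x) (f y) \<le> l * dist x y + e" using qieD(4)[OF f(2)] by simp
    also have "\<dots> \<le> l * H + e" using y(2) l by (simp add: mult_left_mono)
    finally show ?thesis using y(1) unfolding within_distance_def by blast
  qed
  have "\<exists>u v w. [u, v, w] \<in> morse_tuples p 3 N" using f(1) unfolding tracks_centers_def by blast
  then obtain u v w where "u \<noteq> v" "v \<noteq> w" "w \<noteq> u" "{u, v, w} \<subseteq> morse_boundary p"
    unfolding morse_triple_iff morse_pair_iff by blast
  then obtain c d where cd: "c \<in> morse_boundary p" "d \<in> morse_boundary p" "c \<noteq> b" "d \<noteq> b" "c \<noteq> d"
    by (metis insert_subset)
  have hb: "h b \<in> morse_boundary r" "h c \<in> morse_boundary r" "h d \<in> morse_boundary r"
    using h(2) b(1) cd by auto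
  note hv = hb[THEN morse_boundaryD(1)]
  have ne: "h c \<noteq> h b" "h d \<noteq> h b" "h c \<noteq> h d" using inj_onD[OF h(1)] b(1) cd by metis+
  obtain \<gamma> \<eta> where \<gamma>: "line_between c b \<gamma>" and \<eta>: "line_between d b \<eta>" using ex_line_between[OF X] b(1) cd by metis
  obtain \<gamma>' \<eta>' where \<gamma>': "line_between (h c) (h b) \<gamma>'" and \<eta>': "line_between (h d) (h b) \<eta>'"
    using ex_line_between[OF Y] hb ne by metis
  define g where "g t = f (\<gamma> t)" for t
  have q: "qie l e {0..} g" unfolding g_def quasi_isometric_embedding_def
    using qieD[OF f(2)] by (simp add: dist_real_def geodesic_onD[OF line_betweenD[OF \<gamma>], symmetric])
  obtain E\<^sub>1 where E1: "\<And>t. within_distance E\<^sub>1 (g t) (range \<gamma>')"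
    using tracks_centers_image_line[OF f(1) cd(1) b(1) cd(3) \<gamma> \<gamma>'] unfolding g_def by blast
  obtain E\<^sub>2 where E2: "\<And>t. within_distance E\<^sub>2 (f (\<eta> t)) (range \<eta>')"
    using tracks_centers_image_line[OF f(1) cd(2) b(1) cd(4) \<eta> \<eta>'] by blast
  note bv = morse_boundaryD(1)[OF b(1)]
  \<comment> \<open>The two lines are asymptotic at \<open>b\<close>, so the single quasi-ray
    \<open>g\<close> is also near \<open>\<eta>'\<close>.\<close>
  have "finite_hausdorff (\<gamma> ` {0..}) (\<eta> ` {0..})"
    using asymptotic_to_imp_finite_hausdorff[OF bv] \<gamma> \<eta> unfolding line_between_def by blast
  then obtain H where H: "\<And>t. 0 \<le> t \<Longrightarrow> within_distance H (\<gamma> t) (\<eta> ` {0..})" unfolding finite_hausdorff_def by blast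
  have E2': "within_distance (E\<^sub>2 + (l * H + e)) (g t) (range \<eta>')" if t: "0 \<le> t" for t
  proof -
    obtain y where "y \<in> f ` \<eta> ` {0..}" "dist (g t) y \<le> l * H + e"
      using f_close[OF H[OF t]] unfolding g_def within_distance_def by blast
    then show ?thesis using within_distance_triangle[OF E2] by blast
  qed
  have "asymptotic_to (g ` {0..}) (h b) \<or> asymptotic_to (g ` {0..}) (h c)"
    using quasi_ray_near_line[OF line_betweenD[OF \<gamma>'] q E1] \<gamma>' asymptotic_to_cong finite_hausdorff_sym
    unfolding line_between_def by blast
  moreover have "asymptotic_to (g ` {0..}) (h b) \<or> asymptotic_to (g ` {0..}) (h d)"
    using quasi_ray_near_line[OF line_betweenD[OF \<eta>'] q E2'] \<eta>' asymptotic_to_cong finite_hausdorff_sym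
    unfolding line_between_def by blast
  ultimately have gb: "asymptotic_to (g ` {0..}) (h b)" using asymptotic_to_unique[OF hv(2,3)] ne(3) by blast
  have "asymptotic_to (\<beta> ` {0..}) b"
    using b(2) bpoint_mem_iff[OF bv b(2), of \<beta>] unfolding asymptotic_to_def by blast
  then have "finite_hausdorff (\<gamma> ` {0..}) (\<beta> ` {0..})"
    using asymptotic_to_imp_finite_hausdorff[OF bv] \<gamma> unfolding line_between_def by blast
  then obtain H' where H': "\<And>x. x \<in> \<gamma> ` {0..} \<Longrightarrow> within_distance H' x (\<beta> ` {0..})"
    "\<And>x. x \<in> \<beta> ` {0..} \<Longrightarrow> within_distance H' x (\<gamma> ` {0..})" unfolding finite_hausdorff_def by blast
  have "finite_hausdorff (f ` \<gamma> ` {0..}) (f ` \<beta> ` {0..})"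
    by (rule finite_hausdorffI[of _ "l * H' + e" _ "l * H' + e"]) (use f_close H' in blast)+
  moreover have "g ` {0..} = f ` \<gamma> ` {0..}" by (auto simp: g_def)
  ultimately show ?thesis using asymptotic_to_cong gb by metis
qed

text \<open>\<open>induced_map\<close> collects rays over all representatives of \<open>b\<close>.
  The image of each one is asymptotic to \<open>h b\<close>, so each already yields the whole
  class.\<close>

lemma induced_map_eq:
  assumes f: "tracks_centers p h N K f" "qie l e UNIV f"
    and h: "inj_on h (morse_boundary p)" "h ` morse_boundary p \<subseteq> morse_boundary r"
    and b: "b \<in> morse_boundary p"
  shows "induced_map r f b = h b"
proof (rule set_eqI)
  fix \<beta>
  have hv: "h b \<in> visual_boundary r" using h(2) b morse_boundaryD(1) by blast
  have *: "\<beta> \<in> h b \<longleftrightarrow> geodesic_ray r \<beta> \<and> finite_hausdorff (f ` \<gamma> ` {0..}) (\<beta> ` {0..})" if \<gamma>: "\<gamma> \<in> b" for \<gamma>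
  proof -
    obtain \<beta>' where \<beta>': "\<beta>' \<in> h b" "finite_hausdorff (f ` \<gamma> ` {0..}) (\<beta>' ` {0..})"
      using tracks_centers_image_ray[OF f h b \<gamma>] unfolding asymptotic_to_def by blast
    show ?thesis
      using bpoint_mem_iff[OF hv \<beta>'(1), of \<beta>] \<beta>'(2) finite_hausdorff_trans finite_hausdorff_sym by blast
  qed
  obtain \<gamma> where "\<gamma> \<in> b" using bpoint_nonempty morse_boundaryD(1)[OF b] by blast
  then show "\<beta> \<in> induced_map r f b \<longleftrightarrow> \<beta> \<in> h b" using * unfolding induced_map_def by blast
qed

end

theorem theorem4p4:
  fixes p :: "'a::metric_space" and r :: "'b::metric_space"
    and \<kappa> :: "gauge \<Rightarrow> real"
    and h :: "'a bpoint \<Rightarrow> 'b bpoint"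
    and N N\<^sub>h :: gauge and K\<^sub>0 :: real
  assumes X: "proper_geodesic_space TYPE('a)" and Y: "proper_geodesic_space TYPE('b)"
    and \<kappa>: "\<And>M. morse_gauge M \<Longrightarrow> \<kappa> M > 0 \<and> triangle_constant p M (\<kappa> M) \<and> triangle_constant r M (\<kappa> M)"
    and "morse_center_space p" and "morse_center_space r"
    and "small_cross_ratio \<kappa> p" and "small_cross_ratio \<kappa> r"
    and "homeomorphic_map (morse_topology p) (morse_topology r) h"
    and "two_stable p r h" and "quasi_moebius \<kappa> p r h"
    and "two_stable r p (inv_into (morse_boundary p) h)"
    and "quasi_moebius \<kappa> r p (inv_into (morse_boundary p) h)"
    and "morse_gauge N" and "K\<^sub>0 > 0"
    and "\<And>K. K \<ge> K\<^sub>0 \<Longrightarrow> covered_by_centers p N K \<and> covered_by_centers r N K"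
    and "morse_gauge N\<^sub>h" and "N \<le> N\<^sub>h"
    and "map h ` morse_tuples p 3 N \<subseteq> morse_tuples r 3 N\<^sub>h"
  shows "\<exists>K\<^sub>1 \<ge> max K\<^sub>0 (\<kappa> N\<^sub>h). \<forall>K \<ge> K\<^sub>1. \<forall>f. center_map p r h N K f \<longrightarrow>
           quasi_isometry f \<and> (\<forall>b\<in>morse_boundary p. induced_map r f b = h b)"
proof (intro exI[of _ "max K\<^sub>0 (\<kappa> N\<^sub>h)"] conjI order_refl allI impI)
  fix K f
  assume K: "max K\<^sub>0 (\<kappa> N\<^sub>h) \<le> K" and f: "center_map p r h N K f"
  define h' where "h' = inv_into (morse_boundary p) h"
  interpret A: quasi_moebius_map \<kappa> p r h using X Y \<kappa> assms(9,10) by unfold_locales auto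
  interpret B: quasi_moebius_map \<kappa> r p h' using X Y \<kappa> assms(11,12) unfolding h'_def by unfold_locales auto
  have inj: "inj_on h (morse_boundary p)" and img: "h ` morse_boundary p = morse_boundary r"
    using homeomorphic_imp_injective_map[OF assms(8)] homeomorphic_imp_surjective_map[OF assms(8)] by auto
  have cov: "covered_by_centers p N K" "covered_by_centers r N K" using assms(15)[of K] K by auto
  obtain L where tf: "tracks_centers p h N L f"
    using A.center_map_tracks_centers[OF assms(13) cov(1) f] by blast
  obtain L' g where tg: "tracks_centers r h' N L' g" using B.ex_tracks_centers[OF assms(13) cov(2)] by blast
  obtain M where M: "map h ` morse_tuples p 2 N \<subseteq> morse_tuples r 2 M"
    using assms(9,13) unfolding two_stable_def by blast
  obtain M' where M': "map h' ` morse_tuples r 2 N \<subseteq> morse_tuples p 2 M'"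
    using assms(11,13) unfolding two_stable_def h'_def by blast
  have hh': "h (h' b) = b" if "b \<in> morse_boundary r" for b
    unfolding h'_def by (rule f_inv_into_f) (use that img in blast)
  have h'h: "h' (h b) = b" if "b \<in> morse_boundary p" for b
    unfolding h'_def by (rule inv_into_f_f[OF inj that])
  obtain E where E: "0 \<le> E" "\<And>x y. dist (f x) (f y) \<le> E * dist x y + E"
    using A.tracks_centers_coarse_lipschitz[OF tf] by blast
  obtain E' where E': "0 \<le> E'" "\<And>x y. dist (g x) (g y) \<le> E' * dist x y + E'"
    using B.tracks_centers_coarse_lipschitz[OF tg] by blast
  obtain D where D: "\<And>y. dist (f (g y)) y \<le> D" using A.tracks_centers_inverse[OF tf tg M' hh'] by blast
  obtain D' where D': "\<And>x. dist (g (f x)) x \<le> D'" using B.tracks_centers_inverse[OF tg tf M h'h] by blast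
  show qi: "quasi_isometry f" by (rule quasi_isometry_if_coarse_inverse[OF E(1) E'(1) E(2) E'(2) D' D])
  then obtain l e where "qie l e UNIV f" unfolding quasi_isometry_def by blast
  then show "\<forall>b\<in>morse_boundary p. induced_map r f b = h b"
    using A.induced_map_eq[OF tf _ inj] img by blast
qed

end
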